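(* Let $1\le n\le m$ be integers, $\theta>0$, $L>0$, $\sigma\ge 0$, $\hat G>0$, $f_*\in\mathbb R$, and let $f(X)=\mathbb E_{\xi\sim\mathcal D}[f(X;\xi)]$, $X\in\mathbb R^{m\times n}$, satisfy: (i) $f(X)\ge f_*$ for all $X$; (ii) for all $X$, $\mathbb E_\xi[\nabla f(X;\xi)]=\nabla f(X)$ and $\mathbb E_\xi[\|\nabla f(X;\xi)-\nabla f(X)\|_F^2]\le\sigma^2$; (iii) $\|\nabla f(X)-\nabla f(Y)\|_F\le L\|X-Y\|_F$ for all $X,Y$; (iv) almost surely, $\|\nabla f(X;\xi)\|_F\le\hat G$ for all $X$. Let $(X_t)_{t\ge1}$ be generated by OptMuon-A (defined in the context) with learning rate $\theta$ and initial point $X_1$. Then for every integer $T\ge1$, with $C_z:=\sqrt{2C_v}+\sqrt{2\varpi C_c}$, $C_{A,1}:=C_z\sqrt{2+8C_z^2}$ and $C_{A,2}:=2^{3/4}C_z$ (where $\varpi,C_c,C_v$ are the explicit constants, independent of $T$ and $\sigma$, defined in the context), $$\mathbb E\Big[\frac1T\sum_{t=1}^T\|\nabla f(X_t)\|_F\Big]\le C_{A,1}\frac{\ln^2(e+T)}{T^{1/2}}+C_{A,2}\frac{\sigma^{1/2}\ln(e+T)}{T^{1/4}}.$$ Consequently, if $R$ is uniformly distributed on $\{1,\dots,T\}$ and independent of the algorithmic randomness, and $X_{\rm out}:=X_R$, then the same bound holds for $\mathbb E[\|\nabla f(X_{\rm out})\|_F]$.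
   Context: Notation: $\|\cdot\|_F$, $\|\cdot\|_2$, $\|\cdot\|_*$ are the Frobenius, spectral and nuclear norms; $\langle A,B\rangle=\mathrm{tr}(A^\top B)$. The objective $f$ and the sample functions $f(\cdot;\xi)$ are differentiable. Orthogonalization: for $M\in\mathbb R^{m\times n}$ with thin SVD $M=U\Sigma W^\top$, $\mathrm{Orth}(M):=UW^\top$ where $U^\top U=W^\top W=I_n$; if $M$ is rank-deficient, $\mathrm{Orth}(M)$ is any measurable choice of a thin-SVD completion, so that $\|\mathrm{Orth}(M)\|_2=1$, $\|\mathrm{Orth}(M)\|_F^2=n$ and $\langle \mathrm{Orth}(M),M\rangle=\|M\|_*\ge\|M\|_F$. OptMuon-A: fix a deterministic $X_1\in\mathbb R^{m\times n}$; set $X_0=X_1$, $M_0=0$, $\rho_{-1}=\rho_0=1$, $\alpha_0=\alpha_1=1$. For $t=1,2,\dots$: draw $\xi_t\sim\mathcal D$ independently of the past; set $G_t=\nabla f(X_t;\xi_t)$, $g_t=\|G_t\|_F$; $\alpha_t=\rho_{t-1}$ and $\rho_t=\Big(\frac{1+\max_{1\le i\le t}g_i^2}{1+\sum_{i=1}^tg_i^2}\Big)^{1/2}$; $M_t=G_t+(1-\alpha_t)M_{t-1}$; $\gamma_t=\min\big\{\alpha_t^2,\ \alpha_t\big(1+\sum_{j=1}^t\alpha_j\|M_j\|_F^2\big)^{-1/2}\big\}$; $X_{t+1}=X_t-\theta\gamma_t\|M_t\|_F\,\mathrm{Orth}(M_t)$. Constants: $\varpi:=\sqrt{1+\hat G^2}$,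 $\kappa:=2(1+\hat G)$, $\delta:=nL^2\theta^2$, $c_0:=\theta/2$, $c_1:=\theta n/2$, $c_2:=Ln\theta^2/2$, $F_1:=f(X_1)-f_*$, $C_b:=\big(52\varpi^5+9\delta\ln(e+\varpi\kappa)\big)\ln(e+\hat G^2)$, $C_c:=2C_b$, $C_d:=3\kappa^3\ln(e+\kappa)\ln(e+\hat G^2)$, $C_e:=(88\varpi^5+6\delta)\ln(e+\hat G^2)$, $C_u:=\big(36\varpi^4\ln(e+\hat G^2)+2C_e\big)C_c$, $C_w:=\frac1{c_0}(F_1+c_1C_c+c_2C_d)$, $C_x:=\frac{3}{c_0^2}(F_1^2+c_1^2C_u+c_2^2C_d^2)$, $C_v:=4\varpi^4(C_w+C_x)$. *)

theory Defs
  imports "HOL-Probability.Probability"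
begin

text \<open>
  Matrices with m rows and n columns have type \<^typ>\<open>real^'n^'m\<close>. The library's
  \<^const>\<open>inner\<close> and \<^const>\<open>norm\<close> on this type are the entrywise (Frobenius) ones.
\<close>

definition grad :: "('a::euclidean_space \<Rightarrow> real) \<Rightarrow> 'a \<Rightarrow> 'a" where
  "grad f x = (THE g. GDERIV f x :> g)"

lemma GDERIV_grad:
  assumes "f differentiable (at x)"
  shows "GDERIV f x :> grad f x"
proof -
  obtain f' where f': "(f has_derivative f') (at x)"
    using assms by (auto simp: differentiable_def)
  then have lin: "linear f'"
    by (rule has_derivative_linear)
  have "f' = (\<lambda>h. h \<bullet> adjoint f' 1)"
    using adjoint_works[OF lin, of _ 1] by (simp add: fun_eq_iff)
  with f' have "GDERIV f x :> adjoint f' 1"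
    unfolding gderiv_def by (rule subst[rotated])
  moreover have "g = g'" if "GDERIV f x :> g" "GDERIV f x :> g'" for g g'
  proof -
    have "(\<lambda>h. h \<bullet> g) = (\<lambda>h. h \<bullet> g')"
      using that unfolding gderiv_def by (rule has_derivative_unique)
    then show ?thesis
      by (metis inner_commute vector_eq_ldot)
  qed
  ultimately show ?thesis
    unfolding grad_def by (metis theI')
qed

text \<open>
  Thin SVD for m at least n. The index type carries no order, so the singular values on the
  diagonal of S are not sorted; this does not affect the possible values of the product U W^T.
\<close>

definition thin_svd :: "real^'n^'m \<Rightarrow> real^'n^'m \<Rightarrow> real^'n^'n \<Rightarrow> real^'n^'n \<Rightarrow> bool" where
  "thin_svd M U S W \<longleftrightarrow>
     transpose U ** U = mat 1 \<and> transpose W ** W = mat 1 \<and>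
     (\<forall>i j. i \<noteq> j \<longrightarrow> S $ i $ j = 0) \<and> (\<forall>i. S $ i $ i \<ge> 0) \<and>
     M = U ** S ** transpose W"

definition orthogonalization :: "(real^'n^'m \<Rightarrow> real^'n^'m) \<Rightarrow> bool" where
  "orthogonalization Orth \<longleftrightarrow>
     Orth \<in> borel_measurable borel \<and>
     (\<forall>M. \<exists>U S W. thin_svd M U S W \<and> Orth M = U ** transpose W)"

text \<open>The scalar and momentum sequences below are functionals of the gradient sequence \<open>G\<close>.\<close>

definition muon_rho :: "(nat \<Rightarrow> 'a::real_normed_vector) \<Rightarrow> nat \<Rightarrow> real" where
  "muon_rho G t =
     (if t = 0 then 1
      else sqrt ((1 + (MAX i\<in>{1..t}. (norm (G i))\<^sup>2)) / (1 + (\<Sum>i=1..t. (norm (G i))\<^sup>2))))"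

definition muon_alpha :: "(nat \<Rightarrow> 'a::real_normed_vector) \<Rightarrow> nat \<Rightarrow> real" where
  "muon_alpha G t = (if t = 0 then 1 else muon_rho G (t - 1))"

fun muon_M :: "(nat \<Rightarrow> 'a::real_normed_vector) \<Rightarrow> nat \<Rightarrow> 'a" where
  "muon_M G 0 = 0"
| "muon_M G (Suc t) = G (Suc t) + (1 - muon_alpha G (Suc t)) *\<^sub>R muon_M G t"

definition muon_gamma :: "(nat \<Rightarrow> 'a::real_normed_vector) \<Rightarrow> nat \<Rightarrow> real" where
  "muon_gamma G t =
     min ((muon_alpha G t)\<^sup>2)
         (muon_alpha G t / sqrt (1 + (\<Sum>j=1..t. muon_alpha G j * (norm (muon_M G j))\<^sup>2)))"

text \<open>
  The iterates along a sample path \<open>\<xi>\<close>. Cutting \<open>G\<close> off after \<open>t\<close> only serves the termination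
  proof: \<^const>\<open>muon_gamma\<close> and \<^const>\<open>muon_M\<close> at \<open>t\<close> do not look at later gradients.
\<close>

fun optmuon_A ::
  "(real^'n^'m \<Rightarrow> 'x \<Rightarrow> real) \<Rightarrow> (real^'n^'m \<Rightarrow> real^'n^'m) \<Rightarrow> real \<Rightarrow> real^'n^'m \<Rightarrow>
     (nat \<Rightarrow> 'x) \<Rightarrow> nat \<Rightarrow> real^'n^'m" where
  "optmuon_A F Orth \<theta> X1 \<xi> 0 = X1"
| "optmuon_A F Orth \<theta> X1 \<xi> (Suc t) =
     (if t = 0 then X1
      else let G = (\<lambda>s. if s \<le> t then grad (\<lambda>Y. F Y (\<xi> s)) (optmuon_A F Orth \<theta> X1 \<xi> s) else 0)
           in optmuon_A F Orth \<theta> X1 \<xi> t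
                - (\<theta> * muon_gamma G t * norm (muon_M G t)) *\<^sub>R Orth (muon_M G t))"

text \<open>The arguments are: \<open>n\<close> columns, \<open>\<theta>\<close>, \<open>L\<close>, gradient bound \<open>H\<close>, and \<open>F1 = f X1 - f_*\<close>.\<close>

definition varpi :: "real \<Rightarrow> real" where
  "varpi H = sqrt (1 + H\<^sup>2)"

definition kappa :: "real \<Rightarrow> real" where
  "kappa H = 2 * (1 + H)"

definition delta :: "nat \<Rightarrow> real \<Rightarrow> real \<Rightarrow> real" where
  "delta n \<theta> L = real n * L\<^sup>2 * \<theta>\<^sup>2"

definition c_0 :: "real \<Rightarrow> real" where
  "c_0 \<theta> = \<theta> / 2"

definition c_1 :: "nat \<Rightarrow> real \<Rightarrow> real" where
  "c_1 n \<theta> = \<theta> * real n / 2"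

definition c_2 :: "nat \<Rightarrow> real \<Rightarrow> real \<Rightarrow> real" where
  "c_2 n \<theta> L = L * real n * \<theta>\<^sup>2 / 2"

definition C_b :: "nat \<Rightarrow> real \<Rightarrow> real \<Rightarrow> real \<Rightarrow> real" where
  "C_b n \<theta> L H =
     (52 * varpi H ^ 5 + 9 * delta n \<theta> L * ln (exp 1 + varpi H * kappa H)) * ln (exp 1 + H\<^sup>2)"

definition C_c :: "nat \<Rightarrow> real \<Rightarrow> real \<Rightarrow> real \<Rightarrow> real" where
  "C_c n \<theta> L H = 2 * C_b n \<theta> L H"

definition C_d :: "real \<Rightarrow> real" where
  "C_d H = 3 * kappa H ^ 3 * ln (exp 1 + kappa H) * ln (exp 1 + H\<^sup>2)"

definition C_e :: "nat \<Rightarrow> real \<Rightarrow> real \<Rightarrow> real \<Rightarrow> real" where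
  "C_e n \<theta> L H = (88 * varpi H ^ 5 + 6 * delta n \<theta> L) * ln (exp 1 + H\<^sup>2)"

definition C_u :: "nat \<Rightarrow> real \<Rightarrow> real \<Rightarrow> real \<Rightarrow> real" where
  "C_u n \<theta> L H =
     (36 * varpi H ^ 4 * ln (exp 1 + H\<^sup>2) + 2 * C_e n \<theta> L H) * C_c n \<theta> L H"

definition C_w :: "nat \<Rightarrow> real \<Rightarrow> real \<Rightarrow> real \<Rightarrow> real \<Rightarrow> real" where
  "C_w n \<theta> L H F1 = 1 / c_0 \<theta> * (F1 + c_1 n \<theta> * C_c n \<theta> L H + c_2 n \<theta> L * C_d H)"

definition C_x :: "nat \<Rightarrow> real \<Rightarrow> real \<Rightarrow> real \<Rightarrow> real \<Rightarrow> real" where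
  "C_x n \<theta> L H F1 =
     3 / (c_0 \<theta>)\<^sup>2 *
       (F1\<^sup>2 + (c_1 n \<theta>)\<^sup>2 * C_u n \<theta> L H + (c_2 n \<theta> L)\<^sup>2 * (C_d H)\<^sup>2)"

definition C_v :: "nat \<Rightarrow> real \<Rightarrow> real \<Rightarrow> real \<Rightarrow> real \<Rightarrow> real" where
  "C_v n \<theta> L H F1 = 4 * varpi H ^ 4 * (C_w n \<theta> L H F1 + C_x n \<theta> L H F1)"

definition C_z :: "nat \<Rightarrow> real \<Rightarrow> real \<Rightarrow> real \<Rightarrow> real \<Rightarrow> real" where
  "C_z n \<theta> L H F1 = sqrt (2 * C_v n \<theta> L H F1) + sqrt (2 * varpi H * C_c n \<theta> L H)"

definition C_A1 :: "nat \<Rightarrow> real \<Rightarrow> real \<Rightarrow> real \<Rightarrow> real \<Rightarrow> real" where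
  "C_A1 n \<theta> L H F1 = C_z n \<theta> L H F1 * sqrt (2 + 8 * (C_z n \<theta> L H F1)\<^sup>2)"

definition C_A2 :: "nat \<Rightarrow> real \<Rightarrow> real \<Rightarrow> real \<Rightarrow> real \<Rightarrow> real" where
  "C_A2 n \<theta> L H F1 = 2 powr (3/4) * C_z n \<theta> L H F1"

end

theory Submission
  imports Defs
begin

text \<open>
  Let \<open>N t\<close> be the true gradient at the iterate, \<open>\<alpha>\<close> and \<open>M\<close> the weights and momenta, and measure
  the momentum by its error \<open>\<alpha> t *\<^sub>R M t - N t\<close>. One step contracts this error by \<open>1 - \<alpha> t\<close>, up to the
  drift of the gradient, the change of \<open>\<alpha>\<close> and the noise. The drift is summable because the step
  sizes are normalised by the momentum sum, and the change of \<open>\<alpha>\<close> because \<open>ln \<alpha>\<close> has logarithmic total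
  variation. So, on every path, the \<open>\<alpha>\<close>-weighted sum of squared errors is at most a deterministic
  logarithmic term plus a martingale, whose second moment is again logarithmic.

  The descent inequality turns this into a bound \<open>q\<close>, with two controlled moments, for
  \<open>\<Sum>t. \<gamma> t * \<alpha> t * (norm (M t))\<^sup>2\<close>. Comparing \<open>\<gamma>\<close> with \<open>\<alpha>\<close> bounds \<open>\<Sum>t. (\<alpha> t * norm (M t))\<^sup>2\<close> by
  \<open>(q + q\<^sup>2) * r\<close> where \<open>r\<^sup>2\<close> is one plus the sum of the squared stochastic gradients. Since \<open>r\<close> is at
  most one plus the root sums of squares of gradients and of noise, Cauchy--Schwarz gives a
  quadratic inequality for the expected root sum of squares of the gradients.
\<close>

subsection \<open>Weights and momenta of a gradient sequence\<close>

text \<open>The weights and step sizes are built from the very gradients they multiply, and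
  \<open>muon_gamma\<close> at \<open>t\<close> even looks at the gradient of step \<open>t\<close>.
  Expectations taken step by step would not factor, so everything up to the bound on the gradient
  norms is proved on a single path. What makes this possible is a lag: \<open>\<alpha> t\<close>
  looks only at gradients before \<open>t\<close>, so noise can be left in linear terms whose
  coefficients are known before the sample is drawn. The squared noise is not replaced by the
  variance there. It is traded for \<open>(norm (G t))\<^sup>2\<close> and one more such linear
  term, because \<open>\<Sum>t. (\<alpha> t * norm (G t))\<^sup>2\<close> is logarithmic on every
  path with bounded gradients. The variance enters only through \<open>r\<close>. Cauchy--Schwarz
  separates \<open>q + q\<^sup>2\<close> from \<open>r\<close> because the two are dependent, and
  the square of \<open>q\<close> is what calls for the second moment of the martingale. The numbers
  found on the way lie below the named constants and are compared with them at the end.\<close>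

definition grad_sum :: "(nat \<Rightarrow> 'a::real_normed_vector) \<Rightarrow> nat \<Rightarrow> real" where
  "grad_sum G t = 1 + (\<Sum>i=1..t. (norm (G i))\<^sup>2)"

text \<open>The value 1 at \<open>t = 0\<close> stands in for a maximum over the empty set, so that
  \<open>muon_alpha_Suc\<close> also covers the first step.\<close>

definition grad_max :: "(nat \<Rightarrow> 'a::real_normed_vector) \<Rightarrow> nat \<Rightarrow> real" where
  "grad_max G t = (if t = 0 then 1 else 1 + (MAX i\<in>{1..t}. (norm (G i))\<^sup>2))"

definition mom_sum :: "(nat \<Rightarrow> 'a::real_normed_vector) \<Rightarrow> nat \<Rightarrow> real" where
  "mom_sum G t = 1 + (\<Sum>j=1..t. muon_alpha G j * (norm (muon_M G j))\<^sup>2)"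

section \<open>Elementary bounds for the weights\<close>

lemma grad_sum_0 [simp]: "grad_sum G 0 = 1"
  by (simp add: grad_sum_def)

lemma grad_sum_Suc: "grad_sum G (Suc t) = grad_sum G t + (norm (G (Suc t)))\<^sup>2"
  by (simp add: grad_sum_def)

lemma grad_sum_ge_1: "grad_sum G t \<ge> 1"
  by (simp add: grad_sum_def sum_nonneg)

lemma grad_sum_mono: "t \<le> u \<Longrightarrow> grad_sum G t \<le> grad_sum G u"
  by (rule lift_Suc_mono_le) (simp_all add: grad_sum_Suc)

lemma grad_max_0 [simp]: "grad_max G 0 = 1"
  by (simp add: grad_max_def)

lemma grad_max_Suc: "grad_max G (Suc t) = max (grad_max G t) (1 + (norm (G (Suc t)))\<^sup>2)"
proof (cases "t = 0")
  case False
  then have "{1..Suc t} = insert (Suc t) {1..t}" and "{1..t} \<noteq> {}"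
    by auto
  with False show ?thesis
    by (simp add: grad_max_def max.commute max_def)
qed (simp add: grad_max_def)

lemma grad_max_ge_1: "grad_max G t \<ge> 1"
  by (induction t) (auto simp: grad_max_Suc)

lemma grad_max_le_grad_sum: "grad_max G t \<le> grad_sum G t"
proof (induction t)
  case (Suc t)
  then show ?case
    using grad_sum_ge_1[of G t] zero_le_power2[of "norm (G (Suc t))"]
    unfolding grad_max_Suc grad_sum_Suc by linarith
qed simp

lemma muon_alpha_Suc: "muon_alpha G (Suc t) = sqrt (grad_max G t / grad_sum G t)"
  by (simp add: muon_alpha_def muon_rho_def grad_max_def grad_sum_def)

lemma muon_alpha_0 [simp]: "muon_alpha G 0 = 1"
  by (simp add: muon_alpha_def)

lemma muon_alpha_1 [simp]: "muon_alpha G (Suc 0) = 1"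
  by (simp add: muon_alpha_Suc)

lemma muon_alpha_pos: "muon_alpha G t > 0"
proof (cases t)
  case (Suc k)
  then show ?thesis
    using grad_sum_ge_1[of G k] grad_max_ge_1[of G k] by (simp add: muon_alpha_Suc)
qed simp

lemma muon_alpha_le_1: "muon_alpha G t \<le> 1"
proof (cases t)
  case (Suc k)
  then show ?thesis
    using grad_sum_ge_1[of G k] grad_max_le_grad_sum[of G k] by (simp add: muon_alpha_Suc)
qed simp

lemma muon_alpha_ge: "1 / sqrt (grad_sum G t) \<le> muon_alpha G (Suc t)"
  using grad_sum_ge_1[of G t] grad_max_ge_1[of G t]
  by (simp add: muon_alpha_Suc real_sqrt_divide divide_right_mono)

text \<open>A new squared norm \<open>g\<close> enlarges the sum from \<open>s\<close> to
  \<open>s + g\<close>, but it also pushes the maximum to at least \<open>1 + g\<close>, so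
  \<open>\<alpha>\<^sup>2\<close> at most halves in one step. This later exchanges
  \<open>1 / \<alpha> (Suc t)\<close> for \<open>1 / \<alpha> t\<close> in the gradient
  drift.\<close>

lemma muon_alpha_ratio: "muon_alpha G t \<le> sqrt 2 * muon_alpha G (Suc t)"
proof (cases t)
  case 0
  then show ?thesis by simp
next
  case (Suc k)
  define s a g where "s = grad_sum G k" and "a = grad_max G k" and "g = (norm (G t))\<^sup>2"
  have s: "1 \<le> s" "a \<le> s" "1 \<le> a" "0 \<le> g"
    by (simp_all add: s_def a_def g_def grad_sum_ge_1 grad_max_ge_1 grad_max_le_grad_sum)
  have "a / s \<le> 2 * (max a (1 + g) / (s + g))"
  proof -
    have "a * g \<le> s * (1 + g)" "a * s \<le> max a (1 + g) * s"
      using s by (auto intro!: mult_mono)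
    moreover have "s * (1 + g) \<le> max a (1 + g) * s"
      using s by (simp add: mult.commute)
    ultimately have "a * (s + g) \<le> 2 * max a (1 + g) * s"
      by (simp add: algebra_simps)
    then show ?thesis
      using s by (simp add: field_simps)
  qed
  then have "sqrt (a / s) \<le> sqrt (2 * (max a (1 + g) / (s + g)))"
    by simp
  then show ?thesis
    unfolding Suc muon_alpha_Suc real_sqrt_mult grad_max_Suc grad_sum_Suc
    using Suc by (simp add: s_def a_def g_def real_sqrt_mult)
qed

text \<open>The inequality \<open>ln u \<le> u - 1\<close> at \<open>u = x / y\<close>. Telescoped,
  it bounds a sum of increments over their running total by a logarithm; the logarithmic bounds of
  this section rest on it.\<close>

lemma ln_increment_ge:
  fixes x y :: real
  assumes "0 < x" "x \<le> y"
  shows "(y - x) / y \<le> ln y - ln x"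
proof -
  have "ln (x / y) \<le> x / y - 1"
    using assms by (intro ln_le_minus_one) auto
  then show ?thesis
    using assms by (simp add: ln_div diff_divide_distrib)
qed

text \<open>Meant for consecutive weights \<open>x\<close>, \<open>y\<close> and a momentum norm
  \<open>m\<close> that may be as large as \<open>1 / x\<close>: only the products
  \<open>x * m\<close> and \<open>y * m\<close> are controlled, so the relative change of the weight
  is what counts.\<close>

lemma abs_diff_le_ln:
  fixes x y m b :: real
  assumes "0 < x" "0 < y" "0 \<le> m" "x * m \<le> b" "y * m \<le> b"
  shows "\<bar>x - y\<bar> * m \<le> b * \<bar>ln x - ln y\<bar>"
proof -
  have *: "(v - u) * m \<le> b * (ln v - ln u)" if "0 < u" "u \<le> v" "v * m \<le> b" for u v :: real
  proof -
    have "(v - u) * m = (v - u) / v * (v * m)"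
      using that by simp
    also have "\<dots> \<le> (ln v - ln u) * b"
      using that ln_increment_ge[of u v] \<open>0 \<le> m\<close> by (intro mult_mono) auto
    finally show ?thesis by (simp add: mult.commute)
  qed
  show ?thesis
    using *[of x y] *[of y x] assms by (cases "x \<le> y") (auto simp: abs_if)
qed

section \<open>Momentum sum and step sizes\<close>

lemma mom_sum_Suc:
  "mom_sum G (Suc t) = mom_sum G t + muon_alpha G (Suc t) * (norm (muon_M G (Suc t)))\<^sup>2"
  by (simp add: mom_sum_def)

lemma mom_sum_ge_1: "mom_sum G t \<ge> 1"
  by (simp add: mom_sum_def sum_nonneg muon_alpha_pos less_imp_le)

lemma mom_sum_mono: "t \<le> u \<Longrightarrow> mom_sum G t \<le> mom_sum G u"
  by (rule lift_Suc_mono_le) (simp_all add: mom_sum_Suc muon_alpha_pos less_imp_le)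

lemma muon_gamma_eq:
  "muon_gamma G t = muon_alpha G t * min (muon_alpha G t) (1 / sqrt (mom_sum G t))"
proof -
  have "muon_alpha G t * min (muon_alpha G t) (1 / sqrt (mom_sum G t)) =
      min (muon_alpha G t * muon_alpha G t) (muon_alpha G t * (1 / sqrt (mom_sum G t)))"
    using muon_alpha_pos[of G t] by (simp add: min_mult_distrib_left)
  then show ?thesis
    by (simp add: muon_gamma_def mom_sum_def power2_eq_square)
qed

lemma muon_gamma_pos: "muon_gamma G t > 0"
  using muon_alpha_pos[of G t] mom_sum_ge_1[of G t] by (simp add: muon_gamma_eq)

lemma muon_gamma_le: "muon_gamma G t \<le> (muon_alpha G t)\<^sup>2"
  by (simp add: muon_gamma_def)

lemma muon_gamma_sq_le: "(muon_gamma G t)\<^sup>2 \<le> (muon_alpha G t)\<^sup>2 / mom_sum G t"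
proof -
  have "muon_gamma G t \<le> muon_alpha G t / sqrt (mom_sum G t)"
    by (simp add: muon_gamma_def mom_sum_def)
  then have "(muon_gamma G t)\<^sup>2 \<le> (muon_alpha G t / sqrt (mom_sum G t))\<^sup>2"
    using muon_gamma_pos[of G t] by (intro power_mono) auto
  then show ?thesis
    using mom_sum_ge_1[of G t] by (simp add: power_divide)
qed

text \<open>The second branch of the minimum in \<open>muon_gamma\<close> turns each term into the
  increment of \<open>mom_sum\<close> over its new value, which telescopes. The weight
  \<open>muon_alpha\<close> inside \<open>mom_sum\<close> is what leaves room for the division by
  \<open>muon_alpha\<close>, as the drift term requires.\<close>

lemma sum_step_sq_div_alpha_le:
  "(\<Sum>t=1..T. (muon_gamma G t * norm (muon_M G t))\<^sup>2 / muon_alpha G t) \<le> ln (mom_sum G T)"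
proof (induction T)
  case (Suc T)
  let ?t = "Suc T"
  have "(muon_gamma G ?t * norm (muon_M G ?t))\<^sup>2 / muon_alpha G ?t
      \<le> (muon_alpha G ?t)\<^sup>2 / mom_sum G ?t * (norm (muon_M G ?t))\<^sup>2 / muon_alpha G ?t"
    unfolding power_mult_distrib
    by (intro divide_right_mono mult_right_mono muon_gamma_sq_le) (auto simp: muon_alpha_pos less_imp_le)
  also have "\<dots> = (mom_sum G ?t - mom_sum G T) / mom_sum G ?t"
    using muon_alpha_pos[of G ?t] by (simp add: mom_sum_Suc power2_eq_square)
  also have "\<dots> \<le> ln (mom_sum G ?t) - ln (mom_sum G T)"
    using mom_sum_ge_1[of G T] mom_sum_mono[of T ?t G] by (intro ln_increment_ge) auto
  finally show ?case
    using Suc.IH by simp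
qed (simp add: mom_sum_def)

lemma sum_step_sq_le:
  "(\<Sum>t=1..T. (muon_gamma G t * norm (muon_M G t))\<^sup>2) \<le> ln (mom_sum G T)"
proof -
  have "x\<^sup>2 \<le> x\<^sup>2 / muon_alpha G t" for x :: real and t
    using muon_alpha_pos[of G t] muon_alpha_le_1[of G t]
    by (simp add: divide_simps mult_left_le)
  then have "(\<Sum>t=1..T. (muon_gamma G t * norm (muon_M G t))\<^sup>2)
      \<le> (\<Sum>t=1..T. (muon_gamma G t * norm (muon_M G t))\<^sup>2 / muon_alpha G t)"
    by (intro sum_mono)
  also note sum_step_sq_div_alpha_le
  finally show ?thesis .
qed

text \<open>Logarithms that are at least 1 allow sums and lower powers of them to be absorbed into
  their product; this is the purpose of adding \<open>exp 1\<close>.\<close>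

lemma one_le_ln_exp_1_add: "x \<ge> 0 \<Longrightarrow> 1 \<le> ln (exp 1 + x)" for x :: real
  by (metis add.commute add_increasing exp_gt_zero exp_le_cancel_iff exp_ln le_add_same_cancel2 less_add_same_cancel2 add_nonneg_pos order_refl)

lemma ln_one_add_mult_le:
  fixes x y :: real
  assumes "x \<ge> 0" "y \<ge> 0"
  shows "ln (1 + x * y) \<le> ln (exp 1 + x) + ln (exp 1 + y)"
proof -
  have e: "exp (1::real) \<ge> 1" by simp
  have "1 + x * y \<le> (exp 1 + x) * (exp 1 + y)"
    using assms e mult_mono[OF e e] by (simp add: algebra_simps add_increasing2 add_increasing)
  then have "ln (1 + x * y) \<le> ln ((exp 1 + x) * (exp 1 + y))"
    using assms by (subst ln_le_cancel_iff) (auto simp: add_pos_nonneg)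
  also have "\<dots> = ln (exp 1 + x) + ln (exp 1 + y)"
    using assms add_pos_nonneg[of "exp 1" x] add_pos_nonneg[of "exp 1" y] by (subst ln_mult) auto
  finally show ?thesis .
qed

lemma add_le_2_mult:
  fixes x y :: real
  assumes "x \<ge> 1" "y \<ge> 1"
  shows "x + y \<le> 2 * (x * y)"
  using mult_left_mono[of 1 y x] mult_right_mono[of 1 x y] assms by linarith

lemma varpi_sq: "(varpi H)\<^sup>2 = 1 + H\<^sup>2"
  by (simp add: varpi_def)

lemma varpi_ge_1: "varpi H \<ge> 1"
  by (simp add: varpi_def)

section \<open>Paths with bounded gradients\<close>

locale bounded_grads =
  fixes G :: "nat \<Rightarrow> 'a::real_normed_vector" and H :: real
  assumes bound: "\<And>i. i \<ge> 1 \<Longrightarrow> norm (G i) \<le> H" and H_nonneg: "H \<ge> 0"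
begin

lemma norm_sq_le: "i \<ge> 1 \<Longrightarrow> (norm (G i))\<^sup>2 \<le> H\<^sup>2"
  by (simp add: bound power_mono)

lemma grad_max_le: "grad_max G t \<le> (varpi H)\<^sup>2"
  by (induction t) (auto simp: grad_max_Suc varpi_sq norm_sq_le)

lemma grad_sum_le: "grad_sum G t \<le> 1 + real t * H\<^sup>2"
proof (induction t)
  case (Suc t)
  then show ?case
    using norm_sq_le[of "Suc t"] by (simp add: grad_sum_Suc algebra_simps)
qed simp

text \<open>With \<open>muon_alpha_ge\<close> this pins the weight, up to the factor
  \<open>varpi H\<close>, to the inverse root of the sum of squares before it.\<close>

lemma muon_alpha_sqrt_sum_le: "muon_alpha G (Suc t) * sqrt (grad_sum G t) \<le> varpi H"
proof -
  have "muon_alpha G (Suc t) * sqrt (grad_sum G t) = sqrt (grad_max G t)"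
    using grad_sum_ge_1[of G t] by (simp add: muon_alpha_Suc real_sqrt_divide)
  also have "\<dots> \<le> varpi H"
    using grad_max_le[of t] by (intro real_le_lsqrt) (auto simp: varpi_def)
  finally show ?thesis .
qed

text \<open>The bound \<open>H * s\<close> reproduces itself under
  \<open>x \<mapsto> H + (1 - a) * x\<close> as soon as \<open>a * s \<ge> 1\<close>, which is
  \<open>muon_alpha_ge\<close>. The sum of squares lags one step behind the momentum, matching the
  lag of the weight; at the start it is 1 and the momentum is the first gradient.\<close>

lemma norm_muon_M_Suc_le: "norm (muon_M G (Suc t)) \<le> H * sqrt (grad_sum G t)"
proof (induction t)
  case 0
  then show ?case using bound[of 1] by simp
next
  case (Suc t)
  let ?\<alpha> = "muon_alpha G (Suc (Suc t))" and ?s = "sqrt (grad_sum G (Suc t))"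
  have s: "?s \<ge> 1" "1 \<le> ?\<alpha> * ?s"
    using grad_sum_ge_1[of G "Suc t"] muon_alpha_ge[of G "Suc t"]
    by (simp_all add: field_simps)
  have "norm (muon_M G (Suc (Suc t)))
      \<le> norm (G (Suc (Suc t))) + norm ((1 - ?\<alpha>) *\<^sub>R muon_M G (Suc t))"
    by (subst muon_M.simps) (rule norm_triangle_ineq)
  also have "\<dots> \<le> H + (1 - ?\<alpha>) * norm (muon_M G (Suc t))"
    using bound[of "Suc (Suc t)"] muon_alpha_le_1[of G "Suc (Suc t)"] by simp
  also have "\<dots> \<le> H + (1 - ?\<alpha>) * (H * ?s)"
  proof -
    have "norm (muon_M G (Suc t)) \<le> H * ?s"
      using Suc.IH grad_sum_mono[of t "Suc t" G] H_nonneg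
      by (meson lessI less_imp_le mult_left_mono order_trans real_sqrt_le_mono)
    then show ?thesis
      using muon_alpha_le_1[of G "Suc (Suc t)"] by (simp add: mult_left_mono)
  qed
  also have "\<dots> = H * (1 + ?s - ?\<alpha> * ?s)"
    by (simp add: algebra_simps)
  also have "\<dots> \<le> H * ?s"
    using s H_nonneg by (intro mult_left_mono) auto
  finally show ?case .
qed

lemma norm_muon_M_le: "norm (muon_M G t) \<le> H * sqrt (grad_sum G t)"
proof (cases t)
  case (Suc k)
  then show ?thesis
    using norm_muon_M_Suc_le[of k] grad_sum_mono[of k t G] H_nonneg
    by (meson le_SucI le_refl mult_left_mono order_trans real_sqrt_le_mono)
qed (simp add: H_nonneg)

lemma muon_alpha_M_le: "muon_alpha G t * norm (muon_M G t) \<le> varpi H * H"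
proof (cases t)
  case 0
  then show ?thesis using H_nonneg varpi_ge_1[of H] by simp
next
  case (Suc k)
  have "muon_alpha G t * norm (muon_M G t) \<le> muon_alpha G t * (H * sqrt (grad_sum G k))"
    unfolding Suc using norm_muon_M_Suc_le muon_alpha_pos by (intro mult_left_mono) (auto intro: less_imp_le)
  also have "\<dots> = muon_alpha G t * sqrt (grad_sum G k) * H"
    by simp
  also have "\<dots> \<le> varpi H * H"
    unfolding Suc by (intro mult_right_mono muon_alpha_sqrt_sum_le H_nonneg)
  finally show ?thesis .
qed

text \<open>The next weight with the present momentum, the combination that occurs in the error
  recursion. Together with \<open>muon_alpha_M_le\<close> it supplies the two bounds asked for by
  \<open>abs_diff_le_ln\<close>.\<close>

lemma muon_alpha_Suc_M_le: "muon_alpha G (Suc t) * norm (muon_M G t) \<le> varpi H * H"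
proof -
  have "muon_alpha G (Suc t) * norm (muon_M G t) \<le> muon_alpha G (Suc t) * (H * sqrt (grad_sum G t))"
    using norm_muon_M_le muon_alpha_pos by (intro mult_left_mono) (auto intro: less_imp_le)
  also have "\<dots> = muon_alpha G (Suc t) * sqrt (grad_sum G t) * H"
    by simp
  also have "\<dots> \<le> varpi H * H"
    by (intro mult_right_mono muon_alpha_sqrt_sum_le H_nonneg)
  finally show ?thesis .
qed

text \<open>The weight at \<open>t\<close> divides by the sum before \<open>t\<close>, whereas
  telescoping needs the sum including \<open>t\<close>. Since
  \<open>s + g \<le> (varpi H)\<^sup>2 * s\<close>, the exchange costs a second factor
  \<open>(varpi H)\<^sup>2\<close>, hence the fourth power.\<close>

lemma sum_alpha_grad_sq_le:
  "(\<Sum>t=1..T. (muon_alpha G t)\<^sup>2 * (norm (G t))\<^sup>2) \<le> varpi H ^ 4 * ln (grad_sum G T)"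
proof (induction T)
  case (Suc T)
  define s g where "s = grad_sum G T" and "g = (norm (G (Suc T)))\<^sup>2"
  have s: "s \<ge> 1" and g: "0 \<le> g" "g \<le> H\<^sup>2"
    using norm_sq_le[of "Suc T"] by (simp_all add: s_def g_def grad_sum_ge_1)
  have "(muon_alpha G (Suc T))\<^sup>2 = grad_max G T / s"
    using s grad_max_ge_1[of G T] by (simp add: muon_alpha_Suc s_def)
  also have "\<dots> \<le> (varpi H)\<^sup>2 / s"
    using s grad_max_le by (simp add: divide_right_mono)
  also have "\<dots> \<le> (varpi H)\<^sup>2 * ((varpi H)\<^sup>2 / (s + g))"
  proof -
    have "s + g \<le> (varpi H)\<^sup>2 * s"
    proof -
      have "g \<le> H\<^sup>2 * s" using g s
        by (metis mult.right_neutral mult_left_mono order_trans zero_le_power2)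
      then show ?thesis by (simp add: varpi_sq algebra_simps)
    qed
    then have "1 / s \<le> (varpi H)\<^sup>2 / (s + g)"
      using s g by (simp add: field_simps)
    then have "(varpi H)\<^sup>2 * (1 / s) \<le> (varpi H)\<^sup>2 * ((varpi H)\<^sup>2 / (s + g))"
      by (intro mult_left_mono) auto
    then show ?thesis by simp
  qed
  finally have "(muon_alpha G (Suc T))\<^sup>2 * g \<le> (varpi H)\<^sup>2 * ((varpi H)\<^sup>2 / (s + g)) * g"
    using g by (intro mult_right_mono)
  also have "\<dots> = varpi H ^ 4 * (((s + g) - s) / (s + g))"
    by (simp add: power4_eq_xxxx power2_eq_square)
  also have "\<dots> \<le> varpi H ^ 4 * (ln (s + g) - ln s)"
    using s g by (intro mult_left_mono ln_increment_ge) auto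
  finally show ?case
    using Suc.IH by (simp add: grad_sum_Suc s_def g_def algebra_simps)
qed simp

text \<open>
  The numerator and the denominator of \<open>\<alpha>\<^sup>2\<close> are both monotone, so \<open>ln \<alpha>\<close> has logarithmic
  total variation although \<open>\<alpha>\<close> itself need not be monotone.
\<close>

lemma sum_alpha_variation_le:
  "(\<Sum>t=1..T. \<bar>muon_alpha G t - muon_alpha G (t - 1)\<bar> * norm (muon_M G (t - 1)))
    \<le> varpi H * H * ((ln (grad_max G T) + ln (grad_sum G T)) / 2)"
proof (cases T)
  case (Suc K)
  \<comment> \<open>The sum up to \<open>Suc k\<close> is controlled by the quantities at
    \<open>k\<close>, since the weight lags by one. The term at 1 vanishes because the weights at 0
    and 1 agree. Monotonicity restores the index \<open>T\<close> afterwards.\<close>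
  have "(\<Sum>t=1..Suc k. \<bar>muon_alpha G t - muon_alpha G (t - 1)\<bar> * norm (muon_M G (t - 1)))
    \<le> varpi H * H * ((ln (grad_max G k) + ln (grad_sum G k)) / 2)" for k
  proof (induction k)
    case (Suc k)
    let ?p = "ln (grad_max G k)" and ?p' = "ln (grad_max G (Suc k))"
    let ?q = "ln (grad_sum G k)" and ?q' = "ln (grad_sum G (Suc k))"
    have pos: "grad_max G j > 0" "grad_sum G j > 0" for j
      using grad_max_ge_1[of G j] grad_sum_ge_1[of G j] by auto
    have mono: "?p \<le> ?p'" "?q \<le> ?q'"
      using pos grad_sum_mono[of k "Suc k" G] by (auto simp: grad_max_Suc less_max_iff_disj)
    have ln_alpha: "ln (muon_alpha G (Suc j)) = (ln (grad_max G j) - ln (grad_sum G j)) / 2" for j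
      using pos[of j] by (simp add: muon_alpha_Suc ln_sqrt ln_div)
    have "\<bar>muon_alpha G (Suc (Suc k)) - muon_alpha G (Suc k)\<bar> * norm (muon_M G (Suc k))
       \<le> varpi H * H * \<bar>ln (muon_alpha G (Suc (Suc k))) - ln (muon_alpha G (Suc k))\<bar>"
      by (intro abs_diff_le_ln muon_alpha_pos norm_ge_zero muon_alpha_M_le muon_alpha_Suc_M_le)
    also have "\<dots> \<le> varpi H * H * ((?p' - ?p + (?q' - ?q)) / 2)"
    proof (rule mult_left_mono)
      show "\<bar>ln (muon_alpha G (Suc (Suc k))) - ln (muon_alpha G (Suc k))\<bar>
          \<le> (?p' - ?p + (?q' - ?q)) / 2"
        using mono unfolding ln_alpha abs_le_iff by (simp add: field_simps)
    qed (use H_nonneg varpi_ge_1[of H] in auto)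
    finally show ?case
      using Suc.IH by (simp add: algebra_simps add_divide_distrib diff_divide_distrib)
  qed (simp add: H_nonneg)
  note this[of K]
  also have "varpi H * H * ((ln (grad_max G K) + ln (grad_sum G K)) / 2)
      \<le> varpi H * H * ((ln (grad_max G T) + ln (grad_sum G T)) / 2)"
    using H_nonneg varpi_ge_1[of H] grad_max_ge_1[of G K] grad_sum_ge_1[of G K] grad_sum_mono[of K T G]
    unfolding Suc by (intro mult_left_mono divide_right_mono add_mono) (auto simp: grad_max_Suc)
  finally show ?thesis
    by (simp add: Suc)
qed simp

lemma ln_grad_max_le: "ln (grad_max G t) \<le> ln (exp 1 + H\<^sup>2)"
  using grad_max_ge_1[of G t] grad_max_le[of t] exp_ge_add_one_self[of 1] by (subst ln_le_cancel_iff) (auto simp: varpi_sq)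


lemma ln_grad_sum_le: "ln (grad_sum G T) \<le> ln (exp 1 + real T) + ln (exp 1 + H\<^sup>2)"
proof -
  have "ln (grad_sum G T) \<le> ln (1 + real T * H\<^sup>2)"
    using grad_sum_ge_1[of G T] grad_sum_le[of T] by (subst ln_le_cancel_iff) auto
  also have "\<dots> \<le> ln (exp 1 + real T) + ln (exp 1 + H\<^sup>2)"
    by (rule ln_one_add_mult_le) auto
  finally show ?thesis .
qed

text \<open>Each term of \<open>mom_sum\<close> is at most
  \<open>H\<^sup>2 * varpi H * sqrt (grad_sum G T)\<close>. With \<open>x\<close> and
  \<open>y\<close> for the logarithms in \<open>T\<close> and \<open>H\<close>, the resulting bound
  is \<open>3/2 * x + 2 * y\<close>; the coefficients add up to \<open>7/2\<close>.\<close>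

lemma ln_mom_sum_le: "ln (mom_sum G T) \<le> 7/2 * (ln (exp 1 + H\<^sup>2) * ln (exp 1 + real T))"
proof -
  let ?x = "ln (exp 1 + real T)" and ?y = "ln (exp 1 + H\<^sup>2)"
  let ?b = "varpi H * sqrt (grad_sum G T)"
  have w: "varpi H \<ge> 1"
    by (rule varpi_ge_1)
  then have b: "?b \<ge> 1"
    using grad_sum_ge_1[of G T] by (smt (verit) mult_less_cancel_left2 real_sqrt_ge_one)
  have "mom_sum G T \<le> 1 + (\<Sum>j=1..T. H\<^sup>2 * ?b)"
    unfolding mom_sum_def
  proof (intro add_left_mono sum_mono)
    fix j assume j: "j \<in> {1..T}"
    have "muon_alpha G j * (norm (muon_M G j))\<^sup>2 = muon_alpha G j * norm (muon_M G j) * norm (muon_M G j)"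
      by (simp add: power2_eq_square)
    also have "\<dots> \<le> varpi H * H * (H * sqrt (grad_sum G T))"
    proof (rule mult_mono[OF muon_alpha_M_le])
      have "norm (muon_M G j) \<le> H * sqrt (grad_sum G j)"
        by (rule norm_muon_M_le)
      also have "\<dots> \<le> H * sqrt (grad_sum G T)"
        using j H_nonneg by (intro mult_left_mono real_sqrt_le_mono grad_sum_mono) auto
      finally show "norm (muon_M G j) \<le> H * sqrt (grad_sum G T)" .
    qed (use w H_nonneg in auto)
    finally show "muon_alpha G j * (norm (muon_M G j))\<^sup>2 \<le> H\<^sup>2 * ?b"
      by (simp add: power2_eq_square mult_ac)
  qed
  also have "\<dots> = 1 + real T * H\<^sup>2 * ?b"
    by simp
  also have "\<dots> \<le> (1 + real T * H\<^sup>2) * ?b"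
    using b by (simp add: algebra_simps)
  finally have "ln (mom_sum G T) \<le> ln ((1 + real T * H\<^sup>2) * ?b)"
    using mom_sum_ge_1[of G T] by (subst ln_le_cancel_iff) auto
  also have "\<dots> = ln (1 + real T * H\<^sup>2) + (ln (1 + H\<^sup>2) / 2 + ln (grad_sum G T) / 2)"
  proof -
    have "0 < 1 + real T * H\<^sup>2" "0 < 1 + H\<^sup>2" "0 < grad_sum G T"
      using grad_sum_ge_1[of G T] by (auto intro: add_pos_nonneg)
    then show ?thesis
      by (simp add: ln_mult_pos varpi_def ln_sqrt)
  qed
  also have "\<dots> \<le> (?x + ?y) + (?y / 2 + (?x + ?y) / 2)"
  proof (intro add_mono divide_right_mono ln_one_add_mult_le ln_grad_sum_le)
    show "ln (1 + H\<^sup>2) \<le> ?y"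
      using exp_ge_add_one_self[of 1] by (subst ln_le_cancel_iff) (auto intro: add_pos_nonneg)
  qed auto
  also have "\<dots> \<le> 7/2 * (?y * ?x)"
  proof -
    have "1 \<le> ?x" "1 \<le> ?y"
      by (simp_all add: one_le_ln_exp_1_add)
    then have "?x \<le> ?y * ?x" "?y \<le> ?y * ?x"
      using mult_left_mono[of 1 ?x ?y] mult_right_mono[of 1 ?y ?x] by linarith+
    then show ?thesis by (simp add: field_simps)
  qed
  finally show ?thesis .
qed

end

subsection \<open>Error recursion and descent along a path\<close>

text \<open>Along the segment, \<open>\<phi>\<close> is \<open>f\<close> minus its linearisation and
  the quadratic allowance. Cauchy--Schwarz and the Lipschitz bound make its derivative nonpositive,
  which replaces an integral of the gradient.\<close>

lemma descent_lemma:
  fixes f :: "'a::euclidean_space \<Rightarrow> real"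
  assumes diff: "\<And>Y. f differentiable (at Y)"
    and smooth: "\<And>Y Z. norm (grad f Y - grad f Z) \<le> L * norm (Y - Z)"
  shows "f (Y + D) \<le> f Y + inner D (grad f Y) + L / 2 * (norm D)\<^sup>2"
proof -
  define \<phi> where
    "\<phi> t = f (Y + t *\<^sub>R D) - t * inner D (grad f Y) - L * t\<^sup>2 / 2 * (norm D)\<^sup>2" for t :: real
  have "\<phi> 1 \<le> \<phi> 0"
  proof (rule DERIV_nonpos_imp_nonincreasing[where f = \<phi> and a = 0 and b = 1])
    fix t :: real assume t: "0 \<le> t" "t \<le> 1"
    let ?y = "inner D (grad f (Y + t *\<^sub>R D)) - inner D (grad f Y) - L * t * (norm D)\<^sup>2"
    have "(f has_derivative (\<lambda>h. inner h (grad f (Y + t *\<^sub>R D)))) (at (Y + t *\<^sub>R D))"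
      using GDERIV_grad[OF diff] by (simp add: gderiv_def)
    moreover have "((\<lambda>t. Y + t *\<^sub>R D) has_derivative (\<lambda>h. h *\<^sub>R D)) (at t)"
      by (auto intro!: derivative_eq_intros)
    ultimately have "((\<lambda>t. f (Y + t *\<^sub>R D)) has_derivative
        (\<lambda>h. inner (h *\<^sub>R D) (grad f (Y + t *\<^sub>R D)))) (at t)"
      using has_derivative_compose by fastforce
    then have "DERIV (\<lambda>t. f (Y + t *\<^sub>R D)) t :> inner D (grad f (Y + t *\<^sub>R D))"
      by (simp add: has_field_derivative_def mult.commute[of _ "inner D _"] fun_eq_iff)
    then have "DERIV \<phi> t :> ?y"
      unfolding \<phi>_def by (auto intro!: derivative_eq_intros)
    moreover have "?y \<le> 0"
    proof -
      have "inner D (grad f (Y + t *\<^sub>R D) - grad f Y) \<le> norm D * norm (grad f (Y + t *\<^sub>R D) - grad f Y)"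
        by (rule norm_cauchy_schwarz)
      also have "\<dots> \<le> norm D * (L * norm (t *\<^sub>R D))"
        using smooth[of "Y + t *\<^sub>R D" Y] by (intro mult_left_mono) auto
      finally show ?thesis
        using t by (simp add: inner_diff_right power2_eq_square mult_ac)
    qed
    ultimately show "\<exists>y. DERIV \<phi> t :> y \<and> y \<le> 0"
      by blast
  qed simp
  then show ?thesis
    by (simp add: \<phi>_def)
qed

lemma norm_lincomb_sq:
  fixes x y :: "'a::real_inner"
  shows "(norm (a *\<^sub>R x + b *\<^sub>R y))\<^sup>2 = a\<^sup>2 * (norm x)\<^sup>2 + b\<^sup>2 * (norm y)\<^sup>2 + 2 * a * b * inner x y"
  unfolding power2_norm_eq_inner
  by (simp add: inner_add_left inner_add_right inner_commute power2_eq_square algebra_simps)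

text \<open>Young's inequality with weight \<open>a\<close> gives the factor \<open>1 + a\<close>,
  and \<open>(1 - a)\<^sup>2 * (1 + a) = (1 - a) * (1 - a\<^sup>2)\<close> leaves one full factor
  \<open>1 - a\<close> as the contraction. The price is the division of the drift by
  \<open>a\<close>.\<close>

lemma contraction_ineq:
  fixes x d :: "'a::real_inner"
  assumes a: "0 < a" "a \<le> 1"
  shows "(1 - a)\<^sup>2 * (norm (x + d))\<^sup>2 \<le> (1 - a) * (norm x)\<^sup>2 + (norm d)\<^sup>2 / a"
proof -
  have "0 \<le> (norm (a *\<^sub>R x - d))\<^sup>2 / a"
    using a by simp
  also have "(norm (a *\<^sub>R x - d))\<^sup>2 = a\<^sup>2 * (norm x)\<^sup>2 - 2 * a * inner x d + (norm d)\<^sup>2"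
    using norm_lincomb_sq[of a x "-1" d] by simp
  finally have "2 * inner x d \<le> a * (norm x)\<^sup>2 + (norm d)\<^sup>2 / a"
    using a by (simp add: field_simps power2_eq_square)
  then have "(norm (x + d))\<^sup>2 \<le> (1 + a) * ((norm x)\<^sup>2 + (norm d)\<^sup>2 / a)"
    using a by (simp add: power2_norm_eq_inner inner_add_left inner_add_right inner_commute field_simps)
  then have "(1 - a)\<^sup>2 * (norm (x + d))\<^sup>2 \<le> (1 - a)\<^sup>2 * ((1 + a) * ((norm x)\<^sup>2 + (norm d)\<^sup>2 / a))"
    by (intro mult_left_mono) auto
  also have "\<dots> = (1 - a) * (1 - a\<^sup>2) * ((norm x)\<^sup>2 + (norm d)\<^sup>2 / a)"
    by algebra
  also have "\<dots> \<le> (1 - a) * 1 * ((norm x)\<^sup>2 + (norm d)\<^sup>2 / a)"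
    using a by (intro mult_right_mono mult_left_mono) auto
  also have "\<dots> \<le> (1 - a) * (norm x)\<^sup>2 + 1 * ((norm d)\<^sup>2 / a)"
    using a unfolding mult_1_right distrib_left by (intro add_left_mono mult_right_mono) auto
  finally show ?thesis by simp
qed

text \<open>The momentum adds up gradients unnormalised. For a constant weight,
  \<open>\<alpha> * M\<close> is the exponential moving average of the gradients, so this is the
  natural estimator of \<open>N\<close>.\<close>

definition muon_err :: "(nat \<Rightarrow> 'a::real_inner) \<Rightarrow> (nat \<Rightarrow> 'a) \<Rightarrow> nat \<Rightarrow> 'a" where
  "muon_err G N t = muon_alpha G t *\<^sub>R muon_M G t - N t"

text \<open>
  Expanding \<open>norm (muon_err G N t)\<^sup>2\<close> along the recursion leaves the noise \<open>G t - N t\<close> in a linear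
  term only, paired with this direction, which depends on the gradients before \<open>t\<close> and on \<open>N t\<close>.
\<close>

definition muon_mart_dir :: "(nat \<Rightarrow> 'a::real_inner) \<Rightarrow> (nat \<Rightarrow> 'a) \<Rightarrow> nat \<Rightarrow> 'a" where
  "muon_mart_dir G N t = ((1 + muon_alpha G t) * muon_alpha G t) *\<^sub>R
     (((1 - muon_alpha G t) * muon_alpha G t) *\<^sub>R muon_M G (t - 1) - N t)"

definition muon_step_sum :: "(nat \<Rightarrow> 'a::real_inner) \<Rightarrow> nat \<Rightarrow> real" where
  "muon_step_sum G T = (\<Sum>t=1..T. muon_gamma G t * muon_alpha G t * (norm (muon_M G t))\<^sup>2)"

text \<open>In \<open>weighted_err_le\<close> the 11 splits into 1 for the initial error, 6 for the
  variation of the weights and 4 for the squared stochastic gradients; the 10 comes from the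
  gradient drift.\<close>

definition err_bound :: "nat \<Rightarrow> real \<Rightarrow> real \<Rightarrow> real \<Rightarrow> nat \<Rightarrow> real" where
  "err_bound n \<theta> L H T =
     (11 * varpi H ^ 4 + 10 * delta n \<theta> L) * (ln (exp 1 + H\<^sup>2) * ln (exp 1 + real T))"

text \<open>Since \<open>kappa H \<ge> 2\<close>, the cube alone is at least 8, more than enough for
  the \<open>7/2\<close> of \<open>ln_mom_sum_le\<close>.\<close>

lemma C_d_ge:
  assumes "H \<ge> 0"
  shows "7/2 * ln (exp 1 + H\<^sup>2) \<le> C_d H"
proof -
  have "kappa H \<ge> 2"
    using assms by (simp add: kappa_def)
  then have "8 \<le> kappa H ^ 3" "1 \<le> ln (exp 1 + kappa H)"
    using power_mono[of 2 "kappa H" 3] by (simp_all add: one_le_ln_exp_1_add)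
  then have "8 * 1 \<le> kappa H ^ 3 * ln (exp 1 + kappa H)"
    using \<open>kappa H \<ge> 2\<close> by (intro mult_mono) auto
  then have "7/2 * ln (exp 1 + H\<^sup>2) \<le> 3 * (kappa H ^ 3 * ln (exp 1 + kappa H)) * ln (exp 1 + H\<^sup>2)"
    using one_le_ln_exp_1_add[of "H\<^sup>2"] by (intro mult_right_mono) auto
  then show ?thesis
    by (simp add: C_d_def mult_ac)
qed

lemma C_d_nonneg: "H \<ge> 0 \<Longrightarrow> C_d H \<ge> 0"
  using C_d_ge[of H] one_le_ln_exp_1_add[of "H\<^sup>2"] by simp

text \<open>One realisation of the algorithm, free of probability. Orthogonalization enters through
  \<open>inner_Orth\<close> and \<open>norm_Orth\<close>, so the iterates live in any Euclidean
  space. The convention \<open>X 0 = X 1\<close> makes the drift of the first step zero.\<close>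

locale muon_path = bounded_grads G H
  for G :: "nat \<Rightarrow> 'a::euclidean_space" and H :: real +
  fixes X N :: "nat \<Rightarrow> 'a" and f :: "'a \<Rightarrow> real" and Orth :: "'a \<Rightarrow> 'a"
    and \<theta> L fstar :: real and n :: nat
  assumes params: "\<theta> > 0" "L > 0"
    and N_def: "\<And>t. N t = grad f (X t)"
    and X_0: "X 0 = X (Suc 0)"
    and X_step: "\<And>t. t \<ge> 1 \<Longrightarrow>
      X (Suc t) = X t - (\<theta> * muon_gamma G t * norm (muon_M G t)) *\<^sub>R Orth (muon_M G t)"
    and inner_Orth: "\<And>M. inner (Orth M) M \<ge> norm M"
    and norm_Orth: "\<And>M. norm (Orth M) = sqrt (real n)"
    and f_diff: "\<And>Y. f differentiable (at Y)"
    and smooth: "\<And>Y Z. norm (grad f Y - grad f Z) \<le> L * norm (Y - Z)"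
    and lower: "\<And>Y. f Y \<ge> fstar"
    and grad_bound: "\<And>Y. norm (grad f Y) \<le> H"
begin

abbreviation "\<alpha> \<equiv> muon_alpha G"
abbreviation "\<gamma> \<equiv> muon_gamma G"
abbreviation "M \<equiv> muon_M G"

abbreviation "err \<equiv> muon_err G N"
abbreviation "mart_dir \<equiv> muon_mart_dir G N"
abbreviation "noise t \<equiv> G t - N t"
abbreviation "step_sum \<equiv> muon_step_sum G"

section \<open>Recursion for the momentum error\<close>

lemma norm_N_le: "norm (N t) \<le> H"
  by (simp add: N_def grad_bound)

text \<open>The contracted vector carries the new weight and the new gradient but the old momentum.
  It thus differs from the old error by exactly the change of the weight and the drift, which
  \<open>alpha_err_le\<close> treats separately.\<close>

lemma err_Suc:
  "err (Suc k) = \<alpha> (Suc k) *\<^sub>R noise (Suc k) + (1 - \<alpha> (Suc k)) *\<^sub>R (\<alpha> (Suc k) *\<^sub>R M k - N (Suc k))"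
  by (simp add: muon_err_def algebra_simps)

text \<open>Trades the squared noise for the squared stochastic gradient, whose weighted sum is
  bounded on the path. The linear remainder joins the martingale.\<close>

lemma norm_noise_sq:
  "(norm (noise t))\<^sup>2 = (norm (G t))\<^sup>2 - 2 * inner (noise t) (N t) - (norm (N t))\<^sup>2"
  by (simp add: power2_norm_eq_inner inner_diff_left inner_diff_right inner_commute)

lemma norm_scaled_M_diff_le:
  assumes "a * norm (M k) \<le> varpi H * H" "0 \<le> a"
  shows "norm (a *\<^sub>R M k - N j) \<le> H * (1 + varpi H)"
proof -
  have "norm (a *\<^sub>R M k - N j) \<le> norm (a *\<^sub>R M k) + norm (N j)"
    by (rule norm_triangle_ineq4)
  then show ?thesis
    using assms norm_N_le[of j] by (simp add: algebra_simps)
qed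

lemma alpha_err_le:
  fixes k
  defines "t \<equiv> Suc k"
  shows "\<alpha> t * (norm (err t))\<^sup>2 \<le> (norm (err k))\<^sup>2 - (norm (err t))\<^sup>2
    + 2 * (H * (1 + varpi H)) * (\<bar>\<alpha> t - \<alpha> k\<bar> * norm (M k))
    + 2 * ((norm (N k - N t))\<^sup>2 / \<alpha> t) + 2 * ((\<alpha> t)\<^sup>2 * (norm (G t))\<^sup>2)
    + 2 * inner (noise t) (mart_dir t)"
proof -
  define a where "a = \<alpha> t"
  have a: "0 < a" "a \<le> 1"
    by (simp_all add: a_def muon_alpha_pos muon_alpha_le_1)
  define p where "p = a *\<^sub>R M k - N k"
  define y where "y = a *\<^sub>R M k - N t"
  \<comment> \<open>\<open>Z\<close> gathers all that is not contracted. It contains an inner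
    product with the noise and may be negative, so its factor \<open>1 + a\<close> below cannot
    simply be rounded up to 2.\<close>
  define Z where "Z = (norm (N k - N t))\<^sup>2 / a + a\<^sup>2 * (norm (noise t))\<^sup>2
    + 2 * a * (1 - a) * inner (noise t) y"
  have y: "y = p + (N k - N t)"
    by (simp add: y_def p_def)
  have "err t = a *\<^sub>R noise t + (1 - a) *\<^sub>R y"
    by (simp add: err_Suc t_def a_def y_def)
  then have "(norm (err t))\<^sup>2 = a\<^sup>2 * (norm (noise t))\<^sup>2 + (1 - a)\<^sup>2 * (norm y)\<^sup>2
      + 2 * a * (1 - a) * inner (noise t) y"
    by (simp add: norm_lincomb_sq)
  also have "\<dots> \<le> (1 - a) * (norm p)\<^sup>2 + Z"
    using contraction_ineq[OF a, of p "N k - N t"] by (simp add: Z_def y)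
  finally have main: "(norm (err t))\<^sup>2 \<le> (1 - a) * (norm p)\<^sup>2 + Z" .
  \<comment> \<open>\<open>main\<close> is used twice: multiplied by \<open>a\<close> it passes from
    the new error to \<open>p\<close>, and rearranged it bounds \<open>a * (norm p)\<^sup>2\<close>
    by a telescoping difference plus \<open>Z\<close>. The two copies of \<open>Z\<close> produce
    the factor \<open>1 + a\<close>, which reappears in \<open>muon_mart_dir\<close>.\<close>
  have "a * (norm (err t))\<^sup>2 \<le> a * ((1 - a) * (norm p)\<^sup>2 + Z)"
    using main a by (intro mult_left_mono) auto
  also have "\<dots> \<le> a * (norm p)\<^sup>2 + a * Z"
    using a by (simp add: algebra_simps)
  also have "\<dots> \<le> (norm p)\<^sup>2 - (norm (err t))\<^sup>2 + (1 + a) * Z"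
    using main by (simp add: algebra_simps)
  also have "(norm p)\<^sup>2 \<le> (norm (err k))\<^sup>2 + 2 * (H * (1 + varpi H)) * (\<bar>a - \<alpha> k\<bar> * norm (M k))"
  proof -
    have "(norm p)\<^sup>2 - (norm (err k))\<^sup>2 = inner (p - err k) (p + err k)"
      by (simp add: power2_norm_eq_inner inner_add_right inner_diff_left inner_diff_right inner_commute)
    also have "\<dots> \<le> norm (p - err k) * norm (p + err k)"
      by (rule norm_cauchy_schwarz)
    also have "p - err k = (a - \<alpha> k) *\<^sub>R M k"
      by (simp add: p_def muon_err_def algebra_simps)
    also have "norm ((a - \<alpha> k) *\<^sub>R M k) * norm (p + err k)
        \<le> (\<bar>a - \<alpha> k\<bar> * norm (M k)) * (H * (1 + varpi H) + H * (1 + varpi H))"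
    proof (intro mult_mono)
      have "norm (p + err k) \<le> norm p + norm (err k)"
        by (rule norm_triangle_ineq)
      also have "\<dots> \<le> H * (1 + varpi H) + H * (1 + varpi H)"
        unfolding p_def muon_err_def a_def t_def
        by (intro add_mono norm_scaled_M_diff_le muon_alpha_M_le muon_alpha_Suc_M_le)
          (simp_all add: muon_alpha_pos less_imp_le)
      finally show "norm (p + err k) \<le> H * (1 + varpi H) + H * (1 + varpi H)" .
    qed auto
    finally show ?thesis
      by (simp add: algebra_simps)
  qed
  also have "(1 + a) * Z \<le> 2 * ((norm (N k - N t))\<^sup>2 / a) + 2 * (a\<^sup>2 * (norm (G t))\<^sup>2)
      + 2 * inner (noise t) (mart_dir t)"
  proof -
    have "mart_dir t = ((1 + a) * a) *\<^sub>R ((1 - a) *\<^sub>R y - a *\<^sub>R N t)"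
      by (simp add: muon_mart_dir_def t_def a_def y_def algebra_simps)
    then have dir: "inner (noise t) (mart_dir t) =
        (1 + a) * a * ((1 - a) * inner (noise t) y - a * inner (noise t) (N t))"
      by (simp add: inner_diff_right)
    \<comment> \<open>The linear noise terms are kept exactly, since they are to have mean zero.
      Only the nonnegative terms are rounded up, and the one in \<open>N t\<close> is
      dropped.\<close>
    have "(1 + a) * Z = (1 + a) * ((norm (N k - N t))\<^sup>2 / a) + (1 + a) * (a\<^sup>2 * (norm (G t))\<^sup>2)
        - (1 + a) * (a\<^sup>2 * (norm (N t))\<^sup>2) + 2 * inner (noise t) (mart_dir t)"
      unfolding Z_def norm_noise_sq dir by algebra
    moreover have "(1 + a) * v \<le> 2 * v" "0 \<le> (1 + a) * v" if "v \<ge> 0" for v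
      using a that by (auto intro!: mult_right_mono)
    moreover have "0 \<le> (norm (N k - N t))\<^sup>2 / a" "0 \<le> a\<^sup>2 * (norm (G t))\<^sup>2" "0 \<le> a\<^sup>2 * (norm (N t))\<^sup>2"
      using a by auto
    ultimately show ?thesis by (smt (verit))
  qed
  finally show ?thesis
    by (simp add: a_def)
qed

lemma norm_step: "t \<ge> 1 \<Longrightarrow> norm (X t - X (Suc t)) = \<theta> * sqrt (real n) * (\<gamma> t * norm (M t))"
  using params muon_gamma_pos[of G t] by (simp add: X_step norm_Orth)

text \<open>Smoothness bounds the drift by the length of the preceding step. The weight at
  \<open>Suc t\<close> is then exchanged for the one at \<open>t\<close> at the cost of
  \<open>sqrt 2\<close>, so that \<open>sum_step_sq_div_alpha_le\<close> applies.\<close>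

lemma sum_grad_diff_le:
  "(\<Sum>t=1..T. (norm (N (t - 1) - N t))\<^sup>2 / \<alpha> t) \<le> sqrt 2 * delta n \<theta> L * ln (mom_sum G T)"
proof (cases T)
  case (Suc K)
  have "(norm (N t - N (Suc t)))\<^sup>2 / \<alpha> (Suc t) \<le> sqrt 2 * delta n \<theta> L * ((\<gamma> t * norm (M t))\<^sup>2 / \<alpha> t)"
    if "t \<ge> 1" for t
  proof -
    have "norm (N t - N (Suc t)) \<le> L * (\<theta> * sqrt (real n) * (\<gamma> t * norm (M t)))"
      using smooth[of "X t" "X (Suc t)"] norm_step[OF that] by (simp add: N_def)
    then have "(norm (N t - N (Suc t)))\<^sup>2 \<le> (L * (\<theta> * sqrt (real n) * (\<gamma> t * norm (M t))))\<^sup>2"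
      by (intro power_mono) auto
    also have "\<dots> = delta n \<theta> L * (\<gamma> t * norm (M t))\<^sup>2"
      by (simp add: delta_def power_mult_distrib)
    finally have "(norm (N t - N (Suc t)))\<^sup>2 / \<alpha> (Suc t) \<le> delta n \<theta> L * (\<gamma> t * norm (M t))\<^sup>2 / \<alpha> (Suc t)"
      by (intro divide_right_mono) (auto simp: muon_alpha_pos less_imp_le)
    also have "\<dots> \<le> delta n \<theta> L * (\<gamma> t * norm (M t))\<^sup>2 * (sqrt 2 / \<alpha> t)"
    proof -
      have "1 / \<alpha> (Suc t) \<le> sqrt 2 / \<alpha> t"
        using muon_alpha_ratio[of G t] muon_alpha_pos[of G t] muon_alpha_pos[of G "Suc t"]
        by (simp add: field_simps)
      then have "delta n \<theta> L * (\<gamma> t * norm (M t))\<^sup>2 * (1 / \<alpha> (Suc t))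
          \<le> delta n \<theta> L * (\<gamma> t * norm (M t))\<^sup>2 * (sqrt 2 / \<alpha> t)"
        by (intro mult_left_mono) (auto simp: delta_def)
      then show ?thesis by simp
    qed
    finally show ?thesis
      by (simp add: mult_ac)
  qed
  then have "(\<Sum>t=1..K. (norm (N t - N (Suc t)))\<^sup>2 / \<alpha> (Suc t))
      \<le> (\<Sum>t=1..K. sqrt 2 * delta n \<theta> L * ((\<gamma> t * norm (M t))\<^sup>2 / \<alpha> t))"
    by (intro sum_mono) auto
  also have "\<dots> \<le> sqrt 2 * delta n \<theta> L * ln (mom_sum G K)"
    unfolding sum_distrib_left[symmetric]
    by (intro mult_left_mono sum_step_sq_div_alpha_le) (auto simp: delta_def)
  also have "\<dots> \<le> sqrt 2 * delta n \<theta> L * ln (mom_sum G T)"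
    using mom_sum_ge_1[of G K] mom_sum_mono[of K T G]
    by (intro mult_left_mono) (auto simp: Suc delta_def)
  also have "(\<Sum>t=1..K. (norm (N t - N (Suc t)))\<^sup>2 / \<alpha> (Suc t)) =
      (\<Sum>t=1..T. (norm (N (t - 1) - N t))\<^sup>2 / \<alpha> t)"
  proof -
    have "(\<Sum>t=1..T. (norm (N (t - 1) - N t))\<^sup>2 / \<alpha> t) =
        (\<Sum>t=0..K. (norm (N t - N (Suc t)))\<^sup>2 / \<alpha> (Suc t))"
      using sum.shift_bounds_cl_Suc_ivl[of "\<lambda>t. (norm (N (t - 1) - N t))\<^sup>2 / \<alpha> t" 0 K] by (simp add: Suc)
    also have "\<dots> = (\<Sum>t=1..K. (norm (N t - N (Suc t)))\<^sup>2 / \<alpha> (Suc t))"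
      by (subst sum.atLeast_Suc_atMost) (simp_all add: N_def X_0)
    finally show ?thesis by simp
  qed
  finally show ?thesis .
qed (simp add: mom_sum_def)

lemma sum_alpha_grad_sq_le_ln:
  "(\<Sum>t=1..T. (\<alpha> t)\<^sup>2 * (norm (G t))\<^sup>2)
    \<le> 2 * varpi H ^ 4 * (ln (exp 1 + H\<^sup>2) * ln (exp 1 + real T))"
proof -
  let ?x = "ln (exp 1 + real T)" and ?y = "ln (exp 1 + H\<^sup>2)"
  have "ln (grad_sum G T) \<le> 2 * (?y * ?x)"
    using ln_grad_sum_le[of T] add_le_2_mult[of ?y ?x] by (simp add: one_le_ln_exp_1_add)
  then have "varpi H ^ 4 * ln (grad_sum G T) \<le> varpi H ^ 4 * (2 * (?y * ?x))"
    using varpi_ge_1[of H] by (intro mult_left_mono) auto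
  then show ?thesis
    using sum_alpha_grad_sq_le[of T] by simp
qed

lemma weighted_err_le:
  "(\<Sum>t=1..T. \<alpha> t * (norm (err t))\<^sup>2)
    \<le> err_bound n \<theta> L H T + 2 * (\<Sum>t=1..T. inner (noise t) (mart_dir t))"
proof -
  let ?x = "ln (exp 1 + real T)" and ?y = "ln (exp 1 + H\<^sup>2)" and ?w = "varpi H"
  define V where "V = (\<Sum>t=1..T. \<bar>\<alpha> t - \<alpha> (t - 1)\<bar> * norm (M (t - 1)))"
  define S where "S = (\<Sum>t=1..T. (norm (N (t - 1) - N t))\<^sup>2 / \<alpha> t)"
  define R where "R = (\<Sum>t=1..T. (\<alpha> t)\<^sup>2 * (norm (G t))\<^sup>2)"
  define Q where "Q = (\<Sum>t=1..T. inner (noise t) (mart_dir t))"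
  have "1 \<le> ?x" "1 \<le> ?y"
    by (simp_all add: one_le_ln_exp_1_add)
  then have xy: "?x \<le> ?y * ?x" "?y \<le> ?y * ?x" "1 \<le> ?y * ?x"
    using mult_left_mono[of 1 ?x ?y] mult_right_mono[of 1 ?y ?x] by linarith+
  have w: "?w \<ge> 1" "H\<^sup>2 \<le> ?w\<^sup>2" "H \<ge> 0"
    using varpi_ge_1[of H] H_nonneg by (auto simp: varpi_sq)
  have "(\<Sum>t=1..k. \<alpha> t * (norm (err t))\<^sup>2) \<le> (norm (err 0))\<^sup>2 - (norm (err k))\<^sup>2
    + 2 * (H * (1 + ?w)) * (\<Sum>t=1..k. \<bar>\<alpha> t - \<alpha> (t - 1)\<bar> * norm (M (t - 1)))
    + 2 * (\<Sum>t=1..k. (norm (N (t - 1) - N t))\<^sup>2 / \<alpha> t) + 2 * (\<Sum>t=1..k. (\<alpha> t)\<^sup>2 * (norm (G t))\<^sup>2)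
    + 2 * (\<Sum>t=1..k. inner (noise t) (mart_dir t))" for k
  proof (induction k)
    case (Suc k)
    then show ?case
      using alpha_err_le[of k] by (simp add: distrib_left del: muon_M.simps)
  qed simp
  from this[of T] have "(\<Sum>t=1..T. \<alpha> t * (norm (err t))\<^sup>2)
      \<le> (norm (err 0))\<^sup>2 + 2 * (H * (1 + ?w)) * V + 2 * S + 2 * R + 2 * Q"
    unfolding V_def[symmetric] S_def[symmetric] R_def[symmetric] Q_def[symmetric]
    using zero_le_power2[of "norm (err T)"] by linarith
  also have "(norm (err 0))\<^sup>2 \<le> ?w ^ 4 * (?y * ?x)"
  proof -
    have "(norm (err 0))\<^sup>2 \<le> H\<^sup>2"
      using norm_N_le[of 0] by (simp add: muon_err_def power_mono)
    also have "\<dots> \<le> ?w ^ 4 * 1"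
      using w(2) power_increasing[of 2 4 ?w] w(1) by linarith
    also have "\<dots> \<le> ?w ^ 4 * (?y * ?x)"
      using w xy by (intro mult_left_mono) auto
    finally show ?thesis .
  qed
  also have "2 * (H * (1 + ?w)) * V \<le> 6 * ?w ^ 4 * (?y * ?x)"
  proof -
    have "V \<le> ?w * H * ((ln (grad_max G T) + ln (grad_sum G T)) / 2)"
      unfolding V_def by (rule sum_alpha_variation_le)
    also have "\<dots> \<le> ?w * H * ((3 * (?y * ?x)) / 2)"
      using w xy ln_grad_max_le[of T] ln_grad_sum_le[of T]
      by (intro mult_left_mono divide_right_mono) auto
    finally have "2 * (H * (1 + ?w)) * V \<le> 2 * (H * (1 + ?w)) * (?w * H * ((3 * (?y * ?x)) / 2))"
      using w by (intro mult_left_mono) auto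
    also have "\<dots> = 3 * (H\<^sup>2 * ((1 + ?w) * ?w)) * (?y * ?x)"
      by (simp add: power2_eq_square)
    also have "\<dots> \<le> 3 * (?w\<^sup>2 * ((2 * ?w) * ?w)) * (?y * ?x)"
      using w xy by (intro mult_left_mono mult_right_mono mult_mono) auto
    also have "\<dots> = 6 * ?w ^ 4 * (?y * ?x)"
      by (simp add: power2_eq_square power4_eq_xxxx)
    finally show ?thesis .
  qed
  also have "2 * S \<le> 10 * delta n \<theta> L * (?y * ?x)"
  proof -
    have d: "delta n \<theta> L \<ge> 0"
      by (simp add: delta_def)
    have "S \<le> sqrt 2 * delta n \<theta> L * ln (mom_sum G T)"
      unfolding S_def by (rule sum_grad_diff_le)
    \<comment> \<open>A rational upper bound for \<open>sqrt 2\<close> chosen to cancel the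
      \<open>7/2\<close> of \<open>ln_mom_sum_le\<close>.\<close>
    also have "\<dots> \<le> 10/7 * delta n \<theta> L * (7/2 * (?y * ?x))"
    proof (intro mult_mono ln_mom_sum_le)
      show "sqrt 2 \<le> 10/7"
        by (rule real_le_lsqrt) (auto simp: power2_eq_square)
    qed (use d mom_sum_ge_1[of G T] in auto)
    finally show ?thesis by simp
  qed
  also have "2 * R \<le> 4 * ?w ^ 4 * (?y * ?x)"
    using sum_alpha_grad_sq_le_ln[of T] by (simp add: R_def mult_ac)
  finally show ?thesis
    by (simp add: err_bound_def Q_def algebra_simps)
qed

text \<open>The factor \<open>\<alpha> t\<close> is the point: it turns the squared increments of
  the martingale into multiples of \<open>(\<alpha> t)\<^sup>2 * (norm (noise t))\<^sup>2\<close>.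
  The 4 is made of \<open>1 + \<alpha> t \<le> 2\<close> and
  \<open>1 + varpi H \<le> 2 * varpi H\<close>.\<close>

lemma norm_mart_dir_le: "t \<ge> 1 \<Longrightarrow> norm (mart_dir t) \<le> 4 * varpi H * H * \<alpha> t"
proof -
  assume "t \<ge> 1"
  then obtain k where t: "t = Suc k" by (cases t) auto
  have a: "0 < \<alpha> t" "\<alpha> t \<le> 1"
    by (simp_all add: muon_alpha_pos muon_alpha_le_1)
  have "norm (((1 - \<alpha> t) * \<alpha> t) *\<^sub>R M k - N t) \<le> H * (1 + varpi H)"
  proof (rule norm_scaled_M_diff_le)
    have "(1 - \<alpha> t) * (\<alpha> t * norm (M k)) \<le> 1 * (\<alpha> t * norm (M k))"
      using a by (intro mult_right_mono) auto
    then show "(1 - \<alpha> t) * \<alpha> t * norm (M k) \<le> varpi H * H"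
      using muon_alpha_Suc_M_le[of k] by (simp add: t)
  qed (use a in auto)
  also have "\<dots> \<le> H * (2 * varpi H)"
    using varpi_ge_1[of H] H_nonneg by (intro mult_left_mono) auto
  finally have "norm (mart_dir t) \<le> ((1 + \<alpha> t) * \<alpha> t) * (H * (2 * varpi H))"
    using a by (simp add: muon_mart_dir_def t mult_left_mono)
  also have "\<dots> \<le> (2 * \<alpha> t) * (H * (2 * varpi H))"
    using a varpi_ge_1[of H] H_nonneg by (intro mult_right_mono) auto
  finally show ?thesis by (simp add: mult_ac)
qed

text \<open>Writing \<open>N t\<close> as \<open>\<alpha> t *\<^sub>R M t - err t\<close> splits the
  first-order term. Alignment of \<open>Orth\<close> with the momentum gives the decrease, and
  completing a square spends half of it on the error term. The first branch of the minimum in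
  \<open>\<gamma>\<close> then replaces \<open>\<gamma> t / \<alpha> t\<close> by
  \<open>\<alpha> t\<close>.\<close>

lemma descent_step:
  assumes "t \<ge> 1"
  shows "f (X (Suc t)) \<le> f (X t) - c_0 \<theta> * (\<gamma> t * \<alpha> t * (norm (M t))\<^sup>2)
    + c_1 n \<theta> * (\<alpha> t * (norm (err t))\<^sup>2) + c_2 n \<theta> L * (\<gamma> t * norm (M t))\<^sup>2"
proof -
  define s where "s = \<theta> * \<gamma> t * norm (M t)"
  have g: "\<gamma> t > 0" and a: "\<alpha> t > 0"
    by (simp_all add: muon_gamma_pos muon_alpha_pos)
  then have s: "s \<ge> 0"
    using params by (simp add: s_def)
  have "f (X (Suc t)) = f (X t + (- s) *\<^sub>R Orth (M t))"
    using X_step[OF assms] by (simp add: s_def)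
  also have "\<dots> \<le> f (X t) + inner ((- s) *\<^sub>R Orth (M t)) (N t) + L / 2 * (norm ((- s) *\<^sub>R Orth (M t)))\<^sup>2"
    unfolding N_def by (rule descent_lemma[OF f_diff smooth])
  also have "L / 2 * (norm ((- s) *\<^sub>R Orth (M t)))\<^sup>2 = c_2 n \<theta> L * (\<gamma> t * norm (M t))\<^sup>2"
    by (simp add: norm_Orth c_2_def power_mult_distrib s_def)
  also have "inner ((- s) *\<^sub>R Orth (M t)) (N t) =
      - (s * \<alpha> t) * inner (Orth (M t)) (M t) + s * inner (Orth (M t)) (err t)"
    by (simp add: muon_err_def inner_diff_right algebra_simps)
  also have "\<dots> \<le> - (s * \<alpha> t) * norm (M t) + s * (sqrt (real n) * norm (err t))"
  proof (intro add_mono)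
    show "- (s * \<alpha> t) * inner (Orth (M t)) (M t) \<le> - (s * \<alpha> t) * norm (M t)"
      using s a inner_Orth[of "M t"] by (intro mult_left_mono_neg) auto
    show "s * inner (Orth (M t)) (err t) \<le> s * (sqrt (real n) * norm (err t))"
      using s norm_cauchy_schwarz[of "Orth (M t)" "err t"] by (intro mult_left_mono) (auto simp: norm_Orth)
  qed
  also have "\<dots> = \<theta> * \<gamma> t * (norm (M t) * (sqrt (real n) * norm (err t)) - \<alpha> t * (norm (M t))\<^sup>2)"
    by (simp add: s_def algebra_simps power2_eq_square)
  also have "\<dots> \<le> \<theta> * \<gamma> t * (real n * (norm (err t))\<^sup>2 / (2 * \<alpha> t) - \<alpha> t * (norm (M t))\<^sup>2 / 2)"
  proof (rule mult_left_mono)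
    have "0 \<le> (\<alpha> t * norm (M t) - sqrt (real n) * norm (err t))\<^sup>2 / (2 * \<alpha> t)"
      using a by simp
    also have "\<dots> = (\<alpha> t)\<^sup>2 * (norm (M t))\<^sup>2 / (2 * \<alpha> t) + real n * (norm (err t))\<^sup>2 / (2 * \<alpha> t)
        - \<alpha> t * (norm (M t) * (sqrt (real n) * norm (err t))) / \<alpha> t"
      by (simp add: power2_diff power_mult_distrib add_divide_distrib diff_divide_distrib)
    finally show "norm (M t) * (sqrt (real n) * norm (err t)) - \<alpha> t * (norm (M t))\<^sup>2
        \<le> real n * (norm (err t))\<^sup>2 / (2 * \<alpha> t) - \<alpha> t * (norm (M t))\<^sup>2 / 2"
      using a by (simp add: power2_eq_square)
  qed (use params g in auto)
  also have "\<dots> = c_1 n \<theta> * (\<gamma> t / \<alpha> t * (norm (err t))\<^sup>2) - c_0 \<theta> * (\<gamma> t * \<alpha> t * (norm (M t))\<^sup>2)"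
    by (simp add: c_0_def c_1_def algebra_simps)
  also have "c_1 n \<theta> * (\<gamma> t / \<alpha> t * (norm (err t))\<^sup>2) \<le> c_1 n \<theta> * (\<alpha> t * (norm (err t))\<^sup>2)"
  proof (intro mult_left_mono mult_right_mono)
    show "\<gamma> t / \<alpha> t \<le> \<alpha> t"
      using a muon_gamma_le[of G t] by (simp add: divide_le_eq power2_eq_square)
  qed (use params in \<open>auto simp: c_1_def\<close>)
  finally show ?thesis by simp
qed

section \<open>From the summed descent to the gradient norms\<close>

lemma step_sum_le:
  "c_0 \<theta> * step_sum T \<le> f (X 1) - fstar
    + c_1 n \<theta> * (\<Sum>t=1..T. \<alpha> t * (norm (err t))\<^sup>2) + c_2 n \<theta> L * ln (mom_sum G T)"
proof -
  have "f (X (Suc T)) + c_0 \<theta> * step_sum T \<le> f (X 1)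
    + c_1 n \<theta> * (\<Sum>t=1..T. \<alpha> t * (norm (err t))\<^sup>2) + c_2 n \<theta> L * (\<Sum>t=1..T. (\<gamma> t * norm (M t))\<^sup>2)"
  proof (induction T)
    case (Suc T)
    then show ?case
      using descent_step[of "Suc T"] by (simp add: muon_step_sum_def distrib_left del: muon_M.simps)
  qed (simp add: muon_step_sum_def)
  moreover have "c_2 n \<theta> L * (\<Sum>t=1..T. (\<gamma> t * norm (M t))\<^sup>2) \<le> c_2 n \<theta> L * ln (mom_sum G T)"
    using params by (intro mult_left_mono sum_step_sq_le) (auto simp: c_2_def)
  ultimately show ?thesis
    using lower[of "X (Suc T)"] by linarith
qed

lemma step_sum_nonneg: "step_sum T \<ge> 0"
  unfolding muon_step_sum_def
  by (intro sum_nonneg) (auto intro!: mult_nonneg_nonneg simp: muon_alpha_pos muon_gamma_pos less_imp_le)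

lemma inverse_alpha_le:
  assumes "1 \<le> t" "t \<le> T"
  shows "1 \<le> \<alpha> t * sqrt (grad_sum G T)"
proof -
  obtain k where t: "t = Suc k" using assms by (cases t) auto
  have "1 \<le> \<alpha> t * sqrt (grad_sum G k)"
    using muon_alpha_ge[of G k] grad_sum_ge_1[of G k] by (simp add: t divide_le_eq)
  also have "\<dots> \<le> \<alpha> t * sqrt (grad_sum G T)"
    using assms t by (intro mult_left_mono real_sqrt_le_mono grad_sum_mono) (auto simp: muon_alpha_pos less_imp_le)
  finally show ?thesis .
qed

text \<open>Depending on the active branch of the minimum, the sum \<open>U\<close> is at most
  \<open>Q * r\<close> or \<open>Q * b\<close>. In the second case \<open>b\<close> itself depends
  on \<open>U\<close> through \<open>b\<^sup>2 \<le> 1 + U * r\<close>, so a quadratic inequality in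
  \<open>U\<close> remains.\<close>

lemma momentum_sum_le:
  "(\<Sum>t=1..T. (\<alpha> t * norm (M t))\<^sup>2) \<le> (step_sum T + (step_sum T)\<^sup>2) * sqrt (grad_sum G T)"
proof -
  define r where "r = sqrt (grad_sum G T)"
  define U where "U = (\<Sum>t=1..T. (\<alpha> t * norm (M t))\<^sup>2)"
  define b where "b = sqrt (mom_sum G T)"
  define Q where "Q = step_sum T"
  have r: "r \<ge> 1" and b: "b \<ge> 1"
    by (simp_all add: r_def b_def grad_sum_ge_1 mom_sum_ge_1)
  have Q: "Q \<ge> 0"
    by (simp add: Q_def step_sum_nonneg)
  have U: "U \<ge> 0"
    by (simp add: U_def sum_nonneg)
  have "min (1 / r) (1 / b) * U \<le> Q"
    unfolding U_def Q_def muon_step_sum_def sum_distrib_left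
  proof (rule sum_mono)
    fix t assume t: "t \<in> {1..T}"
    have "min (1 / r) (1 / b) \<le> min (\<alpha> t) (1 / sqrt (mom_sum G t))"
    proof (rule min.mono)
      show "1 / r \<le> \<alpha> t"
        using inverse_alpha_le[of t T] t r by (simp add: r_def divide_le_eq)
      show "1 / b \<le> 1 / sqrt (mom_sum G t)"
        using t mom_sum_ge_1[of G t] by (simp add: b_def frac_le mom_sum_mono)
    qed
    then have "min (1 / r) (1 / b) * (\<alpha> t * norm (M t))\<^sup>2 \<le> min (\<alpha> t) (1 / sqrt (mom_sum G t)) * (\<alpha> t * norm (M t))\<^sup>2"
      by (rule mult_right_mono) simp
    also have "\<dots> = \<gamma> t * \<alpha> t * (norm (M t))\<^sup>2"
      by (simp add: muon_gamma_eq power2_eq_square)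
    finally show "min (1 / r) (1 / b) * (\<alpha> t * norm (M t))\<^sup>2 \<le> \<gamma> t * \<alpha> t * (norm (M t))\<^sup>2" .
  qed
  then have cases: "U \<le> Q * r \<or> U \<le> Q * b"
    using r b by (auto simp: min_def field_simps split: if_splits)
  have b2: "b\<^sup>2 \<le> 1 + U * r"
  proof -
    have "(\<Sum>j=1..T. \<alpha> j * (norm (M j))\<^sup>2) \<le> (\<Sum>j=1..T. (\<alpha> j * norm (M j))\<^sup>2 * r)"
    proof (rule sum_mono)
      fix j assume j: "j \<in> {1..T}"
      have "\<alpha> j * (norm (M j))\<^sup>2 * 1 \<le> \<alpha> j * (norm (M j))\<^sup>2 * (\<alpha> j * r)"
        using inverse_alpha_le[of j T] j by (intro mult_left_mono) (auto simp: r_def muon_alpha_pos less_imp_le)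
      then show "\<alpha> j * (norm (M j))\<^sup>2 \<le> (\<alpha> j * norm (M j))\<^sup>2 * r"
        by (simp add: power2_eq_square mult_ac)
    qed
    then show ?thesis
      using mom_sum_ge_1[of G T] by (simp add: b_def mom_sum_def U_def sum_distrib_right)
  qed
  have "U \<le> (Q + Q\<^sup>2) * r"
    using cases
  proof
    assume "U \<le> Q * r"
    also have "\<dots> \<le> (Q + Q\<^sup>2) * r"
      using r by (intro mult_right_mono) auto
    finally show ?thesis .
  next
    assume "U \<le> Q * b"
    then have "U\<^sup>2 \<le> Q\<^sup>2 * b\<^sup>2"
      using U by (metis power_mono power_mult_distrib)
    also have "\<dots> \<le> Q\<^sup>2 * (1 + U * r)"
      using b2 by (intro mult_left_mono) auto
    finally have *: "U * (U - Q\<^sup>2 * r) \<le> Q * Q"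
      by (simp add: algebra_simps power2_eq_square)
    \<comment> \<open>If this failed, both factors on the left of \<open>*\<close> would exceed
      \<open>Q\<close>.\<close>
    have "U \<le> Q + Q\<^sup>2 * r"
    proof (rule ccontr)
      assume "\<not> ?thesis"
      then have 1: "U - Q\<^sup>2 * r > Q" by simp
      then have "U > Q"
        using r Q by (smt (verit) mult_nonneg_nonneg zero_le_power2)
      then have "Q * Q < U * (U - Q\<^sup>2 * r)"
        using 1 Q by (intro mult_strict_mono') auto
      with * show False by simp
    qed
    also have "\<dots> \<le> (Q + Q\<^sup>2) * r"
      using r Q mult_left_mono[of 1 r Q] by (simp add: algebra_simps)
    finally show ?thesis .
  qed
  then show ?thesis
    by (simp add: U_def Q_def r_def)
qed

lemma sqrt_sum_grad_sq_le:
  "sqrt (\<Sum>t=1..T. (norm (N t))\<^sup>2)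
    \<le> sqrt ((step_sum T + (step_sum T)\<^sup>2) * sqrt (grad_sum G T))
      + sqrt ((\<Sum>t=1..T. \<alpha> t * (norm (err t))\<^sup>2) * sqrt (grad_sum G T))"
proof -
  have "sqrt (\<Sum>t=1..T. (norm (N t))\<^sup>2) \<le> L2_set (\<lambda>t. \<alpha> t * norm (M t) + norm (err t)) {1..T}"
    unfolding L2_set_def
  proof (intro real_sqrt_le_mono sum_mono power_mono)
    fix t
    have "N t = \<alpha> t *\<^sub>R M t - err t"
      by (simp add: muon_err_def)
    then have "norm (N t) \<le> norm (\<alpha> t *\<^sub>R M t) + norm (err t)"
      by (metis norm_triangle_ineq4)
    then show "norm (N t) \<le> \<alpha> t * norm (M t) + norm (err t)"
      using muon_alpha_pos[of G t] by simp
  qed simp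
  also have "\<dots> \<le> L2_set (\<lambda>t. \<alpha> t * norm (M t)) {1..T} + L2_set (\<lambda>t. norm (err t)) {1..T}"
    by (rule L2_set_triangle_ineq)
  also have "L2_set (\<lambda>t. \<alpha> t * norm (M t)) {1..T}
      \<le> sqrt ((step_sum T + (step_sum T)\<^sup>2) * sqrt (grad_sum G T))"
    unfolding L2_set_def by (intro real_sqrt_le_mono momentum_sum_le)
  also have "L2_set (\<lambda>t. norm (err t)) {1..T}
      \<le> sqrt ((\<Sum>t=1..T. \<alpha> t * (norm (err t))\<^sup>2) * sqrt (grad_sum G T))"
    unfolding L2_set_def sum_distrib_right
  proof (intro real_sqrt_le_mono sum_mono)
    fix t assume t: "t \<in> {1..T}"
    have "(norm (err t))\<^sup>2 * 1 \<le> (norm (err t))\<^sup>2 * (\<alpha> t * sqrt (grad_sum G T))"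
      using inverse_alpha_le[of t T] t by (intro mult_left_mono) auto
    then show "(norm (err t))\<^sup>2 \<le> \<alpha> t * (norm (err t))\<^sup>2 * sqrt (grad_sum G T)"
      by (simp add: mult_ac)
  qed
  finally show ?thesis by simp
qed

text \<open>Closes the loop: the factor \<open>r\<close> that multiplies the bound on the gradients
  is itself controlled by the gradients and the noise.\<close>

lemma sqrt_grad_sum_le:
  "sqrt (grad_sum G T) \<le> 1 + sqrt (\<Sum>t=1..T. (norm (N t))\<^sup>2) + sqrt (\<Sum>t=1..T. (norm (noise t))\<^sup>2)"
proof -
  have "sqrt (grad_sum G T) \<le> sqrt 1 + sqrt (\<Sum>t=1..T. (norm (G t))\<^sup>2)"
    unfolding grad_sum_def by (rule sqrt_add_le_add_sqrt) (auto simp: sum_nonneg)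
  also have "sqrt (\<Sum>t=1..T. (norm (G t))\<^sup>2) \<le> L2_set (\<lambda>t. norm (N t) + norm (noise t)) {1..T}"
    unfolding L2_set_def
  proof (intro real_sqrt_le_mono sum_mono power_mono)
    fix t
    show "norm (G t) \<le> norm (N t) + norm (noise t)"
      by (metis add.commute diff_add_cancel norm_triangle_ineq)
  qed simp
  also have "\<dots> \<le> L2_set (\<lambda>t. norm (N t)) {1..T} + L2_set (\<lambda>t. norm (noise t)) {1..T}"
    by (rule L2_set_triangle_ineq)
  finally show ?thesis
    by (simp add: L2_set_def)
qed

text \<open>The interface to the expectations: path sums are replaced by \<open>v\<close> and
  \<open>q\<close>, affine in the martingale. Neither is visibly nonnegative; that follows because
  they dominate nonnegative sums.\<close>

lemma grad_norm_le:
  fixes T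
  defines "l \<equiv> ln (exp 1 + real T)"
  assumes v: "v = err_bound n \<theta> L H T + 2 * (\<Sum>t=1..T. inner (noise t) (mart_dir t))"
    and q: "q = (f (X 1) - fstar + c_1 n \<theta> * v + c_2 n \<theta> L * (C_d H * l)) / c_0 \<theta>"
  shows "0 \<le> v" "0 \<le> q"
    "sqrt (\<Sum>t=1..T. (norm (N t))\<^sup>2)
      \<le> sqrt ((q + q\<^sup>2) * sqrt (grad_sum G T)) + sqrt (v * sqrt (grad_sum G T))"
proof -
  let ?V = "\<Sum>t=1..T. \<alpha> t * (norm (err t))\<^sup>2"
  have "0 \<le> ?V"
    by (intro sum_nonneg mult_nonneg_nonneg) (auto simp: muon_alpha_pos less_imp_le)
  moreover have V: "?V \<le> v"
    unfolding v by (rule weighted_err_le)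
  ultimately show "0 \<le> v" by linarith
  have l: "1 \<le> l"
    by (simp add: l_def one_le_ln_exp_1_add)
  have c: "0 < c_0 \<theta>" "0 \<le> c_1 n \<theta>" "0 \<le> c_2 n \<theta> L"
    using params by (auto simp: c_0_def c_1_def c_2_def)
  have "ln (mom_sum G T) \<le> 7/2 * ln (exp 1 + H\<^sup>2) * l"
    using ln_mom_sum_le[of T] by (simp add: l_def)
  also have "\<dots> \<le> C_d H * l"
    using l C_d_ge[OF H_nonneg] by (intro mult_right_mono) auto
  finally have W: "ln (mom_sum G T) \<le> C_d H * l" .
  have "c_0 \<theta> * step_sum T \<le> f (X 1) - fstar + c_1 n \<theta> * ?V + c_2 n \<theta> L * ln (mom_sum G T)"
    by (rule step_sum_le)
  also have "\<dots> \<le> c_0 \<theta> * q"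
    using mult_left_mono[OF V c(2)] mult_left_mono[OF W c(3)] c(1) by (simp add: q)
  finally have Q: "step_sum T \<le> q"
    using c(1) by simp
  then show "0 \<le> q"
    using step_sum_nonneg[of T] by linarith
  have r: "0 \<le> sqrt (grad_sum G T)"
    using grad_sum_ge_1[of G T] by simp
  have "step_sum T + (step_sum T)\<^sup>2 \<le> q + q\<^sup>2"
    using Q step_sum_nonneg[of T] by (intro add_mono power_mono) auto
  then have "sqrt ((step_sum T + (step_sum T)\<^sup>2) * sqrt (grad_sum G T)) \<le> sqrt ((q + q\<^sup>2) * sqrt (grad_sum G T))"
    "sqrt (?V * sqrt (grad_sum G T)) \<le> sqrt (v * sqrt (grad_sum G T))"
    using V r by (auto intro!: mult_right_mono)
  then show "sqrt (\<Sum>t=1..T. (norm (N t))\<^sup>2)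
      \<le> sqrt ((q + q\<^sup>2) * sqrt (grad_sum G T)) + sqrt (v * sqrt (grad_sum G T))"
    using sqrt_sum_grad_sq_le[of T] by linarith
qed

end

subsection \<open>Orthogonalization and measurability\<close>

lemma inner_matrix_mult_left:
  fixes A :: "real^'k^'m" and B :: "real^'n^'k" and C :: "real^'n^'m"
  shows "inner (A ** B) C = inner B (transpose A ** C)"
proof -
  have "inner (A ** B) C = (\<Sum>i\<in>UNIV. \<Sum>j\<in>UNIV. \<Sum>k\<in>UNIV. A $ i $ k * B $ k $ j * C $ i $ j)"
    by (simp add: inner_vec_def matrix_matrix_mult_def sum_distrib_right)
  also have "\<dots> = (\<Sum>i\<in>UNIV. \<Sum>k\<in>UNIV. \<Sum>j\<in>UNIV. A $ i $ k * B $ k $ j * C $ i $ j)"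
    by (intro sum.cong refl sum.swap)
  also have "\<dots> = (\<Sum>k\<in>UNIV. \<Sum>i\<in>UNIV. \<Sum>j\<in>UNIV. A $ i $ k * B $ k $ j * C $ i $ j)"
    by (rule sum.swap)
  also have "\<dots> = (\<Sum>k\<in>UNIV. \<Sum>j\<in>UNIV. \<Sum>i\<in>UNIV. A $ i $ k * B $ k $ j * C $ i $ j)"
    by (intro sum.cong refl sum.swap)
  also have "\<dots> = inner B (transpose A ** C)"
    by (simp add: inner_vec_def matrix_matrix_mult_def transpose_def sum_distrib_left mult_ac)
  finally show ?thesis .
qed

lemma inner_matrix_mult_right:
  fixes A :: "real^'k^'m" and B :: "real^'n^'k" and C :: "real^'n^'m"
  shows "inner (A ** B) C = inner A (C ** transpose B)"
proof -
  have "inner (A ** B) C = (\<Sum>i\<in>UNIV. \<Sum>j\<in>UNIV. \<Sum>k\<in>UNIV. A $ i $ k * B $ k $ j * C $ i $ j)"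
    by (simp add: inner_vec_def matrix_matrix_mult_def sum_distrib_right)
  also have "\<dots> = (\<Sum>i\<in>UNIV. \<Sum>k\<in>UNIV. \<Sum>j\<in>UNIV. A $ i $ k * B $ k $ j * C $ i $ j)"
    by (intro sum.cong refl sum.swap)
  also have "\<dots> = inner A (C ** transpose B)"
    by (simp add: inner_vec_def matrix_matrix_mult_def transpose_def sum_distrib_left mult_ac)
  finally show ?thesis .
qed

lemma inner_thin_svd_factors:
  fixes U :: "real^'n^'m" and W A B :: "real^'n^'n"
  assumes "transpose U ** U = mat 1" "transpose W ** W = mat 1"
  shows "inner (U ** A ** transpose W) (U ** B ** transpose W) = inner A B"
proof -
  have "inner (U ** A ** transpose W) (U ** B ** transpose W) =
      inner (U ** A) (U ** B ** (transpose W ** W))"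
    by (subst inner_matrix_mult_right) (simp add: matrix_mul_assoc)
  also have "\<dots> = inner A (transpose U ** U ** B)"
    by (simp add: assms inner_matrix_mult_left matrix_mul_assoc)
  finally show ?thesis
    by (simp add: assms)
qed

lemma inner_mat_1: "inner (mat 1) (A :: real^'n^'n) = (\<Sum>i\<in>UNIV. A $ i $ i)"
  by (simp add: inner_vec_def mat_def if_distrib[of "\<lambda>x. x * _"] cong: if_cong)

text \<open>After cancelling the isometries, the inner product is the sum of the singular values and
  the squared Frobenius norm is the sum of their squares, so the first claim compares an l1 norm
  with an l2 norm.\<close>

lemma orthogonalization_inner_norm:
  fixes Orth :: "real^'n^'m \<Rightarrow> real^'n^'m"
  assumes "orthogonalization Orth"
  shows "norm M \<le> inner (Orth M) M" and "norm (Orth M) = sqrt (real CARD('n))"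
proof -
  obtain U S W where svd: "thin_svd M U S W" and O: "Orth M = U ** transpose W"
    using assms unfolding orthogonalization_def by blast
  have U: "transpose U ** U = mat 1" and W: "transpose W ** W = mat 1"
    and diag: "\<And>i j. i \<noteq> j \<Longrightarrow> S $ i $ j = 0" and nonneg: "\<And>i. S $ i $ i \<ge> 0"
    and M: "M = U ** S ** transpose W"
    using svd by (auto simp: thin_svd_def)
  have O': "Orth M = U ** mat 1 ** transpose W"
    by (simp add: O)
  have "inner (Orth M) M = inner (mat 1) S"
    using inner_thin_svd_factors[OF U W, of "mat 1" S] O' M by metis
  then have 1: "inner (Orth M) M = (\<Sum>i\<in>UNIV. S $ i $ i)"
    by (simp add: inner_mat_1)
  have "(norm M)\<^sup>2 = inner S S"
    using inner_thin_svd_factors[OF U W, of S S] M by (metis power2_norm_eq_inner)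
  also have "\<dots> = (\<Sum>i\<in>UNIV. (S $ i $ i)\<^sup>2)"
  proof -
    have "(\<Sum>j\<in>UNIV. (S $ i $ j)\<^sup>2) = (\<Sum>j\<in>UNIV. if j = i then (S $ i $ i)\<^sup>2 else 0)" for i
      by (intro sum.cong) (auto simp: diag)
    then show ?thesis
      by (simp add: inner_vec_def power2_eq_square)
  qed
  also have "\<dots> \<le> (\<Sum>i\<in>UNIV. S $ i $ i)\<^sup>2"
    using L2_set_le_sum[of UNIV "\<lambda>i. S $ i $ i"] nonneg
    by (simp add: L2_set_def sqrt_le_D)
  finally show "norm M \<le> inner (Orth M) M"
    unfolding 1 by (rule power2_le_imp_le) (simp add: sum_nonneg nonneg)
  have "(norm (Orth M))\<^sup>2 = inner (mat 1) (mat 1 :: real^'n^'n)"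
    unfolding power2_norm_eq_inner O' by (rule inner_thin_svd_factors[OF U W])
  also have "\<dots> = real CARD('n)"
    by (subst inner_mat_1) (simp add: mat_def)
  finally show "norm (Orth M) = sqrt (real CARD('n))"
    by (metis norm_ge_zero real_sqrt_abs abs_of_nonneg)
qed

text \<open>A Caratheodory function is a pointwise limit of functions that depend on
  \<open>Y\<close> only through a point of a countable dense set.\<close>

lemma borel_measurable_continuous_param:
  fixes F :: "'a::euclidean_space \<Rightarrow> 'x \<Rightarrow> real"
  assumes meas: "\<And>Y. F Y \<in> borel_measurable D"
    and cont: "\<And>x. x \<in> space D \<Longrightarrow> continuous_on UNIV (\<lambda>Y. F Y x)"
  shows "(\<lambda>p. F (fst p) (snd p)) \<in> borel_measurable (borel \<Otimes>\<^sub>M D)"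
proof -
  obtain Q :: "'a set" where Q: "countable Q" "\<And>X. open X \<Longrightarrow> X \<noteq> {} \<Longrightarrow> \<exists>d\<in>Q. d \<in> X"
    using countable_dense_exists by blast
  have "Q \<noteq> {}" using Q(2)[of UNIV] by auto
  define d where "d = from_nat_into Q"
  \<comment> \<open>Taking the least admissible index makes the choice of the nearby point a
    measurable function of \<open>Y\<close> with countably many values.\<close>
  define k where "k n Y = (LEAST k. dist (d k) Y < 1 / real (Suc n))" for n Y
  have k: "dist (d (k n Y)) Y < 1 / real (Suc n)" for n Y
  proof -
    have "\<exists>q\<in>Q. q \<in> ball Y (1 / real (Suc n))"
      by (rule Q(2)) auto
    then have "\<exists>k. dist (d k) Y < 1 / real (Suc n)"
      using from_nat_into_surj[OF Q(1)] unfolding d_def by (metis dist_commute mem_ball)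
    then show ?thesis
      unfolding k_def by (rule LeastI_ex)
  qed
  have lim: "(\<lambda>n. d (k n Y)) \<longlonglongrightarrow> Y" for Y
  proof (rule metric_tendsto_imp_tendsto)
    show "(\<lambda>n. inverse (real (Suc n))) \<longlonglongrightarrow> 0"
      by (rule LIMSEQ_inverse_real_of_nat)
    show "\<forall>\<^sub>F n in sequentially. dist (d (k n Y)) Y \<le> dist (inverse (real (Suc n))) 0"
      using k[of _ Y] by (intro always_eventually allI) (simp add: inverse_eq_divide less_imp_le)
  qed
  show ?thesis
  proof (rule borel_measurable_LIMSEQ_metric)
    fix n
    have "k n \<in> measurable borel (count_space UNIV)"
      unfolding k_def by measurable
    then have "(\<lambda>p. k n (fst p)) \<in> measurable (borel \<Otimes>\<^sub>M D) (count_space UNIV)"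
      by (rule measurable_compose[OF measurable_fst])
    moreover have "(\<lambda>p. F (d i) (snd p)) \<in> borel_measurable (borel \<Otimes>\<^sub>M D)" for i
      by (rule measurable_compose[OF measurable_snd meas])
    ultimately show "(\<lambda>p. F (d (k n (fst p))) (snd p)) \<in> borel_measurable (borel \<Otimes>\<^sub>M D)"
      by (rule measurable_compose_countable[rotated])
  next
    fix p :: "'a \<times> 'x" assume "p \<in> space (borel \<Otimes>\<^sub>M D)"
    then have "snd p \<in> space D"
      by (auto simp: space_pair_measure)
    then have "isCont (\<lambda>Y. F Y (snd p)) (fst p)"
      using cont by (simp add: continuous_on_eq_continuous_at)
    then show "(\<lambda>n. F (d (k n (fst p))) (snd p)) \<longlonglongrightarrow> F (fst p) (snd p)"
      using lim by (rule isCont_tendsto_compose)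
  qed
qed

text \<open>\<open>grad\<close> is a definite description, so its measurability has to come from
  outside: its coordinates are limits of difference quotients along a fixed sequence of
  steps.\<close>

lemma inner_grad_LIMSEQ:
  fixes f :: "'a::euclidean_space \<Rightarrow> real"
  assumes "f differentiable (at Y)"
  shows "(\<lambda>n. real (Suc n) * (f (Y + inverse (real (Suc n)) *\<^sub>R b) - f Y)) \<longlonglongrightarrow> inner (grad f Y) b"
proof -
  have "(f has_derivative (\<lambda>h. inner h (grad f Y))) (at (Y + 0 *\<^sub>R b))"
    using GDERIV_grad[OF assms] by (simp add: gderiv_def)
  moreover have "((\<lambda>t. Y + t *\<^sub>R b) has_derivative (\<lambda>h. h *\<^sub>R b)) (at (0::real))"
    by (auto intro!: derivative_eq_intros)
  ultimately have "((\<lambda>t. f (Y + t *\<^sub>R b)) has_derivative (\<lambda>h. inner (h *\<^sub>R b) (grad f Y))) (at (0::real))"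
    using has_derivative_compose by fastforce
  then have "DERIV (\<lambda>t. f (Y + t *\<^sub>R b)) 0 :> inner b (grad f Y)"
    by (simp add: has_field_derivative_def mult.commute[of _ "inner b _"] fun_eq_iff)
  then have "((\<lambda>h. (f (Y + h *\<^sub>R b) - f Y) / h) \<longlongrightarrow> inner b (grad f Y)) (at 0)"
    by (simp add: DERIV_def)
  moreover have "filterlim (\<lambda>n. inverse (real (Suc n))) (at 0) sequentially"
    by (rule filterlim_atI[OF LIMSEQ_inverse_real_of_nat]) auto
  ultimately have "(\<lambda>n. (f (Y + inverse (real (Suc n)) *\<^sub>R b) - f Y) / inverse (real (Suc n)))
      \<longlonglongrightarrow> inner b (grad f Y)"
    by (rule filterlim_compose)
  then show ?thesis
    by (simp add: inner_commute field_simps)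
qed

lemma borel_measurable_grad_param:
  fixes F :: "'a::euclidean_space \<Rightarrow> 'x \<Rightarrow> real"
  assumes meas: "\<And>Y. F Y \<in> borel_measurable D"
    and diff: "\<And>x Y. x \<in> space D \<Longrightarrow> (\<lambda>Z. F Z x) differentiable (at Y)"
  shows "(\<lambda>p. grad (\<lambda>Z. F Z (snd p)) (fst p)) \<in> borel_measurable (borel \<Otimes>\<^sub>M D)"
proof (rule iffD2[OF borel_measurable_euclidean_space], rule ballI)
  fix b :: 'a assume "b \<in> Basis"
  have [measurable]: "(\<lambda>p. F (fst p) (snd p)) \<in> borel_measurable (borel \<Otimes>\<^sub>M D)"
    using meas diff
    by (intro borel_measurable_continuous_param)
      (auto intro!: continuous_at_imp_continuous_on differentiable_imp_continuous_within)
  have shift: "(\<lambda>p. F (fst p + c) (snd p)) \<in> borel_measurable (borel \<Otimes>\<^sub>M D)" for c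
  proof -
    have "(\<lambda>p. (fst p + c, snd p)) \<in> measurable (borel \<Otimes>\<^sub>M D) (borel \<Otimes>\<^sub>M D)"
      by measurable
    from measurable_compose[OF this, of "\<lambda>p. F (fst p) (snd p)" borel] show ?thesis
      by simp
  qed
  show "(\<lambda>p. inner (grad (\<lambda>Z. F Z (snd p)) (fst p)) b) \<in> borel_measurable (borel \<Otimes>\<^sub>M D)"
  proof (rule borel_measurable_LIMSEQ_metric)
    fix n
    show "(\<lambda>p. real (Suc n) * (F (fst p + inverse (real (Suc n)) *\<^sub>R b) (snd p) - F (fst p) (snd p)))
        \<in> borel_measurable (borel \<Otimes>\<^sub>M D)"
      using shift by measurable
  next
    fix p :: "'a \<times> 'x" assume "p \<in> space (borel \<Otimes>\<^sub>M D)"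
    then show "(\<lambda>n. real (Suc n) * (F (fst p + inverse (real (Suc n)) *\<^sub>R b) (snd p) - F (fst p) (snd p)))
        \<longlonglongrightarrow> inner (grad (\<lambda>Z. F Z (snd p)) (fst p)) b"
      by (intro inner_grad_LIMSEQ diff) (auto simp: space_pair_measure)
  qed
qed

section \<open>Dependence on the past and measurability of the iterates\<close>

lemma muon_rho_cong: "(\<And>i. 1 \<le> i \<Longrightarrow> i \<le> t \<Longrightarrow> G i = G' i) \<Longrightarrow> muon_rho G t = muon_rho G' t"
  unfolding muon_rho_def by (auto intro!: arg_cong[where f = Max] image_cong sum.cong arg_cong2[where f = "(/)"])

text \<open>The strict \<open>i < t\<close> expresses that the weights are predictable, unlike
  \<open>muon_M\<close> and \<open>muon_gamma\<close>.\<close>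

lemma muon_alpha_cong: "(\<And>i. 1 \<le> i \<Longrightarrow> i < t \<Longrightarrow> G i = G' i) \<Longrightarrow> muon_alpha G t = muon_alpha G' t"
  unfolding muon_alpha_def by (auto intro!: muon_rho_cong)

lemma muon_M_cong: "(\<And>i. 1 \<le> i \<Longrightarrow> i \<le> t \<Longrightarrow> G i = G' i) \<Longrightarrow> muon_M G t = muon_M G' t"
proof (induction t)
  case (Suc t)
  have "muon_M G t = muon_M G' t"
    using Suc.prems by (intro Suc.IH) auto
  moreover have "muon_alpha G (Suc t) = muon_alpha G' (Suc t)"
    using Suc.prems by (intro muon_alpha_cong) auto
  ultimately show ?case
    using Suc.prems[of "Suc t"] by simp
qed simp

lemma muon_gamma_cong:
  assumes "\<And>i. 1 \<le> i \<Longrightarrow> i \<le> t \<Longrightarrow> G i = G' i"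
  shows "muon_gamma G t = muon_gamma G' t"
proof -
  have a: "muon_alpha G j = muon_alpha G' j" "muon_M G j = muon_M G' j" if "j \<le> t" for j
    using that assms by (auto intro!: muon_alpha_cong muon_M_cong)
  then have "(\<Sum>j=1..t. muon_alpha G j * (norm (muon_M G j))\<^sup>2)
      = (\<Sum>j=1..t. muon_alpha G' j * (norm (muon_M G' j))\<^sup>2)"
    by (intro sum.cong) auto
  then show ?thesis
    by (simp add: muon_gamma_def a)
qed

definition optmuon_grad ::
  "(real^'n^'m \<Rightarrow> 'x \<Rightarrow> real) \<Rightarrow> (real^'n^'m \<Rightarrow> real^'n^'m) \<Rightarrow> real \<Rightarrow> real^'n^'m \<Rightarrow>
     (nat \<Rightarrow> 'x) \<Rightarrow> nat \<Rightarrow> real^'n^'m" where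
  "optmuon_grad F Orth \<theta> X1 \<xi> t = grad (\<lambda>Y. F Y (\<xi> t)) (optmuon_A F Orth \<theta> X1 \<xi> t)"

lemma optmuon_A_Suc:
  fixes F Orth \<theta> X1 \<xi> t
  defines "G \<equiv> optmuon_grad F Orth \<theta> X1 \<xi>"
  assumes "t \<ge> 1"
  shows "optmuon_A F Orth \<theta> X1 \<xi> (Suc t) = optmuon_A F Orth \<theta> X1 \<xi> t
    - (\<theta> * muon_gamma G t * norm (muon_M G t)) *\<^sub>R Orth (muon_M G t)"
proof -
  let ?G = "\<lambda>s. if s \<le> t then grad (\<lambda>Y. F Y (\<xi> s)) (optmuon_A F Orth \<theta> X1 \<xi> s) else 0"
  have "muon_gamma ?G t = muon_gamma G t" "muon_M ?G t = muon_M G t"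
    by (auto simp: G_def optmuon_grad_def intro!: muon_gamma_cong muon_M_cong)
  then show ?thesis
    using assms by (simp add: Let_def del: muon_M.simps)
qed

lemma borel_measurable_muon_rho:
  fixes G :: "'w \<Rightarrow> nat \<Rightarrow> 'a::euclidean_space"
  assumes "\<And>i. 1 \<le> i \<Longrightarrow> i \<le> t \<Longrightarrow> (\<lambda>\<omega>. G \<omega> i) \<in> borel_measurable K"
  shows "(\<lambda>\<omega>. muon_rho (G \<omega>) t) \<in> borel_measurable K"
proof -
  have "(\<lambda>\<omega>. (norm (G \<omega> i))\<^sup>2) \<in> borel_measurable K" if "i \<in> {1..t}" for i
    using assms that by auto
  then have [measurable]: "(\<lambda>\<omega>. MAX i\<in>{1..t}. (norm (G \<omega> i))\<^sup>2) \<in> borel_measurable K"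
    and [measurable]: "(\<lambda>\<omega>. \<Sum>i=1..t. (norm (G \<omega> i))\<^sup>2) \<in> borel_measurable K"
    by (auto intro!: borel_measurable_Max borel_measurable_sum)
  show ?thesis
    unfolding muon_rho_def by measurable
qed

lemma borel_measurable_muon_alpha:
  fixes G :: "'w \<Rightarrow> nat \<Rightarrow> 'a::euclidean_space"
  assumes "\<And>i. 1 \<le> i \<Longrightarrow> i < t \<Longrightarrow> (\<lambda>\<omega>. G \<omega> i) \<in> borel_measurable K"
  shows "(\<lambda>\<omega>. muon_alpha (G \<omega>) t) \<in> borel_measurable K"
  unfolding muon_alpha_def using assms by (cases t) (auto intro!: borel_measurable_muon_rho)

lemma borel_measurable_muon_M:
  fixes G :: "'w \<Rightarrow> nat \<Rightarrow> 'a::euclidean_space"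
  assumes "\<And>i. 1 \<le> i \<Longrightarrow> i \<le> t \<Longrightarrow> (\<lambda>\<omega>. G \<omega> i) \<in> borel_measurable K"
  shows "(\<lambda>\<omega>. muon_M (G \<omega>) t) \<in> borel_measurable K"
  using assms
proof (induction t)
  case (Suc t)
  have [measurable]: "(\<lambda>\<omega>. muon_M (G \<omega>) t) \<in> borel_measurable K"
    using Suc.prems by (intro Suc.IH) auto
  have [measurable]: "(\<lambda>\<omega>. muon_alpha (G \<omega>) (Suc t)) \<in> borel_measurable K"
    using Suc.prems by (intro borel_measurable_muon_alpha) auto
  have [measurable]: "(\<lambda>\<omega>. G \<omega> (Suc t)) \<in> borel_measurable K"
    using Suc.prems by auto
  show ?case
    by simp
qed simp

lemma borel_measurable_muon_gamma:
  fixes G :: "'w \<Rightarrow> nat \<Rightarrow> 'a::euclidean_space"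
  assumes "\<And>i. 1 \<le> i \<Longrightarrow> i \<le> t \<Longrightarrow> (\<lambda>\<omega>. G \<omega> i) \<in> borel_measurable K"
  shows "(\<lambda>\<omega>. muon_gamma (G \<omega>) t) \<in> borel_measurable K"
proof -
  have m: "(\<lambda>\<omega>. muon_alpha (G \<omega>) j) \<in> borel_measurable K" "(\<lambda>\<omega>. muon_M (G \<omega>) j) \<in> borel_measurable K"
    if "j \<le> t" for j
    using that assms by (auto intro!: borel_measurable_muon_alpha borel_measurable_muon_M)
  then have [measurable]: "(\<lambda>\<omega>. \<Sum>j=1..t. muon_alpha (G \<omega>) j * (norm (muon_M (G \<omega>) j))\<^sup>2) \<in> borel_measurable K"
    by (intro borel_measurable_sum borel_measurable_times borel_measurable_power borel_measurable_norm) auto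
  note [measurable] = m[of t]
  show ?thesis
    unfolding muon_gamma_def by measurable
qed

text \<open>\<open>K\<close> is left open because three sigma-algebras are needed: that of
  \<open>P\<close>, that of the samples before \<open>t\<close>, and that of all samples when the
  output index is drawn.\<close>

lemma borel_measurable_optmuon_A:
  fixes F :: "real^'n^'m \<Rightarrow> 'x \<Rightarrow> real"
  assumes grad: "(\<lambda>p. grad (\<lambda>Z. F Z (snd p)) (fst p)) \<in> borel_measurable (borel \<Otimes>\<^sub>M D)"
    and Orth [measurable]: "Orth \<in> borel_measurable borel"
    and \<xi>: "\<And>s. 1 \<le> s \<Longrightarrow> s < t \<Longrightarrow> (\<lambda>\<omega>. \<xi> \<omega> s) \<in> measurable K D"
  shows "(\<lambda>\<omega>. optmuon_A F Orth \<theta> X1 (\<xi> \<omega>) t) \<in> borel_measurable K"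
  using \<xi>
proof (induction t rule: less_induct)
  case (less t)
  show ?case
  proof (cases "t \<le> 1")
    case True
    then have "t = 0 \<or> t = Suc 0" by auto
    then show ?thesis by auto
  next
    case False
    then obtain k where t: "t = Suc k" and k: "k \<ge> 1"
      by (cases t) auto
    have G: "(\<lambda>\<omega>. optmuon_grad F Orth \<theta> X1 (\<xi> \<omega>) i) \<in> borel_measurable K" if "1 \<le> i" "i \<le> k" for i
    proof -
      have [measurable]: "(\<lambda>\<omega>. optmuon_A F Orth \<theta> X1 (\<xi> \<omega>) i) \<in> borel_measurable K"
        using that t less.prems by (intro less.IH) auto
      have [measurable]: "(\<lambda>\<omega>. \<xi> \<omega> i) \<in> measurable K D"
        using that t less.prems by auto
      have "(\<lambda>\<omega>. (optmuon_A F Orth \<theta> X1 (\<xi> \<omega>) i, \<xi> \<omega> i)) \<in> measurable K (borel \<Otimes>\<^sub>M D)"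
        by measurable
      from measurable_compose[OF this grad] show ?thesis
        by (simp add: optmuon_grad_def)
    qed
    have [measurable]: "(\<lambda>\<omega>. optmuon_A F Orth \<theta> X1 (\<xi> \<omega>) k) \<in> borel_measurable K"
      using t less.prems by (intro less.IH) auto
    have [measurable]: "(\<lambda>\<omega>. muon_gamma (optmuon_grad F Orth \<theta> X1 (\<xi> \<omega>)) k) \<in> borel_measurable K"
      "(\<lambda>\<omega>. muon_M (optmuon_grad F Orth \<theta> X1 (\<xi> \<omega>)) k) \<in> borel_measurable K"
      using G by (auto intro!: borel_measurable_muon_gamma borel_measurable_muon_M)
    show ?thesis
      unfolding t optmuon_A_Suc[OF k] by measurable
  qed
qed

lemma borel_measurable_optmuon_grad:
  fixes F :: "real^'n^'m \<Rightarrow> 'x \<Rightarrow> real"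
  assumes grad: "(\<lambda>p. grad (\<lambda>Z. F Z (snd p)) (fst p)) \<in> borel_measurable (borel \<Otimes>\<^sub>M D)"
    and Orth: "Orth \<in> borel_measurable borel"
    and \<xi>: "\<And>s. 1 \<le> s \<Longrightarrow> s \<le> t \<Longrightarrow> (\<lambda>\<omega>. \<xi> \<omega> s) \<in> measurable K D" and t: "t \<ge> 1"
  shows "(\<lambda>\<omega>. optmuon_grad F Orth \<theta> X1 (\<xi> \<omega>) t) \<in> borel_measurable K"
proof -
  have [measurable]: "(\<lambda>\<omega>. optmuon_A F Orth \<theta> X1 (\<xi> \<omega>) t) \<in> borel_measurable K"
    using \<xi> by (intro borel_measurable_optmuon_A[OF grad Orth]) auto
  have [measurable]: "(\<lambda>\<omega>. \<xi> \<omega> t) \<in> measurable K D"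
    using \<xi> t by auto
  have "(\<lambda>\<omega>. (optmuon_A F Orth \<theta> X1 (\<xi> \<omega>) t, \<xi> \<omega> t)) \<in> measurable K (borel \<Otimes>\<^sub>M D)"
    by measurable
  from measurable_compose[OF this grad] show ?thesis
    by (simp add: optmuon_grad_def)
qed

subsection \<open>Expectations\<close>

context prob_space
begin

text \<open>The freezing principle: a variable independent of \<open>K\<close> is integrated out
  while the rest of the path is held fixed. It holds because the law of the pair on
  \<open>K \<Otimes>\<^sub>M D\<close> is a product measure, and it takes the place of conditional
  expectations.\<close>

lemma expectation_indep_pair:
  fixes \<phi> :: "'a \<times> 'c \<Rightarrow> real"
  assumes sub: "subalgebra M K" and Y: "Y \<in> measurable M D"
    and indep: "indep_set (sets K) {Y -` B \<inter> space M |B. B \<in> sets D}"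
    and meas: "\<phi> \<in> borel_measurable (K \<Otimes>\<^sub>M D)"
    and int: "integrable M (\<lambda>\<omega>. \<phi> (\<omega>, Y \<omega>))"
  shows "integrable M (\<lambda>\<omega>. \<integral>y. \<phi> (\<omega>, y) \<partial>distr M D Y)"
    and "expectation (\<lambda>\<omega>. \<phi> (\<omega>, Y \<omega>)) = expectation (\<lambda>\<omega>. \<integral>y. \<phi> (\<omega>, y) \<partial>distr M D Y)"
proof -
  have X: "(\<lambda>\<omega>. \<omega>) \<in> measurable M K" and sp: "space K = space M"
    and sets_K: "\<And>A. A \<in> sets K \<Longrightarrow> A \<in> events"
    using sub by (auto simp: subalgebra_def intro!: measurableI)
  interpret X: prob_space "distr M K (\<lambda>\<omega>. \<omega>)" by (rule prob_space_distr[OF X])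
  interpret Y: prob_space "distr M D Y" by (rule prob_space_distr[OF Y])
  interpret pair_sigma_finite "distr M K (\<lambda>\<omega>. \<omega>)" "distr M D Y" ..
  have XY: "(\<lambda>\<omega>. (\<omega>, Y \<omega>)) \<in> measurable M (K \<Otimes>\<^sub>M D)"
    using X Y by measurable
  have eq: "distr M K (\<lambda>\<omega>. \<omega>) \<Otimes>\<^sub>M distr M D Y = distr M (K \<Otimes>\<^sub>M D) (\<lambda>\<omega>. (\<omega>, Y \<omega>))"
  proof (rule pair_measure_eqI)
    fix A B assume "A \<in> sets (distr M K (\<lambda>\<omega>. \<omega>))" "B \<in> sets (distr M D Y)"
    then have A: "A \<in> sets K" and B: "B \<in> sets D" by auto
    have "A \<inter> space M = A"
      using A sets.sets_into_space[OF A] sp by auto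
    moreover have "prob (A \<inter> (Y -` B \<inter> space M)) = prob A * prob (Y -` B \<inter> space M)"
      using A B by (intro indep_setD[OF indep]) auto
    moreover have "(\<lambda>\<omega>. (\<omega>, Y \<omega>)) -` (A \<times> B) \<inter> space M = A \<inter> (Y -` B \<inter> space M)"
      by auto
    ultimately show "emeasure (distr M K (\<lambda>\<omega>. \<omega>)) A * emeasure (distr M D Y) B =
        emeasure (distr M (K \<Otimes>\<^sub>M D) (\<lambda>\<omega>. (\<omega>, Y \<omega>))) (A \<times> B)"
      using A B X Y XY by (simp add: emeasure_distr emeasure_eq_measure ennreal_mult)
  qed (auto intro!: X.sigma_finite_measure_axioms Y.sigma_finite_measure_axioms cong: sets_pair_measure_cong)
  have int': "integrable (distr M K (\<lambda>\<omega>. \<omega>) \<Otimes>\<^sub>M distr M D Y) \<phi>"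
    unfolding eq using int meas XY by (simp add: integrable_distr_eq)
  have m: "(\<lambda>x. \<integral>y. \<phi> (x, y) \<partial>distr M D Y) \<in> borel_measurable K"
  proof -
    have "(\<lambda>x. \<integral>y. \<phi> (x, y) \<partial>distr M D Y) \<in> borel_measurable (distr M K (\<lambda>\<omega>. \<omega>))"
      using borel_measurable_integrable[OF integrable_fst'[OF int']] by simp
    then show ?thesis by simp
  qed
  show "integrable M (\<lambda>\<omega>. \<integral>y. \<phi> (\<omega>, y) \<partial>distr M D Y)"
    using integrable_fst'[OF int'] m X by (simp add: integrable_distr_eq)
  have "expectation (\<lambda>\<omega>. \<phi> (\<omega>, Y \<omega>)) = integral\<^sup>L (distr M K (\<lambda>\<omega>. \<omega>) \<Otimes>\<^sub>M distr M D Y) \<phi>"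
    unfolding eq by (rule integral_distr[OF XY meas, symmetric])
  also have "\<dots> = (\<integral>x. (\<integral>y. \<phi> (x, y) \<partial>distr M D Y) \<partial>distr M K (\<lambda>\<omega>. \<omega>))"
    by (rule integral_fst'[OF int', symmetric])
  also have "\<dots> = expectation (\<lambda>\<omega>. \<integral>y. \<phi> (\<omega>, y) \<partial>distr M D Y)"
    by (rule integral_distr[OF X m])
  finally show "expectation (\<lambda>\<omega>. \<phi> (\<omega>, Y \<omega>)) = expectation (\<lambda>\<omega>. \<integral>y. \<phi> (\<omega>, y) \<partial>distr M D Y)" .
qed

text \<open>The arithmetic-geometric mean with deterministic weights taken from the bounds
  \<open>A\<close> and \<open>B\<close> yields integrability and the estimate at once. The weights
  are quotients, hence the strict positivity of the bounds.\<close>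

lemma expectation_sqrt_mult_le:
  fixes a b :: "'a \<Rightarrow> real"
  assumes a: "integrable M a" "AE \<omega> in M. 0 \<le> a \<omega>" "expectation a \<le> A" "0 < A"
    and b: "integrable M b" "AE \<omega> in M. 0 \<le> b \<omega>" "expectation b \<le> B" "0 < B"
  shows "integrable M (\<lambda>\<omega>. sqrt (a \<omega> * b \<omega>))"
    and "expectation (\<lambda>\<omega>. sqrt (a \<omega> * b \<omega>)) \<le> sqrt (A * B)"
proof -
  define u where "u = sqrt A"
  define v where "v = sqrt B"
  have uv: "u > 0" "v > 0" "A = u\<^sup>2" "B = v\<^sup>2"
    using a b by (simp_all add: u_def v_def)
  define m where "m \<omega> = (v / u * a \<omega> + u / v * b \<omega>) / 2" for \<omega>
  have m: "integrable M m"
    unfolding m_def using a b by auto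
  have le: "AE \<omega> in M. 0 \<le> sqrt (a \<omega> * b \<omega>) \<and> sqrt (a \<omega> * b \<omega>) \<le> m \<omega>"
    using a(2) b(2)
  proof eventually_elim
    case (elim \<omega>)
    have "sqrt (a \<omega> * b \<omega>) = sqrt ((v / u * a \<omega>) * (u / v * b \<omega>))"
      using uv by simp
    also have "\<dots> \<le> m \<omega>"
      unfolding m_def using elim uv by (intro arith_geo_mean_sqrt) auto
    finally show ?case using elim by simp
  qed
  show i: "integrable M (\<lambda>\<omega>. sqrt (a \<omega> * b \<omega>))"
  proof (rule Bochner_Integration.integrable_bound[OF m])
    show "(\<lambda>\<omega>. sqrt (a \<omega> * b \<omega>)) \<in> borel_measurable M"
      using a(1) b(1) by measurable
    show "AE \<omega> in M. norm (sqrt (a \<omega> * b \<omega>)) \<le> norm (m \<omega>)"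
      using le by eventually_elim auto
  qed
  have "expectation (\<lambda>\<omega>. sqrt (a \<omega> * b \<omega>)) \<le> expectation m"
    using i m le by (intro integral_mono_AE) auto
  also have "\<dots> = (v / u * expectation a + u / v * expectation b) / 2"
    unfolding m_def using a b by simp
  also have "\<dots> \<le> (v / u * A + u / v * B) / 2"
    using a b uv by (intro divide_right_mono add_mono mult_left_mono) auto
  also have "\<dots> = sqrt (A * B)"
    using uv by (simp add: power2_eq_square real_sqrt_mult)
  finally show "expectation (\<lambda>\<omega>. sqrt (a \<omega> * b \<omega>)) \<le> sqrt (A * B)" .
qed

text \<open>Jensen's inequality for the root, read off from the nonnegative variance of the
  root.\<close>

lemma expectation_sqrt_le:
  fixes a :: "'a \<Rightarrow> real"
  assumes a: "integrable M a" "\<And>\<omega>. 0 \<le> a \<omega>" "integrable M (\<lambda>\<omega>. sqrt (a \<omega>))"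
  shows "expectation (\<lambda>\<omega>. sqrt (a \<omega>)) \<le> sqrt (expectation a)"
proof -
  have "0 \<le> variance (\<lambda>\<omega>. sqrt (a \<omega>))"
    by (rule variance_positive)
  also have "\<dots> = expectation a - (expectation (\<lambda>\<omega>. sqrt (a \<omega>)))\<^sup>2"
    using a by (subst variance_eq) auto
  finally show ?thesis
    by (intro real_le_rsqrt) simp
qed

text \<open>Families over disjoint index sets are independent; the remaining work identifies
  \<open>\<xi> t\<close> with the family over the singleton.\<close>

lemma indep_set_past:
  fixes \<xi> :: "nat \<Rightarrow> 'a \<Rightarrow> 'b"
  assumes indep: "indep_vars (\<lambda>_. D) \<xi> {1..}" and t: "t \<ge> 1"
  shows "indep_set (sets (vimage_algebra (space M) (\<lambda>\<omega>. \<lambda>s\<in>{1..<t}. \<xi> s \<omega>) (\<Pi>\<^sub>M s\<in>{1..<t}. D)))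
    {\<xi> t -` B \<inter> space M |B. B \<in> sets D}"
proof -
  let ?X = "\<lambda>\<omega>. \<lambda>s\<in>{1..<t}. \<xi> s \<omega>" and ?Y = "\<lambda>\<omega>. \<lambda>s\<in>{t}. \<xi> s \<omega>"
  let ?N = "\<Pi>\<^sub>M s\<in>{1..<t}. D"
  have "indep_var ?N ?X (\<Pi>\<^sub>M s\<in>{t}. D) ?Y"
    using t by (intro indep_var_restrict[OF indep]) auto
  then have X: "?X \<in> measurable M ?N" and Y: "?Y \<in> measurable M (\<Pi>\<^sub>M s\<in>{t}. D)"
    and ind: "indep_set (sigma_sets (space M) {?X -` A \<inter> space M |A. A \<in> sets ?N})
      (sigma_sets (space M) {?Y -` A \<inter> space M |A. A \<in> sets (\<Pi>\<^sub>M s\<in>{t}. D)})"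
    unfolding indep_var_eq by auto
  have X': "?X \<in> space M \<rightarrow> space ?N"
    using measurable_space[OF X] by auto
  show ?thesis
    using ind unfolding indep_set_def
  proof (rule indep_sets_mono_sets)
    fix i :: bool
    have "\<xi> t -` B \<inter> space M \<in> {?Y -` A \<inter> space M |A. A \<in> sets (\<Pi>\<^sub>M s\<in>{t}. D)}" if "B \<in> sets D" for B
    proof -
      have "(\<lambda>x. x t) -` B \<inter> space (\<Pi>\<^sub>M s\<in>{t}. D) \<in> sets (\<Pi>\<^sub>M s\<in>{t}. D)"
        using that by (intro measurable_sets[OF measurable_component_singleton]) auto
      moreover have "\<xi> t -` B \<inter> space M = ?Y -` ((\<lambda>x. x t) -` B \<inter> space (\<Pi>\<^sub>M s\<in>{t}. D)) \<inter> space M"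
        using measurable_space[OF Y] by auto
      ultimately show ?thesis by blast
    qed
    then show "(case i of True \<Rightarrow> sets (vimage_algebra (space M) ?X ?N)
          | False \<Rightarrow> {\<xi> t -` B \<inter> space M |B. B \<in> sets D})
        \<subseteq> (case i of True \<Rightarrow> sigma_sets (space M) {?X -` A \<inter> space M |A. A \<in> sets ?N}
          | False \<Rightarrow> sigma_sets (space M) {?Y -` A \<inter> space M |A. A \<in> sets (\<Pi>\<^sub>M s\<in>{t}. D)})"
      unfolding sets_vimage_algebra2[OF X'] by (auto split: bool.split intro!: sigma_sets.Basic)
  qed
qed

lemma subalgebra_vimage_algebra:
  assumes X: "X \<in> measurable M N"
  shows "subalgebra M (vimage_algebra (space M) X N)"
proof -
  have X': "X \<in> space M \<rightarrow> space N"
    using measurable_space[OF X] by auto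
  show ?thesis
    using X by (auto simp: subalgebra_def sets_vimage_algebra2[OF X'])
qed

end

section \<open>Noise, martingale and its second moment\<close>

locale optmuon_setup =
  fixes D :: "'x measure" and P :: "'w measure"
    and F :: "real^'n^'m \<Rightarrow> 'x \<Rightarrow> real" and f :: "real^'n^'m \<Rightarrow> real"
    and Orth :: "real^'n^'m \<Rightarrow> real^'n^'m"
    and \<xi> :: "nat \<Rightarrow> 'w \<Rightarrow> 'x" and X :: "nat \<Rightarrow> 'w \<Rightarrow> real^'n^'m"
    and X1 :: "real^'n^'m"
    and \<theta> L \<sigma> H fstar :: real
  assumes params: "\<theta> > 0" "L > 0" "\<sigma> \<ge> 0" "H > 0"
    and D: "prob_space D"
    and F_meas: "\<And>Y. F Y \<in> borel_measurable D"
    and f_diff: "\<And>Y. f differentiable (at Y)"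
    and F_diff: "\<And>x Y. x \<in> space D \<Longrightarrow> (\<lambda>Z. F Z x) differentiable (at Y)"
    and lower: "\<And>Y. f Y \<ge> fstar"
    and unbiased: "\<And>Y. has_bochner_integral D (\<lambda>x. grad (\<lambda>Z. F Z x) Y) (grad f Y)"
    and variance_bound: "\<And>Y. (\<integral>x. (norm (grad (\<lambda>Z. F Z x) Y - grad f Y))\<^sup>2 \<partial>D) \<le> \<sigma>\<^sup>2"
    and smooth: "\<And>Y Z. norm (grad f Y - grad f Z) \<le> L * norm (Y - Z)"
    and bounded: "AE x in D. \<forall>Y. norm (grad (\<lambda>Z. F Z x) Y) \<le> H"
    and Orth: "orthogonalization Orth"
    and P: "prob_space P"
    and xi_indep: "prob_space.indep_vars P (\<lambda>_. D) \<xi> {1..}"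
    and xi_distr: "\<And>t. t \<ge> 1 \<Longrightarrow> distr P D (\<xi> t) = D"
    and X_def: "\<And>t \<omega>. X t \<omega> = optmuon_A F Orth \<theta> X1 (\<lambda>s. \<xi> s \<omega>) t"
begin

sublocale prob_space P by (rule P)

definition "G \<omega> = optmuon_grad F Orth \<theta> X1 (\<lambda>s. \<xi> s \<omega>)"

abbreviation "N \<omega> t \<equiv> grad f (X t \<omega>)"
abbreviation "noise t \<omega> \<equiv> G \<omega> t - N \<omega> t"
abbreviation "dir t \<omega> \<equiv> muon_mart_dir (G \<omega>) (N \<omega>) t"

text \<open>The information before the sample of step \<open>t\<close> is drawn: \<open>X t\<close>,
  the weight at \<open>t\<close> and \<open>dir t\<close> are measurable here.\<close>

definition "past t = vimage_algebra (space P) (\<lambda>\<omega>. \<lambda>s\<in>{1..<t}. \<xi> s \<omega>) (\<Pi>\<^sub>M s\<in>{1..<t}. D)"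

lemma norm_grad_le: "norm (grad f Y) \<le> H"
proof -
  interpret D: prob_space D by (rule D)
  have int: "integrable D (\<lambda>x. grad (\<lambda>Z. F Z x) Y)" and eq: "(\<integral>x. grad (\<lambda>Z. F Z x) Y \<partial>D) = grad f Y"
    using unbiased[of Y] by (auto simp: has_bochner_integral_iff)
  have "norm (grad f Y) \<le> (\<integral>x. norm (grad (\<lambda>Z. F Z x) Y) \<partial>D)"
    unfolding eq[symmetric] by (rule integral_norm_bound)
  also have "\<dots> \<le> H"
    using bounded int by (intro D.integral_le_const) (auto elim: eventually_mono)
  finally show ?thesis .
qed

lemma xi_measurable: "t \<ge> 1 \<Longrightarrow> \<xi> t \<in> measurable P D"
  using xi_indep unfolding indep_vars_def by auto

text \<open>The bound has to hold for all \<open>Y\<close> outside one null set, since it is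
  evaluated at a random iterate; the union over \<open>t\<close> is countable.\<close>

lemma norm_G_le: "AE \<omega> in P. \<forall>t\<ge>1. norm (G \<omega> t) \<le> H"
proof -
  have "AE \<omega> in P. \<forall>Y. norm (grad (\<lambda>Z. F Z (\<xi> t \<omega>)) Y) \<le> H" if "t \<ge> 1" for t
  proof (rule AE_distrD[OF xi_measurable[OF that]])
    show "AE x in distr P D (\<xi> t). \<forall>Y. norm (grad (\<lambda>Z. F Z x) Y) \<le> H"
      unfolding xi_distr[OF that] by (rule bounded)
  qed
  then have "AE \<omega> in P. \<forall>t. t \<ge> 1 \<longrightarrow> (\<forall>Y. norm (grad (\<lambda>Z. F Z (\<xi> t \<omega>)) Y) \<le> H)"
    by (subst AE_all_countable) auto
  then show ?thesis
    by eventually_elim (simp add: G_def optmuon_grad_def)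
qed

lemma muon_path_AE:
  "AE \<omega> in P. muon_path (G \<omega>) H (\<lambda>t. X t \<omega>) (N \<omega>) f Orth \<theta> L fstar CARD('n)"
  using norm_G_le
proof eventually_elim
  case (elim \<omega>)
  show ?case
  proof
    show "X (Suc t) \<omega> = X t \<omega> - (\<theta> * muon_gamma (G \<omega>) t * norm (muon_M (G \<omega>) t)) *\<^sub>R Orth (muon_M (G \<omega>) t)"
      if "1 \<le> t" for t
      unfolding X_def G_def by (rule optmuon_A_Suc[OF that])
  qed (use elim params orthogonalization_inner_norm[OF Orth] f_diff smooth lower norm_grad_le in
    \<open>auto simp: X_def\<close>)
qed

lemma grad_measurable: "(\<lambda>p. grad (\<lambda>Z. F Z (snd p)) (fst p)) \<in> borel_measurable (borel \<Otimes>\<^sub>M D)"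
  by (rule borel_measurable_grad_param[OF F_meas F_diff])

lemma grad_f_measurable [measurable]: "grad f \<in> borel_measurable borel"
proof (rule borel_measurable_continuous_onI)
  have "L-lipschitz_on UNIV (grad f)"
    using smooth params by (intro lipschitz_onI) (auto simp: dist_norm)
  then show "continuous_on UNIV (grad f)"
    by (rule lipschitz_on_continuous_on)
qed

lemma Orth_measurable: "Orth \<in> borel_measurable borel"
  using Orth by (simp add: orthogonalization_def)

lemma X_measurable:
  assumes "\<And>s. 1 \<le> s \<Longrightarrow> s < t \<Longrightarrow> \<xi> s \<in> measurable K D"
  shows "X t \<in> borel_measurable K"
  using borel_measurable_optmuon_A[OF grad_measurable Orth_measurable, of t "\<lambda>\<omega> s. \<xi> s \<omega>" K] assms
  by (simp add: X_def[abs_def])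

lemma N_measurable:
  assumes "\<And>s. 1 \<le> s \<Longrightarrow> s < t \<Longrightarrow> \<xi> s \<in> measurable K D"
  shows "(\<lambda>\<omega>. N \<omega> t) \<in> borel_measurable K"
  using measurable_compose[OF X_measurable grad_f_measurable] assms by blast

lemma G_measurable:
  assumes "\<And>s. 1 \<le> s \<Longrightarrow> s \<le> t \<Longrightarrow> \<xi> s \<in> measurable K D" "t \<ge> 1"
  shows "(\<lambda>\<omega>. G \<omega> t) \<in> borel_measurable K"
  unfolding G_def using assms
  by (intro borel_measurable_optmuon_grad[OF grad_measurable Orth_measurable]) auto

lemma noise_measurable:
  assumes "\<And>s. 1 \<le> s \<Longrightarrow> s \<le> t \<Longrightarrow> \<xi> s \<in> measurable K D" "t \<ge> 1"
  shows "noise t \<in> borel_measurable K"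
  using assms by (intro borel_measurable_diff G_measurable N_measurable) auto

lemma alpha_measurable:
  assumes "\<And>s. 1 \<le> s \<Longrightarrow> s < t \<Longrightarrow> \<xi> s \<in> measurable K D"
  shows "(\<lambda>\<omega>. muon_alpha (G \<omega>) t) \<in> borel_measurable K"
  using assms by (intro borel_measurable_muon_alpha G_measurable) auto

lemma dir_measurable:
  assumes "\<And>s. 1 \<le> s \<Longrightarrow> s < t \<Longrightarrow> \<xi> s \<in> measurable K D" "t \<ge> 1"
  shows "dir t \<in> borel_measurable K"
proof -
  have [measurable]: "(\<lambda>\<omega>. muon_alpha (G \<omega>) t) \<in> borel_measurable K" "(\<lambda>\<omega>. N \<omega> t) \<in> borel_measurable K"
    using assms by (auto intro!: alpha_measurable N_measurable)
  have [measurable]: "(\<lambda>\<omega>. muon_M (G \<omega>) (t - 1)) \<in> borel_measurable K"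
    using assms by (intro borel_measurable_muon_M G_measurable) auto
  show ?thesis
    unfolding muon_mart_dir_def by measurable
qed

lemma past_map_measurable: "(\<lambda>\<omega>. \<lambda>s\<in>{1..<t}. \<xi> s \<omega>) \<in> measurable P (\<Pi>\<^sub>M s\<in>{1..<t}. D)"
  by (intro measurable_restrict xi_measurable) auto

lemma subalgebra_past: "subalgebra P (past t)"
  unfolding past_def by (rule subalgebra_vimage_algebra[OF past_map_measurable])

lemma xi_measurable_past:
  assumes "1 \<le> s" "s < t"
  shows "\<xi> s \<in> measurable (past t) D"
proof -
  have "(\<lambda>\<omega>. \<lambda>s\<in>{1..<t}. \<xi> s \<omega>) \<in> measurable (past t) (\<Pi>\<^sub>M s\<in>{1..<t}. D)"
    unfolding past_def using measurable_space[OF past_map_measurable]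
    by (intro measurable_vimage_algebra1) auto
  from measurable_compose[OF this measurable_component_singleton[of s "{1..<t}" "\<lambda>_. D"]]
  show ?thesis using assms by simp
qed

lemmas measurable_past = X_measurable[OF xi_measurable_past] N_measurable[OF xi_measurable_past]
  alpha_measurable[OF xi_measurable_past] dir_measurable[OF xi_measurable_past]

lemma measurable_from_past: "Y \<in> borel_measurable (past t) \<Longrightarrow> Y \<in> borel_measurable P"
  using measurable_from_subalg[OF subalgebra_past] by blast

lemma expectation_fresh:
  fixes \<phi> :: "'w \<times> 'x \<Rightarrow> real"
  assumes t: "t \<ge> 1" and \<phi>: "\<phi> \<in> borel_measurable (past t \<Otimes>\<^sub>M D)"
    and int: "integrable P (\<lambda>\<omega>. \<phi> (\<omega>, \<xi> t \<omega>))"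
  shows "integrable P (\<lambda>\<omega>. \<integral>x. \<phi> (\<omega>, x) \<partial>D)"
    and "expectation (\<lambda>\<omega>. \<phi> (\<omega>, \<xi> t \<omega>)) = expectation (\<lambda>\<omega>. \<integral>x. \<phi> (\<omega>, x) \<partial>D)"
  using expectation_indep_pair[OF subalgebra_past xi_measurable[OF t]
      indep_set_past[OF xi_indep t, folded past_def] \<phi> int]
  by (simp_all add: xi_distr[OF t])

lemma fresh_noise_measurable:
  "(\<lambda>p. grad (\<lambda>Z. F Z (snd p)) (X t (fst p)) - N (fst p) t) \<in> borel_measurable (past t \<Otimes>\<^sub>M D)"
proof -
  have [measurable]: "X t \<in> borel_measurable (past t)"
    by (rule measurable_past)
  have "(\<lambda>p. (X t (fst p), snd p)) \<in> measurable (past t \<Otimes>\<^sub>M D) (borel \<Otimes>\<^sub>M D)"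
    by measurable
  from measurable_compose[OF this grad_measurable]
  have [measurable]: "(\<lambda>p. grad (\<lambda>Z. F Z (snd p)) (X t (fst p))) \<in> borel_measurable (past t \<Otimes>\<^sub>M D)"
    by simp
  show ?thesis by measurable
qed

lemma noise_eq: "noise t \<omega> = grad (\<lambda>Z. F Z (\<xi> t \<omega>)) (X t \<omega>) - N \<omega> t"
  by (simp add: G_def optmuon_grad_def X_def)

text \<open>With the path before \<open>t\<close> frozen, the fresh gradient averages to
  \<open>N \<omega> t\<close> and \<open>Y\<close> is a constant vector, so the inner integral is
  zero.\<close>

lemma expectation_noise_inner:
  assumes t: "t \<ge> 1" and Y: "Y \<in> borel_measurable (past t)"
    and int: "integrable P (\<lambda>\<omega>. inner (noise t \<omega>) (Y \<omega>))"
  shows "expectation (\<lambda>\<omega>. inner (noise t \<omega>) (Y \<omega>)) = 0"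
proof -
  interpret D: prob_space D by (rule D)
  define \<phi> where "\<phi> p = inner (grad (\<lambda>Z. F Z (snd p)) (X t (fst p)) - N (fst p) t) (Y (fst p))" for p
  have "\<phi> \<in> borel_measurable (past t \<Otimes>\<^sub>M D)"
    unfolding \<phi>_def[abs_def] using Y
    by (intro borel_measurable_inner fresh_noise_measurable measurable_compose[OF measurable_fst]) auto
  moreover have "integrable P (\<lambda>\<omega>. \<phi> (\<omega>, \<xi> t \<omega>))"
    using int by (simp add: \<phi>_def noise_eq)
  ultimately have "expectation (\<lambda>\<omega>. \<phi> (\<omega>, \<xi> t \<omega>)) = expectation (\<lambda>\<omega>. \<integral>x. \<phi> (\<omega>, x) \<partial>D)"
    by (rule expectation_fresh[OF t])
  moreover have "(\<integral>x. \<phi> (\<omega>, x) \<partial>D) = 0" for \<omega>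
  proof -
    have "integrable D (\<lambda>x. grad (\<lambda>Z. F Z x) (X t \<omega>))" "(\<integral>x. grad (\<lambda>Z. F Z x) (X t \<omega>) \<partial>D) = N \<omega> t"
      using unbiased by (auto simp: has_bochner_integral_iff)
    then show ?thesis
      by (simp add: \<phi>_def D.prob_space)
  qed
  ultimately show ?thesis
    by (simp add: \<phi>_def noise_eq)
qed

lemma norm_noise_le: "AE \<omega> in P. \<forall>t\<ge>1. norm (noise t \<omega>) \<le> 2 * H"
  using norm_G_le
proof eventually_elim
  case (elim \<omega>)
  have "norm (noise t \<omega>) \<le> norm (G \<omega> t) + norm (N \<omega> t)" for t
    by (rule norm_triangle_ineq4)
  with elim show ?case
    using norm_grad_le by (smt (verit))
qed

lemma integrable_bounded:
  assumes "Y \<in> borel_measurable P" "AE \<omega> in P. \<bar>Y \<omega>\<bar> \<le> c"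
  shows "integrable P (Y :: 'w \<Rightarrow> real)"
  using assms by (intro integrable_const_bound[of _ c]) auto

lemma integrable_noise_sq: "t \<ge> 1 \<Longrightarrow> integrable P (\<lambda>\<omega>. (norm (noise t \<omega>))\<^sup>2)"
proof (rule integrable_bounded[where c = "(2 * H)\<^sup>2"])
  assume t: "t \<ge> 1"
  then have [measurable]: "noise t \<in> borel_measurable P"
    by (intro noise_measurable xi_measurable)
  show "(\<lambda>\<omega>. (norm (noise t \<omega>))\<^sup>2) \<in> borel_measurable P"
    by measurable
  show "AE \<omega> in P. \<bar>(norm (noise t \<omega>))\<^sup>2\<bar> \<le> (2 * H)\<^sup>2"
    using norm_noise_le
  proof eventually_elim
    case (elim \<omega>)
    then show ?case
      using t power_mono[of "norm (noise t \<omega>)" "2 * H" 2] by simp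
  qed
qed

lemma expectation_noise_sq_le:
  assumes t: "t \<ge> 1"
  shows "expectation (\<lambda>\<omega>. (norm (noise t \<omega>))\<^sup>2) \<le> \<sigma>\<^sup>2"
proof -
  define \<phi> where "\<phi> p = (norm (grad (\<lambda>Z. F Z (snd p)) (X t (fst p)) - N (fst p) t))\<^sup>2" for p
  have \<phi>: "\<phi> \<in> borel_measurable (past t \<Otimes>\<^sub>M D)"
    unfolding \<phi>_def[abs_def] by (rule measurable_compose[OF fresh_noise_measurable]) measurable
  have int: "integrable P (\<lambda>\<omega>. \<phi> (\<omega>, \<xi> t \<omega>))"
    using integrable_noise_sq[OF t] by (simp add: \<phi>_def noise_eq)
  have "expectation (\<lambda>\<omega>. \<phi> (\<omega>, \<xi> t \<omega>)) = expectation (\<lambda>\<omega>. \<integral>x. \<phi> (\<omega>, x) \<partial>D)"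
    by (rule expectation_fresh[OF t \<phi> int])
  also have "\<dots> \<le> \<sigma>\<^sup>2"
    using expectation_fresh(1)[OF t \<phi> int] variance_bound
    by (intro integral_le_const) (auto simp: \<phi>_def)
  finally show ?thesis
    by (simp add: \<phi>_def noise_eq)
qed

lemma norm_dir_le: "AE \<omega> in P. \<forall>t\<ge>1. norm (dir t \<omega>) \<le> 4 * varpi H * H * muon_alpha (G \<omega>) t"
  using muon_path_AE by eventually_elim (use muon_path.norm_mart_dir_le in blast)

definition "mart k \<omega> = (\<Sum>t=1..k. inner (noise t \<omega>) (dir t \<omega>))"

text \<open>A crude bound that serves integrability only; the quantitative bound on the martingale
  is \<open>expectation_mart_sq_le\<close>.\<close>

lemma abs_inner_dir_le: "AE \<omega> in P. \<forall>t\<ge>1. \<bar>inner (noise t \<omega>) (dir t \<omega>)\<bar> \<le> 2 * H * (4 * varpi H * H)"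
  using norm_dir_le norm_noise_le
proof eventually_elim
  case (elim \<omega>)
  show ?case
  proof (intro allI impI)
    fix t :: nat assume t: "t \<ge> 1"
    have "norm (dir t \<omega>) \<le> 4 * varpi H * H * muon_alpha (G \<omega>) t"
      using elim t by blast
    also have "\<dots> \<le> 4 * varpi H * H * 1"
      using params varpi_ge_1[of H] muon_alpha_le_1[of "G \<omega>" t] by (intro mult_left_mono) auto
    finally have "norm (noise t \<omega>) * norm (dir t \<omega>) \<le> 2 * H * (4 * varpi H * H)"
      using elim t params by (intro mult_mono) auto
    then show "\<bar>inner (noise t \<omega>) (dir t \<omega>)\<bar> \<le> 2 * H * (4 * varpi H * H)"
      using Cauchy_Schwarz_ineq2[of "noise t \<omega>" "dir t \<omega>"] by linarith
  qed
qed

lemma abs_mart_le: "AE \<omega> in P. \<bar>mart k \<omega>\<bar> \<le> real k * (2 * H * (4 * varpi H * H))"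
  using abs_inner_dir_le
proof eventually_elim
  case (elim \<omega>)
  have "\<bar>mart k \<omega>\<bar> \<le> (\<Sum>t=1..k. \<bar>inner (noise t \<omega>) (dir t \<omega>)\<bar>)"
    unfolding mart_def by (rule sum_abs)
  also have "\<dots> \<le> (\<Sum>t=1..k. 2 * H * (4 * varpi H * H))"
    using elim by (intro sum_mono) auto
  finally show ?case by simp
qed

lemma mart_measurable:
  assumes "\<And>s. 1 \<le> s \<Longrightarrow> s \<le> k \<Longrightarrow> \<xi> s \<in> measurable K D"
  shows "mart k \<in> borel_measurable K"
  unfolding mart_def using assms
  by (intro borel_measurable_sum borel_measurable_inner noise_measurable dir_measurable) auto

lemma integrable_mart: "integrable P (mart k)"
  using abs_mart_le[of k] by (intro integrable_bounded mart_measurable xi_measurable)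

lemma integrable_mart_sq: "integrable P (\<lambda>\<omega>. (mart k \<omega>)\<^sup>2)"
proof (rule integrable_bounded[where c = "(real k * (2 * H * (4 * varpi H * H)))\<^sup>2"])
  have [measurable]: "mart k \<in> borel_measurable P"
    by (intro mart_measurable xi_measurable)
  show "(\<lambda>\<omega>. (mart k \<omega>)\<^sup>2) \<in> borel_measurable P"
    by measurable
  show "AE \<omega> in P. \<bar>(mart k \<omega>)\<^sup>2\<bar> \<le> (real k * (2 * H * (4 * varpi H * H)))\<^sup>2"
    using abs_mart_le[of k]
  proof eventually_elim
    case (elim \<omega>)
    then have "\<bar>mart k \<omega>\<bar>\<^sup>2 \<le> (real k * (2 * H * (4 * varpi H * H)))\<^sup>2"
      by (intro power_mono) auto
    then show ?case
      by (simp only: power2_abs abs_power2)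
  qed
qed

lemma integrable_inner_dir: "t \<ge> 1 \<Longrightarrow> integrable P (\<lambda>\<omega>. inner (noise t \<omega>) (dir t \<omega>))"
proof (rule integrable_bounded[where c = "2 * H * (4 * varpi H * H)"])
  assume t: "t \<ge> 1"
  then show "(\<lambda>\<omega>. inner (noise t \<omega>) (dir t \<omega>)) \<in> borel_measurable P"
    by (intro borel_measurable_inner noise_measurable dir_measurable xi_measurable)
  show "AE \<omega> in P. \<bar>inner (noise t \<omega>) (dir t \<omega>)\<bar> \<le> 2 * H * (4 * varpi H * H)"
    using abs_inner_dir_le by eventually_elim (use t in blast)
qed

lemma expectation_mart: "expectation (mart k) = 0"
proof -
  have "expectation (mart k) = (\<Sum>t=1..k. expectation (\<lambda>\<omega>. inner (noise t \<omega>) (dir t \<omega>)))"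
    unfolding mart_def using integrable_inner_dir by (intro Bochner_Integration.integral_sum) auto
  also have "\<dots> = 0"
    using integrable_inner_dir by (intro sum.neutral ballI expectation_noise_inner measurable_past) auto
  finally show ?thesis .
qed

lemma integrable_alpha_grad_sq:
  assumes "t \<ge> 1"
  shows "integrable P (\<lambda>\<omega>. (muon_alpha (G \<omega>) t)\<^sup>2 * (norm (G \<omega> t))\<^sup>2)"
proof (rule integrable_bounded[where c = "1 * H\<^sup>2"])
  have [measurable]: "(\<lambda>\<omega>. muon_alpha (G \<omega>) t) \<in> borel_measurable P" "(\<lambda>\<omega>. G \<omega> t) \<in> borel_measurable P"
    using assms by (auto intro!: alpha_measurable G_measurable xi_measurable)
  show "(\<lambda>\<omega>. (muon_alpha (G \<omega>) t)\<^sup>2 * (norm (G \<omega> t))\<^sup>2) \<in> borel_measurable P"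
    by measurable
  show "AE \<omega> in P. \<bar>(muon_alpha (G \<omega>) t)\<^sup>2 * (norm (G \<omega> t))\<^sup>2\<bar> \<le> 1 * H\<^sup>2"
    using norm_G_le
  proof eventually_elim
    case (elim \<omega>)
    have "(muon_alpha (G \<omega>) t)\<^sup>2 \<le> 1"
      using muon_alpha_le_1[of "G \<omega>" t] muon_alpha_pos[of "G \<omega>" t] by (simp add: power_le_one)
    then have "(muon_alpha (G \<omega>) t)\<^sup>2 * (norm (G \<omega> t))\<^sup>2 \<le> 1 * H\<^sup>2"
      using elim assms by (intro mult_mono power_mono) auto
    then show ?case by simp
  qed
qed

text \<open>The squared noise is again traded for the squared stochastic gradient. The linear
  remainder pairs the noise with \<open>Y\<close>, which is measurable in the past, and has mean
  zero. The 16 is the square of the 4 in \<open>norm_mart_dir_le\<close>.\<close>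

lemma expectation_inner_dir_sq_le:
  assumes t: "t \<ge> 1"
  shows "integrable P (\<lambda>\<omega>. (inner (noise t \<omega>) (dir t \<omega>))\<^sup>2)"
    and "expectation (\<lambda>\<omega>. (inner (noise t \<omega>) (dir t \<omega>))\<^sup>2)
      \<le> 16 * (varpi H)\<^sup>2 * H\<^sup>2 * expectation (\<lambda>\<omega>. (muon_alpha (G \<omega>) t)\<^sup>2 * (norm (G \<omega> t))\<^sup>2)"
proof -
  define c where "c = 16 * (varpi H)\<^sup>2 * H\<^sup>2"
  define Y where "Y \<omega> = (2 * c * (muon_alpha (G \<omega>) t)\<^sup>2) *\<^sub>R N \<omega> t" for \<omega>
  have [measurable]: "noise t \<in> borel_measurable P" "dir t \<in> borel_measurable P"
    using t by (auto intro!: noise_measurable dir_measurable xi_measurable)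
  show i: "integrable P (\<lambda>\<omega>. (inner (noise t \<omega>) (dir t \<omega>))\<^sup>2)"
  proof (rule integrable_bounded[where c = "(2 * H * (4 * varpi H * H))\<^sup>2"])
    show "AE \<omega> in P. \<bar>(inner (noise t \<omega>) (dir t \<omega>))\<^sup>2\<bar> \<le> (2 * H * (4 * varpi H * H))\<^sup>2"
      using abs_inner_dir_le
    proof eventually_elim
      case (elim \<omega>)
      then have "\<bar>inner (noise t \<omega>) (dir t \<omega>)\<bar>\<^sup>2 \<le> (2 * H * (4 * varpi H * H))\<^sup>2"
        using t by (intro power_mono) auto
      then show ?case
        by (simp only: power2_abs abs_power2)
    qed
  qed measurable
  have Y: "Y \<in> borel_measurable (past t)"
  proof -
    have [measurable]: "(\<lambda>\<omega>. muon_alpha (G \<omega>) t) \<in> borel_measurable (past t)" "(\<lambda>\<omega>. N \<omega> t) \<in> borel_measurable (past t)"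
      by (auto intro: measurable_past)
    show ?thesis
      unfolding Y_def by measurable
  qed
  have iY: "integrable P (\<lambda>\<omega>. inner (noise t \<omega>) (Y \<omega>))"
  proof (rule integrable_bounded[where c = "2 * H * (2 * c * 1 * H)"])
    show "(\<lambda>\<omega>. inner (noise t \<omega>) (Y \<omega>)) \<in> borel_measurable P"
      using measurable_from_past[OF Y] by measurable
    show "AE \<omega> in P. \<bar>inner (noise t \<omega>) (Y \<omega>)\<bar> \<le> 2 * H * (2 * c * 1 * H)"
      using norm_noise_le
    proof eventually_elim
      case (elim \<omega>)
      have "(muon_alpha (G \<omega>) t)\<^sup>2 \<le> 1"
        using muon_alpha_le_1[of "G \<omega>" t] muon_alpha_pos[of "G \<omega>" t] by (simp add: power_le_one)
      moreover have c: "c \<ge> 0" by (simp add: c_def)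
      ultimately have "2 * c * (muon_alpha (G \<omega>) t)\<^sup>2 \<le> 2 * c * 1"
        by (intro mult_left_mono) auto
      then have "norm (Y \<omega>) \<le> 2 * c * 1 * H"
        unfolding Y_def norm_scaleR using norm_grad_le[of "X t \<omega>"] params c
        by (intro mult_mono) auto
      then have "norm (noise t \<omega>) * norm (Y \<omega>) \<le> 2 * H * (2 * c * 1 * H)"
        using elim t params by (intro mult_mono) auto
      then show ?case
        using Cauchy_Schwarz_ineq2[of "noise t \<omega>" "Y \<omega>"] by linarith
    qed
  qed
  have "AE \<omega> in P. (inner (noise t \<omega>) (dir t \<omega>))\<^sup>2
      \<le> c * ((muon_alpha (G \<omega>) t)\<^sup>2 * (norm (G \<omega> t))\<^sup>2) - inner (noise t \<omega>) (Y \<omega>)"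
    using norm_dir_le
  proof eventually_elim
    case (elim \<omega>)
    let ?a = "muon_alpha (G \<omega>) t"
    have "(inner (noise t \<omega>) (dir t \<omega>))\<^sup>2 \<le> (norm (noise t \<omega>) * norm (dir t \<omega>))\<^sup>2"
      using Cauchy_Schwarz_ineq2[of "noise t \<omega>" "dir t \<omega>"] by (metis abs_ge_zero power2_abs power_mono)
    also have "\<dots> \<le> (norm (noise t \<omega>) * (4 * varpi H * H * ?a))\<^sup>2"
      using elim t by (intro power_mono mult_left_mono mult_nonneg_nonneg) auto
    also have "\<dots> = c * ?a\<^sup>2 * (norm (noise t \<omega>))\<^sup>2"
      by (simp add: c_def power_mult_distrib)
    also have "(norm (noise t \<omega>))\<^sup>2 = (norm (G \<omega> t))\<^sup>2 - 2 * inner (noise t \<omega>) (N \<omega> t) - (norm (N \<omega> t))\<^sup>2"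
      by (simp add: power2_norm_eq_inner inner_diff_left inner_diff_right inner_commute)
    also have "c * ?a\<^sup>2 * \<dots> \<le> c * ?a\<^sup>2 * ((norm (G \<omega> t))\<^sup>2 - 2 * inner (noise t \<omega>) (N \<omega> t))"
      by (intro mult_left_mono) (auto simp: c_def)
    finally show ?case
      by (simp add: Y_def algebra_simps)
  qed
  then have "expectation (\<lambda>\<omega>. (inner (noise t \<omega>) (dir t \<omega>))\<^sup>2)
      \<le> expectation (\<lambda>\<omega>. c * ((muon_alpha (G \<omega>) t)\<^sup>2 * (norm (G \<omega> t))\<^sup>2) - inner (noise t \<omega>) (Y \<omega>))"
    using i iY integrable_alpha_grad_sq[OF t] by (intro integral_mono_AE) auto
  also have "\<dots> = c * expectation (\<lambda>\<omega>. (muon_alpha (G \<omega>) t)\<^sup>2 * (norm (G \<omega> t))\<^sup>2)"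
    using iY integrable_alpha_grad_sq[OF t] expectation_noise_inner[OF t Y iY] by simp
  finally show "expectation (\<lambda>\<omega>. (inner (noise t \<omega>) (dir t \<omega>))\<^sup>2)
      \<le> 16 * (varpi H)\<^sup>2 * H\<^sup>2 * expectation (\<lambda>\<omega>. (muon_alpha (G \<omega>) t)\<^sup>2 * (norm (G \<omega> t))\<^sup>2)"
    by (simp add: c_def)
qed

text \<open>Martingale increments are orthogonal: in the cross term the noise is paired with
  \<open>mart k \<omega> *\<^sub>R dir ?t \<omega>\<close>, which is determined before step
  \<open>Suc k\<close>.\<close>

lemma expectation_mart_sq_le_sum:
  "expectation (\<lambda>\<omega>. (mart k \<omega>)\<^sup>2)
    \<le> 16 * (varpi H)\<^sup>2 * H\<^sup>2 * (\<Sum>t=1..k. expectation (\<lambda>\<omega>. (muon_alpha (G \<omega>) t)\<^sup>2 * (norm (G \<omega> t))\<^sup>2))"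
proof (induction k)
  case (Suc k)
  let ?t = "Suc k"
  define x where "x \<omega> = inner (noise ?t \<omega>) (dir ?t \<omega>)" for \<omega>
  have ix: "integrable P (\<lambda>\<omega>. (x \<omega>)\<^sup>2)"
    unfolding x_def by (rule expectation_inner_dir_sq_le) simp
  have cross_eq: "mart k \<omega> * x \<omega> = inner (noise ?t \<omega>) (mart k \<omega> *\<^sub>R dir ?t \<omega>)" for \<omega>
    by (simp add: x_def)
  have Y: "(\<lambda>\<omega>. mart k \<omega> *\<^sub>R dir ?t \<omega>) \<in> borel_measurable (past ?t)"
    by (intro borel_measurable_scaleR mart_measurable measurable_past xi_measurable_past) auto
  have icross: "integrable P (\<lambda>\<omega>. mart k \<omega> * x \<omega>)"
  proof (rule Bochner_Integration.integrable_bound)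
    show "integrable P (\<lambda>\<omega>. (mart k \<omega>)\<^sup>2 + (x \<omega>)\<^sup>2)"
      using integrable_mart_sq ix by auto
    show "(\<lambda>\<omega>. mart k \<omega> * x \<omega>) \<in> borel_measurable P"
      using integrable_mart integrable_inner_dir[of ?t] by (auto simp: x_def[abs_def])
    have "\<bar>u * v\<bar> \<le> u\<^sup>2 + v\<^sup>2" for u v :: real
    proof -
      have "2 * (\<bar>u\<bar> * \<bar>v\<bar>) \<le> \<bar>u\<bar>\<^sup>2 + \<bar>v\<bar>\<^sup>2"
        using sum_squares_bound[of "\<bar>u\<bar>" "\<bar>v\<bar>"] by simp
      moreover have "0 \<le> \<bar>u\<bar> * \<bar>v\<bar>" by simp
      ultimately show ?thesis
        unfolding abs_mult power2_abs by linarith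
    qed
    then show "AE \<omega> in P. norm (mart k \<omega> * x \<omega>) \<le> norm ((mart k \<omega>)\<^sup>2 + (x \<omega>)\<^sup>2)"
      by auto
  qed
  have cross: "expectation (\<lambda>\<omega>. mart k \<omega> * x \<omega>) = 0"
    using icross unfolding cross_eq by (intro expectation_noise_inner Y) auto
  have "expectation (\<lambda>\<omega>. (mart ?t \<omega>)\<^sup>2) = expectation (\<lambda>\<omega>. (mart k \<omega>)\<^sup>2 + 2 * (mart k \<omega> * x \<omega>) + (x \<omega>)\<^sup>2)"
  proof (intro Bochner_Integration.integral_cong refl)
    fix \<omega>
    have "mart ?t \<omega> = mart k \<omega> + x \<omega>"
      by (simp add: mart_def x_def)
    then show "(mart ?t \<omega>)\<^sup>2 = (mart k \<omega>)\<^sup>2 + 2 * (mart k \<omega> * x \<omega>) + (x \<omega>)\<^sup>2"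
      by (simp add: power2_sum)
  qed
  also have "\<dots> = expectation (\<lambda>\<omega>. (mart k \<omega>)\<^sup>2) + expectation (\<lambda>\<omega>. (x \<omega>)\<^sup>2)"
    using integrable_mart_sq ix icross cross by simp
  finally show ?case
    using Suc.IH expectation_inner_dir_sq_le(2)[of ?t] by (simp add: x_def distrib_left)
qed (simp add: mart_def)

lemma expectation_mart_sq_le:
  "expectation (\<lambda>\<omega>. (mart T \<omega>)\<^sup>2) \<le> 32 * varpi H ^ 8 * (ln (exp 1 + H\<^sup>2) * ln (exp 1 + real T))"
proof -
  let ?l = "ln (exp 1 + H\<^sup>2) * ln (exp 1 + real T)"
  have "(\<Sum>t=1..T. expectation (\<lambda>\<omega>. (muon_alpha (G \<omega>) t)\<^sup>2 * (norm (G \<omega> t))\<^sup>2)) =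
      expectation (\<lambda>\<omega>. \<Sum>t=1..T. (muon_alpha (G \<omega>) t)\<^sup>2 * (norm (G \<omega> t))\<^sup>2)"
    using integrable_alpha_grad_sq by (intro Bochner_Integration.integral_sum[symmetric]) auto
  also have "\<dots> \<le> 2 * varpi H ^ 4 * ?l"
  proof (rule integral_le_const)
    show "integrable P (\<lambda>\<omega>. \<Sum>t=1..T. (muon_alpha (G \<omega>) t)\<^sup>2 * (norm (G \<omega> t))\<^sup>2)"
      using integrable_alpha_grad_sq by (intro Bochner_Integration.integrable_sum) auto
    show "AE \<omega> in P. (\<Sum>t=1..T. (muon_alpha (G \<omega>) t)\<^sup>2 * (norm (G \<omega> t))\<^sup>2) \<le> 2 * varpi H ^ 4 * ?l"
      using muon_path_AE by eventually_elim (rule muon_path.sum_alpha_grad_sq_le_ln)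
  qed
  finally have "expectation (\<lambda>\<omega>. (mart T \<omega>)\<^sup>2) \<le> 16 * (varpi H)\<^sup>2 * H\<^sup>2 * (2 * varpi H ^ 4 * ?l)"
    by (intro order_trans[OF expectation_mart_sq_le_sum] mult_left_mono) auto
  also have "\<dots> \<le> 16 * (varpi H)\<^sup>2 * (varpi H)\<^sup>2 * (2 * varpi H ^ 4 * ?l)"
    using one_le_ln_exp_1_add[of "H\<^sup>2"] one_le_ln_exp_1_add[of "real T"]
    by (intro mult_right_mono mult_left_mono) (auto simp: varpi_sq)
  also have "\<dots> = 32 * varpi H ^ 8 * ?l"
    by algebra
  finally show ?thesis .
qed

end

text \<open>Young's inequality absorbs the linear term in \<open>y\<close> into half of
  \<open>y\<^sup>2\<close>. As \<open>l \<ge> 1\<close>, what remains is at most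
  \<open>p\<^sup>2 + q\<^sup>2\<close>, and the root splits.\<close>

lemma self_bounding_le:
  fixes y C l s :: real
  assumes y: "0 \<le> y" "y\<^sup>2 \<le> (C * l)\<^sup>2 / 2 * (1 + y + s)" and l: "1 \<le> l" and C: "0 \<le> C" and s: "0 \<le> s"
  shows "y \<le> C * sqrt (2 + 8 * C\<^sup>2) * l\<^sup>2 + 2 powr (3/4) * C * l * sqrt s"
proof -
  define p where "p = C * sqrt (2 + 8 * C\<^sup>2) * l\<^sup>2"
  define q where "q = C * l * sqrt s"
  have "(C * l)\<^sup>2 / 2 * y \<le> y\<^sup>2 / 2 + (C * l) ^ 4 / 8"
    using zero_le_power2[of "y - (C * l)\<^sup>2 / 2"] by (simp add: power2_eq_square power4_eq_xxxx algebra_simps)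
  then have "y\<^sup>2 \<le> (C * l)\<^sup>2 + (C * l) ^ 4 / 4 + (C * l)\<^sup>2 * s"
    using y(2) by (simp add: algebra_simps)
  also have "(C * l)\<^sup>2 + (C * l) ^ 4 / 4 \<le> p\<^sup>2"
  proof -
    have l2: "l\<^sup>2 \<le> l ^ 4"
      using l by (intro power_increasing) auto
    have "(C * l)\<^sup>2 + (C * l) ^ 4 / 4 = C\<^sup>2 * l\<^sup>2 + C ^ 4 * l ^ 4 / 4"
      by (simp add: power_mult_distrib)
    also have "\<dots> \<le> C\<^sup>2 * (2 * l ^ 4) + C ^ 4 * l ^ 4 * 8"
      using l2 by (intro add_mono mult_left_mono) (auto intro: order_trans)
    also have "\<dots> = C\<^sup>2 * (2 + 8 * C\<^sup>2) * l ^ 4"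
      by algebra
    also have "\<dots> = p\<^sup>2"
      by (simp add: p_def power_mult_distrib flip: power_mult)
    finally show ?thesis .
  qed
  also have "(C * l)\<^sup>2 * s = q\<^sup>2"
    using s by (simp add: q_def power_mult_distrib)
  also have pq: "0 \<le> p" "0 \<le> q"
    using C l s by (auto simp: p_def q_def)
  then have "p\<^sup>2 + q\<^sup>2 \<le> (p + q)\<^sup>2"
    by (simp add: power2_sum)
  finally have "y \<le> p + q"
    using pq by (intro power2_le_imp_le[of y]) auto
  also have "q \<le> 2 powr (3/4) * q"
    using pq ge_one_powr_ge_zero[of 2 "3/4"] mult_right_mono[of 1 "2 powr (3/4)" q] by simp
  finally show ?thesis
    by (simp add: p_def q_def mult_ac)
qed

section \<open>Comparison with the constants of the statement\<close>

lemma delta_nonneg: "delta n \<theta> L \<ge> 0"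
  by (simp add: delta_def)

text \<open>A simpler lower bound for the constant; 104 and 18 are twice the 52 and 9 of
  \<open>C_b\<close>.\<close>

lemma C_c_ge: 
  assumes "H \<ge> 0"
  shows "(104 * varpi H ^ 4 + 18 * delta n \<theta> L) * ln (exp 1 + H\<^sup>2) \<le> C_c n \<theta> L H"
proof -
  have w: "varpi H \<ge> 1" by (rule varpi_ge_1)
  then have "varpi H * kappa H \<ge> 0"
    using assms by (simp add: kappa_def)
  then have 1: "1 \<le> ln (exp 1 + varpi H * kappa H)"
    by (rule one_le_ln_exp_1_add)
  have "104 * varpi H ^ 4 + 18 * delta n \<theta> L * 1
      \<le> 104 * varpi H ^ 5 + 18 * delta n \<theta> L * ln (exp 1 + varpi H * kappa H)"
    using w 1 delta_nonneg[of n \<theta> L] power_increasing[of 4 5 "varpi H"] by (intro add_mono mult_left_mono) auto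
  then have "(104 * varpi H ^ 4 + 18 * delta n \<theta> L) * ln (exp 1 + H\<^sup>2)
      \<le> (104 * varpi H ^ 5 + 18 * delta n \<theta> L * ln (exp 1 + varpi H * kappa H)) * ln (exp 1 + H\<^sup>2)"
    using one_le_ln_exp_1_add[of "H\<^sup>2"] by (intro mult_right_mono) auto
  then show ?thesis
    by (simp add: C_c_def C_b_def algebra_simps)
qed

lemma err_bound_le_C_c:
  assumes "H \<ge> 0"
  shows "err_bound n \<theta> L H T \<le> C_c n \<theta> L H * ln (exp 1 + real T)"
proof -
  have "err_bound n \<theta> L H T = (11 * varpi H ^ 4 + 10 * delta n \<theta> L) * ln (exp 1 + H\<^sup>2) * ln (exp 1 + real T)"
    by (simp add: err_bound_def)
  also have "\<dots> \<le> (104 * varpi H ^ 4 + 18 * delta n \<theta> L) * ln (exp 1 + H\<^sup>2) * ln (exp 1 + real T)"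
    using one_le_ln_exp_1_add[of "H\<^sup>2"] one_le_ln_exp_1_add[of "real T"] delta_nonneg[of n \<theta> L] varpi_ge_1[of H]
    by (intro mult_right_mono add_mono) auto
  also have "\<dots> \<le> C_c n \<theta> L H * ln (exp 1 + real T)"
    using one_le_ln_exp_1_add[of "real T"] by (intro mult_right_mono C_c_ge assms) auto
  finally show ?thesis .
qed

text \<open>The left side bounds the second moment of \<open>v\<close>: its martingale part is
  doubled, so the 32 of \<open>expectation_mart_sq_le\<close> becomes 128. On the right,
  \<open>212 = 36 + 2 * 88\<close> and \<open>12 = 2 * 6\<close> come from \<open>C_u\<close> and
  \<open>C_e\<close>.\<close>

lemma err_bound_sq_le_C_u:
  assumes "H \<ge> 0"
  shows "(err_bound n \<theta> L H T)\<^sup>2 + 128 * varpi H ^ 8 * (ln (exp 1 + H\<^sup>2) * ln (exp 1 + real T))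
    \<le> C_u n \<theta> L H * (ln (exp 1 + real T))\<^sup>2"
proof -
  define x y w d where "x = ln (exp 1 + real T)" and "y = ln (exp 1 + H\<^sup>2)"
    and "w = varpi H ^ 4" and "d = delta n \<theta> L"
  have x: "x \<ge> 1" and y: "y \<ge> 1"
    by (simp_all add: x_def y_def one_le_ln_exp_1_add)
  have w: "w \<ge> 1" and d: "d \<ge> 0"
    using varpi_ge_1[of H] by (simp_all add: w_def d_def delta_nonneg)
  have "(1::real) * 1 \<le> y * x"
    using x y by (intro mult_mono) auto
  then have yx: "y * x \<le> (y * x)\<^sup>2"
    by (simp add: power2_eq_square mult_le_cancel_left1)
  have "varpi H ^ 8 = w\<^sup>2"
    by (simp add: w_def flip: power_mult)
  then have "(err_bound n \<theta> L H T)\<^sup>2 + 128 * varpi H ^ 8 * (y * x)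
      \<le> (11 * w + 10 * d)\<^sup>2 * (y * x)\<^sup>2 + 128 * w\<^sup>2 * (y * x)\<^sup>2"
    using yx by (simp add: err_bound_def x_def y_def w_def d_def power_mult_distrib mult_left_mono)
  also have "\<dots> = ((11 * w + 10 * d)\<^sup>2 + 128 * w\<^sup>2) * (y * x)\<^sup>2"
    by algebra
  also have "\<dots> \<le> ((212 * w + 12 * d) * (104 * w + 18 * d)) * (y * x)\<^sup>2"
  proof (rule mult_right_mono)
    have "0 \<le> w * w" "0 \<le> w * d" "0 \<le> d * d"
      using w d by auto
    then show "(11 * w + 10 * d)\<^sup>2 + 128 * w\<^sup>2 \<le> (212 * w + 12 * d) * (104 * w + 18 * d)"
      by (simp add: power2_eq_square algebra_simps)
  qed simp
  also have "\<dots> = ((212 * w + 12 * d) * y) * ((104 * w + 18 * d) * y) * x\<^sup>2"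
    by algebra
  also have "\<dots> \<le> (36 * varpi H ^ 4 * y + 2 * C_e n \<theta> L H) * C_c n \<theta> L H * x\<^sup>2"
  proof (intro mult_right_mono mult_mono)
    have "w \<le> varpi H ^ 5"
      unfolding w_def using varpi_ge_1[of H] by (intro power_increasing) auto
    then have "(212 * w + 12 * d) * y \<le> (36 * w + 176 * varpi H ^ 5 + 12 * d) * y"
      using y by (intro mult_right_mono) auto
    then show "(212 * w + 12 * d) * y \<le> 36 * varpi H ^ 4 * y + 2 * C_e n \<theta> L H"
      by (simp add: C_e_def w_def d_def y_def algebra_simps)
    show "(104 * w + 18 * d) * y \<le> C_c n \<theta> L H"
      unfolding w_def d_def y_def by (rule C_c_ge[OF assms])
    show "0 \<le> 36 * varpi H ^ 4 * y + 2 * C_e n \<theta> L H"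
      using y delta_nonneg[of n \<theta> L] varpi_ge_1[of H] by (simp add: C_e_def y_def)
    show "0 \<le> (104 * w + 18 * d) * y"
      using w d y by simp
  qed simp
  finally show ?thesis
    by (simp add: C_u_def x_def y_def)
qed

section \<open>Expected gradient norm\<close>

context optmuon_setup
begin

context
  fixes T :: nat
  assumes T: "T \<ge> 1"
begin

text \<open>
  Along almost every path \<open>v\<close> dominates the weighted sum of squared errors and \<open>q\<close> the sum of
  \<open>\<gamma> t * \<alpha> t * (norm (M t))\<^sup>2\<close>; both are affine in the martingale, so their moments are explicit.
\<close>

definition "lT = ln (exp 1 + real T)"
definition "v \<omega> = err_bound CARD('n) \<theta> L H T + 2 * mart T \<omega>"
definition "q \<omega> = (f X1 - fstar + c_1 CARD('n) \<theta> * v \<omega> + c_2 CARD('n) \<theta> L * (C_d H * lT)) / c_0 \<theta>"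
definition "r \<omega> = sqrt (grad_sum (G \<omega>) T)"
definition "z \<omega> = sqrt (\<Sum>t=1..T. (norm (N \<omega> t))\<^sup>2)"

abbreviation "Cw \<equiv> C_w CARD('n) \<theta> L H (f X1 - fstar)"
abbreviation "Cx \<equiv> C_x CARD('n) \<theta> L H (f X1 - fstar)"
abbreviation "Cz \<equiv> C_z CARD('n) \<theta> L H (f X1 - fstar)"

lemma lT: "1 \<le> lT" "lT \<le> lT\<^sup>2" "1 \<le> lT\<^sup>2"
proof -
  show l: "1 \<le> lT"
    by (simp add: lT_def one_le_ln_exp_1_add)
  then show "lT \<le> lT\<^sup>2" "1 \<le> lT\<^sup>2"
    by (simp_all add: power2_eq_square mult_le_cancel_left1 mult_ge1_I)
qed

lemma constants_pos: "0 < c_0 \<theta>" "0 < c_1 CARD('n) \<theta>" "0 < c_2 CARD('n) \<theta> L" "0 \<le> f X1 - fstar"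
  "0 < C_c CARD('n) \<theta> L H" "0 \<le> C_d H" "0 < Cw" "0 \<le> Cx"
proof -
  show c: "0 < c_0 \<theta>" "0 < c_1 CARD('n) \<theta>" "0 < c_2 CARD('n) \<theta> L" "0 \<le> f X1 - fstar"
    using params lower[of X1] by (auto simp: c_0_def c_1_def c_2_def)
  have "0 < (104 * varpi H ^ 4 + 18 * delta CARD('n) \<theta> L) * ln (exp 1 + H\<^sup>2)"
    using delta_nonneg[of "CARD('n)" \<theta> L] varpi_ge_1[of H] one_le_ln_exp_1_add[of "H\<^sup>2"]
    by (intro mult_pos_pos add_pos_nonneg) auto
  then show Cc: "0 < C_c CARD('n) \<theta> L H"
    using C_c_ge[of H "CARD('n)" \<theta> L] params by simp
  show Cd: "0 \<le> C_d H"
    using params by (simp add: C_d_nonneg)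
  show "0 < Cw"
    unfolding C_w_def using c Cc Cd
    by (intro mult_pos_pos add_pos_nonneg add_nonneg_pos) auto
  have "0 \<le> C_u CARD('n) \<theta> L H"
    using Cc one_le_ln_exp_1_add[of "H\<^sup>2"] varpi_ge_1[of H] delta_nonneg[of "CARD('n)" \<theta> L]
    by (auto simp: C_u_def C_e_def intro!: mult_nonneg_nonneg add_nonneg_nonneg)
  then show "0 \<le> Cx"
    unfolding C_x_def by simp
qed

lemma X_1: "X 1 \<omega> = X1"
  by (simp add: X_def)

lemma pathwise:
  "AE \<omega> in P. 0 \<le> v \<omega> \<and> 0 \<le> q \<omega> \<and> z \<omega> \<le> sqrt ((q \<omega> + (q \<omega>)\<^sup>2) * r \<omega>) + sqrt (v \<omega> * r \<omega>)
    \<and> r \<omega> \<le> 1 + z \<omega> + sqrt (\<Sum>t=1..T. (norm (noise t \<omega>))\<^sup>2)"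
  using muon_path_AE
proof eventually_elim
  case (elim \<omega>)
  have v: "v \<omega> = err_bound CARD('n) \<theta> L H T + 2 * (\<Sum>t=1..T. inner (noise t \<omega>) (dir t \<omega>))"
    by (simp add: v_def mart_def)
  have q: "q \<omega> = (f (X 1 \<omega>) - fstar + c_1 CARD('n) \<theta> * v \<omega>
      + c_2 CARD('n) \<theta> L * (C_d H * ln (exp 1 + real T))) / c_0 \<theta>"
    using X_1[of \<omega>] by (simp add: q_def lT_def)
  show ?case
    using muon_path.grad_norm_le[OF elim v q] muon_path.sqrt_grad_sum_le[OF elim, of T]
    by (simp add: z_def r_def)
qed

lemma integrable_v: "integrable P v" "integrable P (\<lambda>\<omega>. (v \<omega>)\<^sup>2)"
  unfolding v_def power2_sum power_mult_distrib
  using integrable_mart[of T] integrable_mart_sq[of T] by auto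

lemma expectation_v: "expectation v = err_bound CARD('n) \<theta> L H T"
  unfolding v_def using integrable_mart[of T] by (simp add: expectation_mart prob_space)

lemma expectation_v_le: "expectation v \<le> C_c CARD('n) \<theta> L H * lT"
  unfolding expectation_v lT_def using params by (intro err_bound_le_C_c) simp

lemma expectation_v_sq_le: "expectation (\<lambda>\<omega>. (v \<omega>)\<^sup>2) \<le> C_u CARD('n) \<theta> L H * lT\<^sup>2"
proof -
  have "expectation (\<lambda>\<omega>. (v \<omega>)\<^sup>2) = (err_bound CARD('n) \<theta> L H T)\<^sup>2 + 4 * expectation (\<lambda>\<omega>. (mart T \<omega>)\<^sup>2)"
    unfolding v_def power2_sum power_mult_distrib
    using integrable_mart[of T] integrable_mart_sq[of T] by (simp add: expectation_mart prob_space)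
  also have "\<dots> \<le> (err_bound CARD('n) \<theta> L H T)\<^sup>2 + 128 * varpi H ^ 8 * (ln (exp 1 + H\<^sup>2) * ln (exp 1 + real T))"
    using expectation_mart_sq_le[of T] by (simp add: mult_ac)
  also have "\<dots> \<le> C_u CARD('n) \<theta> L H * lT\<^sup>2"
    unfolding lT_def using params by (intro err_bound_sq_le_C_u) simp
  finally show ?thesis .
qed

lemma integrable_q: "integrable P q" "integrable P (\<lambda>\<omega>. (q \<omega>)\<^sup>2)"
proof -
  define k where "k = (f X1 - fstar + c_2 CARD('n) \<theta> L * (C_d H * lT)) / c_0 \<theta>"
  define u where "u = c_1 CARD('n) \<theta> / c_0 \<theta>"
  have q: "q = (\<lambda>\<omega>. k + u * v \<omega>)"
    by (simp add: q_def fun_eq_iff k_def u_def add_divide_distrib)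
  show "integrable P q" "integrable P (\<lambda>\<omega>. (q \<omega>)\<^sup>2)"
    unfolding q power2_sum power_mult_distrib using integrable_v by auto
qed

lemma expectation_q_le: "expectation q \<le> Cw * lT"
proof -
  have "expectation q = (f X1 - fstar + c_1 CARD('n) \<theta> * expectation v + c_2 CARD('n) \<theta> L * (C_d H * lT)) / c_0 \<theta>"
    unfolding q_def using integrable_v by (simp add: prob_space)
  also have "\<dots> \<le> ((f X1 - fstar) * lT + c_1 CARD('n) \<theta> * (C_c CARD('n) \<theta> L H * lT) + c_2 CARD('n) \<theta> L * (C_d H * lT)) / c_0 \<theta>"
    using constants_pos lT expectation_v_le mult_left_mono[of 1 lT "f X1 - fstar"]
    by (intro divide_right_mono add_mono mult_left_mono) auto
  also have "\<dots> = Cw * lT"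
    by (simp add: C_w_def field_simps)
  finally show ?thesis .
qed

lemma expectation_q_sq_le: "expectation (\<lambda>\<omega>. (q \<omega>)\<^sup>2) \<le> Cx * lT\<^sup>2"
proof -
  let ?c1 = "c_1 CARD('n) \<theta>" and ?c2 = "c_2 CARD('n) \<theta> L" and ?F = "f X1 - fstar"
  \<comment> \<open>The origin of the 3 in \<open>C_x\<close>.\<close>
  have sq: "((a + b + c) / d)\<^sup>2 \<le> 3 / d\<^sup>2 * (a\<^sup>2 + b\<^sup>2 + c\<^sup>2)" for a b c d :: real
  proof -
    have "(a + b + c)\<^sup>2 \<le> 3 * (a\<^sup>2 + b\<^sup>2 + c\<^sup>2)"
      using zero_le_power2[of "a - b"] zero_le_power2[of "b - c"] zero_le_power2[of "a - c"]
      by (simp add: power2_eq_square algebra_simps)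
    then have "(a + b + c)\<^sup>2 / d\<^sup>2 \<le> 3 * (a\<^sup>2 + b\<^sup>2 + c\<^sup>2) / d\<^sup>2"
      by (intro divide_right_mono) auto
    then show ?thesis by (simp add: power_divide)
  qed
  have "expectation (\<lambda>\<omega>. (q \<omega>)\<^sup>2) \<le> expectation (\<lambda>\<omega>. 3 / (c_0 \<theta>)\<^sup>2 * (?F\<^sup>2 + (?c1 * v \<omega>)\<^sup>2 + (?c2 * (C_d H * lT))\<^sup>2))"
  proof (rule integral_mono)
    show "integrable P (\<lambda>\<omega>. 3 / (c_0 \<theta>)\<^sup>2 * (?F\<^sup>2 + (?c1 * v \<omega>)\<^sup>2 + (?c2 * (C_d H * lT))\<^sup>2))"
      unfolding power_mult_distrib[of ?c1] using integrable_v by auto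
    show "(q \<omega>)\<^sup>2 \<le> 3 / (c_0 \<theta>)\<^sup>2 * (?F\<^sup>2 + (?c1 * v \<omega>)\<^sup>2 + (?c2 * (C_d H * lT))\<^sup>2)" for \<omega>
      unfolding q_def by (rule sq)
  qed (rule integrable_q)
  also have "\<dots> = 3 / (c_0 \<theta>)\<^sup>2 * (?F\<^sup>2 + ?c1\<^sup>2 * expectation (\<lambda>\<omega>. (v \<omega>)\<^sup>2) + (?c2 * (C_d H * lT))\<^sup>2)"
    unfolding power_mult_distrib[of ?c1] using integrable_v by (simp add: prob_space)
  also have "\<dots> \<le> 3 / (c_0 \<theta>)\<^sup>2 * (?F\<^sup>2 * lT\<^sup>2 + ?c1\<^sup>2 * (C_u CARD('n) \<theta> L H * lT\<^sup>2) + (?c2 * (C_d H * lT))\<^sup>2)"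
    using lT expectation_v_sq_le mult_left_mono[of 1 "lT\<^sup>2" "?F\<^sup>2"]
    by (intro mult_left_mono add_mono) auto
  also have "\<dots> = Cx * lT\<^sup>2"
    by (simp add: C_x_def power_mult_distrib algebra_simps)
  finally show ?thesis .
qed

lemma integrable_r: "integrable P r"
proof (rule integrable_bounded[where c = "sqrt (1 + real T * H\<^sup>2)"])
  have "(\<lambda>\<omega>. G \<omega> i) \<in> borel_measurable P" if "i \<in> {1..T}" for i
    using that by (intro G_measurable xi_measurable) auto
  then have [measurable]: "(\<lambda>\<omega>. \<Sum>i=1..T. (norm (G \<omega> i))\<^sup>2) \<in> borel_measurable P"
    by (intro borel_measurable_sum borel_measurable_power borel_measurable_norm) auto
  show "r \<in> borel_measurable P"
    unfolding r_def grad_sum_def by measurable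
  show "AE \<omega> in P. \<bar>r \<omega>\<bar> \<le> sqrt (1 + real T * H\<^sup>2)"
    using norm_G_le
  proof eventually_elim
    case (elim \<omega>)
    interpret bounded_grads "G \<omega>" H
      using elim params by unfold_locales auto
    show ?case
      using grad_sum_le[of T] grad_sum_ge_1[of "G \<omega>" T] by (simp add: r_def)
  qed
qed

lemma N_measurable_P: "(\<lambda>\<omega>. N \<omega> t) \<in> borel_measurable P"
  by (intro N_measurable xi_measurable)

lemma integrable_z: "integrable P z"
proof (rule integrable_bounded[where c = "sqrt (\<Sum>t=1..T. H\<^sup>2)"])
  note [measurable] = N_measurable_P
  show "z \<in> borel_measurable P"
    unfolding z_def by measurable
  show "AE \<omega> in P. \<bar>z \<omega>\<bar> \<le> sqrt (\<Sum>t=1..T. H\<^sup>2)"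
  proof (rule AE_I2)
    fix \<omega>
    have "(\<Sum>t=1..T. (norm (N \<omega> t))\<^sup>2) \<le> (\<Sum>t=1..T. H\<^sup>2)"
      using norm_grad_le by (intro sum_mono power_mono) auto
    then have "sqrt (\<Sum>t=1..T. (norm (N \<omega> t))\<^sup>2) \<le> sqrt (\<Sum>t=1..T. H\<^sup>2)"
      by (rule real_sqrt_le_mono)
    moreover have "0 \<le> sqrt (\<Sum>t=1..T. (norm (N \<omega> t))\<^sup>2)"
      by (intro real_sqrt_ge_zero sum_nonneg) auto
    ultimately show "\<bar>z \<omega>\<bar> \<le> sqrt (\<Sum>t=1..T. H\<^sup>2)"
      unfolding z_def by linarith
  qed
qed

text \<open>Jensen takes the root outside the expectation, where \<open>T\<close> variances add up.
  Here \<open>\<sigma>\<close> enters the rate.\<close>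

lemma expectation_sqrt_noise_le:
  shows "integrable P (\<lambda>\<omega>. sqrt (\<Sum>t=1..T. (norm (noise t \<omega>))\<^sup>2))"
    and "expectation (\<lambda>\<omega>. sqrt (\<Sum>t=1..T. (norm (noise t \<omega>))\<^sup>2)) \<le> \<sigma> * sqrt (real T)"
proof -
  have sum: "integrable P (\<lambda>\<omega>. \<Sum>t=1..T. (norm (noise t \<omega>))\<^sup>2)"
    using integrable_noise_sq by (intro Bochner_Integration.integrable_sum) auto
  show i: "integrable P (\<lambda>\<omega>. sqrt (\<Sum>t=1..T. (norm (noise t \<omega>))\<^sup>2))"
  proof (rule Bochner_Integration.integrable_bound)
    show "integrable P (\<lambda>\<omega>. 1 + (\<Sum>t=1..T. (norm (noise t \<omega>))\<^sup>2))"
      using sum by auto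
    show "(\<lambda>\<omega>. sqrt (\<Sum>t=1..T. (norm (noise t \<omega>))\<^sup>2)) \<in> borel_measurable P"
      using borel_measurable_integrable[OF sum] by measurable
    have "sqrt x \<le> 1 + x" if "0 \<le> x" for x :: real
      using that zero_le_power2[of x] by (intro real_le_lsqrt) (auto simp: power2_sum)
    then show "AE \<omega> in P. norm (sqrt (\<Sum>t=1..T. (norm (noise t \<omega>))\<^sup>2))
        \<le> norm (1 + (\<Sum>t=1..T. (norm (noise t \<omega>))\<^sup>2))"
      by (intro AE_I2) (simp add: sum_nonneg)
  qed
  have "expectation (\<lambda>\<omega>. sqrt (\<Sum>t=1..T. (norm (noise t \<omega>))\<^sup>2))
      \<le> sqrt (expectation (\<lambda>\<omega>. \<Sum>t=1..T. (norm (noise t \<omega>))\<^sup>2))"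
    by (rule expectation_sqrt_le[OF sum _ i]) (auto intro: sum_nonneg)
  also have "expectation (\<lambda>\<omega>. \<Sum>t=1..T. (norm (noise t \<omega>))\<^sup>2)
      = (\<Sum>t=1..T. expectation (\<lambda>\<omega>. (norm (noise t \<omega>))\<^sup>2))"
    using integrable_noise_sq by (intro Bochner_Integration.integral_sum) auto
  also have "sqrt \<dots> \<le> sqrt (\<Sum>t=1..T. \<sigma>\<^sup>2)"
    using expectation_noise_sq_le by (intro real_sqrt_le_mono sum_mono) auto
  also have "\<dots> = \<sigma> * sqrt (real T)"
    using params by (simp add: real_sqrt_mult)
  finally show "expectation (\<lambda>\<omega>. sqrt (\<Sum>t=1..T. (norm (noise t \<omega>))\<^sup>2)) \<le> \<sigma> * sqrt (real T)" .
qed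

lemma expectation_z_le:
  "expectation z \<le> Cz * sqrt (2 + 8 * Cz\<^sup>2) * lT\<^sup>2 + 2 powr (3/4) * Cz * lT * sqrt (\<sigma> * sqrt (real T))"
proof (rule self_bounding_le)
  \<comment> \<open>An upper bound for the expectation of \<open>r\<close> that contains the
    expectation of \<open>z\<close> itself, which makes the final inequality quadratic.\<close>
  define B where "B = 1 + expectation z + \<sigma> * sqrt (real T)"
  show z: "0 \<le> expectation z"
    by (intro integral_nonneg_AE AE_I2) (auto simp: z_def intro: sum_nonneg)
  show s: "0 \<le> \<sigma> * sqrt (real T)"
    using params by simp
  show "1 \<le> lT" by (rule lT)
  have B: "0 < B"
    using z s by (simp add: B_def)
  have r: "expectation r \<le> B"
  proof -
    have "expectation r \<le> expectation (\<lambda>\<omega>. 1 + z \<omega> + sqrt (\<Sum>t=1..T. (norm (noise t \<omega>))\<^sup>2))"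
      using integrable_r integrable_z expectation_sqrt_noise_le(1) pathwise
      by (intro integral_mono_AE) (auto elim: eventually_mono)
    also have "\<dots> \<le> B"
      using integrable_z expectation_sqrt_noise_le by (simp add: B_def prob_space)
    finally show ?thesis .
  qed
  have r_nonneg: "AE \<omega> in P. 0 \<le> r \<omega>"
  proof (rule AE_I2)
    show "0 \<le> r \<omega>" for \<omega>
      using grad_sum_ge_1[of "G \<omega>" T] by (simp add: r_def)
  qed
  have q: "expectation (\<lambda>\<omega>. q \<omega> + (q \<omega>)\<^sup>2) \<le> (Cw + Cx) * lT\<^sup>2"
  proof -
    have "Cw * lT \<le> Cw * lT\<^sup>2"
      using lT constants_pos by (intro mult_left_mono) auto
    then show ?thesis
      using integrable_q expectation_q_le expectation_q_sq_le by (simp add: distrib_right)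
  qed
  have v: "expectation v \<le> C_c CARD('n) \<theta> L H * lT\<^sup>2"
  proof -
    have "C_c CARD('n) \<theta> L H * lT \<le> C_c CARD('n) \<theta> L H * lT\<^sup>2"
      using lT constants_pos by (intro mult_left_mono) auto
    then show ?thesis
      using expectation_v_le by simp
  qed
  have qr: "integrable P (\<lambda>\<omega>. sqrt ((q \<omega> + (q \<omega>)\<^sup>2) * r \<omega>))"
    "expectation (\<lambda>\<omega>. sqrt ((q \<omega> + (q \<omega>)\<^sup>2) * r \<omega>)) \<le> sqrt ((Cw + Cx) * lT\<^sup>2 * B)"
  proof -
    have "AE \<omega> in P. 0 \<le> q \<omega> + (q \<omega>)\<^sup>2"
      using pathwise by eventually_elim auto
    moreover have "integrable P (\<lambda>\<omega>. q \<omega> + (q \<omega>)\<^sup>2)"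
      using integrable_q by auto
    moreover have "0 < (Cw + Cx) * lT\<^sup>2"
      using constants_pos lT by (intro mult_pos_pos add_pos_nonneg) auto
    ultimately show "integrable P (\<lambda>\<omega>. sqrt ((q \<omega> + (q \<omega>)\<^sup>2) * r \<omega>))"
      "expectation (\<lambda>\<omega>. sqrt ((q \<omega> + (q \<omega>)\<^sup>2) * r \<omega>)) \<le> sqrt ((Cw + Cx) * lT\<^sup>2 * B)"
      using expectation_sqrt_mult_le[of "\<lambda>\<omega>. q \<omega> + (q \<omega>)\<^sup>2" _ r B] q integrable_r r_nonneg r B by blast+
  qed
  have vr: "integrable P (\<lambda>\<omega>. sqrt (v \<omega> * r \<omega>))"
    "expectation (\<lambda>\<omega>. sqrt (v \<omega> * r \<omega>)) \<le> sqrt (C_c CARD('n) \<theta> L H * lT\<^sup>2 * B)"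
  proof -
    have "AE \<omega> in P. 0 \<le> v \<omega>"
      using pathwise by eventually_elim auto
    moreover have "0 < C_c CARD('n) \<theta> L H * lT\<^sup>2"
      using constants_pos lT by (intro mult_pos_pos) auto
    ultimately show "integrable P (\<lambda>\<omega>. sqrt (v \<omega> * r \<omega>))"
      "expectation (\<lambda>\<omega>. sqrt (v \<omega> * r \<omega>)) \<le> sqrt (C_c CARD('n) \<theta> L H * lT\<^sup>2 * B)"
      using expectation_sqrt_mult_le[of v _ r B] v integrable_v integrable_r r_nonneg r B by blast+
  qed
  have w: "varpi H \<ge> 1" by (rule varpi_ge_1)
  have "expectation z \<le> expectation (\<lambda>\<omega>. sqrt ((q \<omega> + (q \<omega>)\<^sup>2) * r \<omega>) + sqrt (v \<omega> * r \<omega>))"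
    using integrable_z qr vr pathwise by (intro integral_mono_AE) (auto elim: eventually_mono)
  also have "\<dots> \<le> sqrt ((Cw + Cx) * lT\<^sup>2 * B) + sqrt (C_c CARD('n) \<theta> L H * lT\<^sup>2 * B)"
    using qr vr by simp
  also have "\<dots> = (sqrt (2 * (Cw + Cx)) + sqrt (2 * C_c CARD('n) \<theta> L H)) * (lT * sqrt (B / 2))"
  proof -
    \<comment> \<open>The 2 moved under the first root gives \<open>C_z\<close> its shape and leaves
      \<open>B / 2\<close>, the form expected by \<open>self_bounding_le\<close>.\<close>
    have "sqrt (K * lT\<^sup>2 * B) = sqrt (2 * K) * (lT * sqrt (B / 2))" for K
    proof -
      have "K * lT\<^sup>2 * B = (2 * K) * (lT\<^sup>2 * (B / 2))"
        by simp
      then show ?thesis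
        using lT by (simp only: real_sqrt_mult real_sqrt_abs abs_of_nonneg)
    qed
    then show ?thesis
      by (metis distrib_right)
  qed
  also have "\<dots> \<le> Cz * (lT * sqrt (B / 2))"
  proof (rule mult_right_mono)
    have "1 * (Cw + Cx) \<le> 4 * varpi H ^ 4 * (Cw + Cx)"
      using constants_pos one_le_power[OF w, of 4] by (intro mult_right_mono) linarith+
    moreover have "1 * C_c CARD('n) \<theta> L H \<le> varpi H * C_c CARD('n) \<theta> L H"
      using w constants_pos by (intro mult_right_mono) auto
    ultimately show "sqrt (2 * (Cw + Cx)) + sqrt (2 * C_c CARD('n) \<theta> L H) \<le> Cz"
      unfolding C_z_def C_v_def by (intro add_mono real_sqrt_le_mono) auto
    show "0 \<le> lT * sqrt (B / 2)"
      using lT B by simp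
  qed
  finally have "(expectation z)\<^sup>2 \<le> (Cz * (lT * sqrt (B / 2)))\<^sup>2"
    using z by (intro power_mono)
  also have "\<dots> = (Cz * lT)\<^sup>2 / 2 * B"
    using B by (simp add: power_mult_distrib)
  finally show "(expectation z)\<^sup>2 \<le> (Cz * lT)\<^sup>2 / 2 * (1 + expectation z + \<sigma> * sqrt (real T))"
    by (simp add: B_def)
  show "0 \<le> Cz"
    unfolding C_z_def C_v_def using w constants_pos by (intro add_nonneg_nonneg) auto
qed

lemma integrable_average: "integrable P (\<lambda>\<omega>. 1 / real T * (\<Sum>t=1..T. norm (N \<omega> t)))"
proof -
  have "integrable P (\<lambda>\<omega>. norm (N \<omega> t))" for t
    using norm_grad_le N_measurable_P by (intro integrable_bounded[where c = H]) auto
  then show ?thesis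
    by (intro integrable_mult_right Bochner_Integration.integrable_sum) auto
qed

text \<open>Cauchy--Schwarz over the steps bounds the average by
  \<open>z \<omega> / sqrt (real T)\<close>; in the noise term, \<open>T\<close> to the power
  \<open>1/4\<close> cancels against half of this.\<close>

lemma expectation_average_le:
  "expectation (\<lambda>\<omega>. 1 / real T * (\<Sum>t=1..T. norm (N \<omega> t)))
    \<le> C_A1 CARD('n) \<theta> L H (f X1 - fstar) * lT\<^sup>2 / real T powr (1/2)
      + C_A2 CARD('n) \<theta> L H (f X1 - fstar) * \<sigma> powr (1/2) * lT / real T powr (1/4)"
proof -
  have T0: "real T > 0" using T by simp
  have "expectation (\<lambda>\<omega>. 1 / real T * (\<Sum>t=1..T. norm (N \<omega> t))) \<le> expectation (\<lambda>\<omega>. 1 / sqrt (real T) * z \<omega>)"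
  proof (rule integral_mono[OF integrable_average])
    fix \<omega>
    have "(\<Sum>t=1..T. 1 * norm (N \<omega> t))\<^sup>2 \<le> (\<Sum>t=1..T. 1\<^sup>2) * (\<Sum>t=1..T. (norm (N \<omega> t))\<^sup>2)"
      by (rule Cauchy_Schwarz_ineq_sum)
    then have "(\<Sum>t=1..T. norm (N \<omega> t)) \<le> sqrt (real T * (\<Sum>t=1..T. (norm (N \<omega> t))\<^sup>2))"
      by (intro real_le_rsqrt) simp
    also have "\<dots> = sqrt (real T) * z \<omega>"
      by (simp add: z_def real_sqrt_mult)
    finally have "1 / real T * (\<Sum>t=1..T. norm (N \<omega> t)) \<le> 1 / real T * (sqrt (real T) * z \<omega>)"
      by (intro mult_left_mono) auto
    also have "\<dots> = sqrt (real T) / real T * z \<omega>"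
      by simp
    also have "\<dots> = 1 / sqrt (real T) * z \<omega>"
      by (simp only: sqrt_divide_self_eq of_nat_0_le_iff inverse_eq_divide)
    finally show "1 / real T * (\<Sum>t=1..T. norm (N \<omega> t)) \<le> 1 / sqrt (real T) * z \<omega>" .
  qed (use integrable_z in auto)
  also have "\<dots> = 1 / sqrt (real T) * expectation z"
    by simp
  also have "\<dots> \<le> 1 / sqrt (real T) * (Cz * sqrt (2 + 8 * Cz\<^sup>2) * lT\<^sup>2 + 2 powr (3/4) * Cz * lT * sqrt (\<sigma> * sqrt (real T)))"
    by (intro mult_left_mono expectation_z_le) auto
  also have "\<dots> = C_A1 CARD('n) \<theta> L H (f X1 - fstar) * lT\<^sup>2 / real T powr (1/2)
      + C_A2 CARD('n) \<theta> L H (f X1 - fstar) * \<sigma> powr (1/2) * lT / real T powr (1/4)"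
  proof -
    have 1: "real T powr (1/2) = sqrt (real T)" "\<sigma> powr (1/2) = sqrt \<sigma>"
      using params by (simp_all add: powr_half_sqrt)
    have "real T powr (1/4) = (real T powr (1/2)) powr (1/2)"
      by (simp add: powr_powr)
    then have 2: "real T powr (1/4) = sqrt (sqrt (real T))"
      using 1 by (simp add: powr_half_sqrt)
    have 3: "1 / sqrt (real T) * sqrt (sqrt (real T)) = 1 / sqrt (sqrt (real T))"
    proof -
      have "sqrt (real T) = sqrt (sqrt (real T)) * sqrt (sqrt (real T))"
        by simp
      then show ?thesis
        using T0 by (simp add: field_simps)
    qed
    have "1 / sqrt (real T) * (Cz * sqrt (2 + 8 * Cz\<^sup>2) * lT\<^sup>2 + 2 powr (3/4) * Cz * lT * sqrt (\<sigma> * sqrt (real T)))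
      = Cz * sqrt (2 + 8 * Cz\<^sup>2) * lT\<^sup>2 / sqrt (real T)
        + 2 powr (3/4) * Cz * lT * sqrt \<sigma> * (1 / sqrt (real T) * sqrt (sqrt (real T)))"
      by (simp add: real_sqrt_mult algebra_simps add_divide_distrib)
    then show ?thesis
      unfolding 1 2 3 C_A1_def C_A2_def by (simp add: mult_ac)
  qed
  finally show ?thesis .
qed

text \<open>The freezing principle with other roles: the path is frozen and the index is fresh.
  Integrating over the uniform index turns the norm at \<open>R \<omega>\<close> into the average
  over the steps.\<close>

lemma random_index:
  assumes R: "R \<in> measurable P (count_space UNIV)"
    and dist: "distr P (count_space UNIV) R = measure_pmf (pmf_of_set {1..T})"
    and ind: "indep_set (sets (vimage_algebra (space P) R (count_space UNIV)))
      (sets (vimage_algebra (space P) (\<lambda>\<omega>. \<lambda>t\<in>{1..}. \<xi> t \<omega>) (\<Pi>\<^sub>M t\<in>{1..}. D)))"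
  shows "integrable P (\<lambda>\<omega>. norm (N \<omega> (R \<omega>)))"
    and "expectation (\<lambda>\<omega>. norm (N \<omega> (R \<omega>))) = expectation (\<lambda>\<omega>. 1 / real T * (\<Sum>t=1..T. norm (N \<omega> t)))"
proof -
  let ?\<xi> = "\<lambda>\<omega>. \<lambda>t\<in>{1..}. \<xi> t \<omega>"
  let ?K = "vimage_algebra (space P) ?\<xi> (\<Pi>\<^sub>M t\<in>{1..}. D)"
  define \<phi> where "\<phi> p = norm (N (fst p) (snd p))" for p
  have xi: "?\<xi> \<in> measurable P (\<Pi>\<^sub>M t\<in>{1..}. D)"
    by (intro measurable_restrict xi_measurable) auto
  have sub: "subalgebra P ?K"
    by (rule subalgebra_vimage_algebra[OF xi])
  have xi_K: "\<xi> s \<in> measurable ?K D" if "1 \<le> s" for s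
  proof -
    have "?\<xi> \<in> measurable ?K (\<Pi>\<^sub>M t\<in>{1..}. D)"
      using measurable_space[OF xi] by (intro measurable_vimage_algebra1) auto
    from measurable_compose[OF this measurable_component_singleton[of s "{1..}" "\<lambda>_. D"]]
    show ?thesis using that by simp
  qed
  have "R \<in> space P \<rightarrow> space (count_space UNIV)" by simp
  note sets_R = sets_vimage_algebra2[OF this]
  have ind': "indep_set (sets ?K) {R -` B \<inter> space P |B. B \<in> sets (count_space UNIV)}"
  proof (rule indep_setI)
    show "sets ?K \<subseteq> events"
      using sub by (simp add: subalgebra_def)
    show "{R -` B \<inter> space P |B. B \<in> sets (count_space UNIV)} \<subseteq> events"
      using measurable_sets[OF R] by blast
    fix a b
    assume "a \<in> sets ?K" "b \<in> {R -` B \<inter> space P |B. B \<in> sets (count_space UNIV)}"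
    then have "prob (b \<inter> a) = prob b * prob a"
      unfolding sets_R[symmetric] by (intro indep_setD[OF ind])
    then show "prob (a \<inter> b) = prob a * prob b"
      by (simp add: Int_commute mult.commute)
  qed
  have \<phi>: "\<phi> \<in> borel_measurable (?K \<Otimes>\<^sub>M count_space UNIV)"
    unfolding \<phi>_def[abs_def]
  proof (rule measurable_compose_countable[where g = snd])
    fix i
    have "(\<lambda>\<omega>. N \<omega> i) \<in> borel_measurable ?K"
      by (intro N_measurable xi_K)
    from measurable_compose[OF measurable_fst this]
    show "(\<lambda>p. norm (N (fst p) i)) \<in> borel_measurable (?K \<Otimes>\<^sub>M count_space UNIV)"
      by measurable
  qed measurable
  have XR: "(\<lambda>\<omega>. norm (N \<omega> (R \<omega>))) \<in> borel_measurable P"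
  proof (rule measurable_compose_countable[OF _ R])
    show "(\<lambda>\<omega>. norm (N \<omega> i)) \<in> borel_measurable P" for i
      using N_measurable_P by measurable
  qed
  show int: "integrable P (\<lambda>\<omega>. norm (N \<omega> (R \<omega>)))"
    using norm_grad_le XR by (intro integrable_bounded[where c = H]) auto
  have "expectation (\<lambda>\<omega>. \<phi> (\<omega>, R \<omega>)) = expectation (\<lambda>\<omega>. \<integral>y. \<phi> (\<omega>, y) \<partial>distr P (count_space UNIV) R)"
    using int by (intro expectation_indep_pair[OF sub R ind' \<phi>]) (simp add: \<phi>_def)
  also have "\<dots> = expectation (\<lambda>\<omega>. 1 / real T * (\<Sum>t=1..T. norm (N \<omega> t)))"
    unfolding dist using T by (simp add: integral_pmf_of_set \<phi>_def)
  finally show "expectation (\<lambda>\<omega>. norm (N \<omega> (R \<omega>))) = expectation (\<lambda>\<omega>. 1 / real T * (\<Sum>t=1..T. norm (N \<omega> t)))"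
    by (simp add: \<phi>_def)
qed

end

end

theorem theorem14:
  fixes D :: "'x measure" and P :: "'w measure"
    and F :: "real^'n^'m \<Rightarrow> 'x \<Rightarrow> real" and f :: "real^'n^'m \<Rightarrow> real"
    and Orth :: "real^'n^'m \<Rightarrow> real^'n^'m"
    and \<xi> :: "nat \<Rightarrow> 'w \<Rightarrow> 'x" and X :: "nat \<Rightarrow> 'w \<Rightarrow> real^'n^'m"
    and X1 :: "real^'n^'m"
    and \<theta> L \<sigma> Ghat fstar B :: real and T :: nat
  assumes dims: "CARD('n) \<le> CARD('m)"
    and params: "\<theta> > 0" "L > 0" "\<sigma> \<ge> 0" "Ghat > 0"
    and D: "prob_space D"
    and F_integrable: "\<And>Y. integrable D (F Y)"
    and f_def: "\<And>Y. f Y = (\<integral>x. F Y x \<partial>D)"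
    and f_diff: "\<And>Y. f differentiable (at Y)"
    and F_diff: "\<And>x Y. x \<in> space D \<Longrightarrow> (\<lambda>Z. F Z x) differentiable (at Y)"
    and lower: "\<And>Y. f Y \<ge> fstar"
    and unbiased: "\<And>Y. has_bochner_integral D (\<lambda>x. grad (\<lambda>Z. F Z x) Y) (grad f Y)"
    and variance_integrable:
      "\<And>Y. integrable D (\<lambda>x. (norm (grad (\<lambda>Z. F Z x) Y - grad f Y))\<^sup>2)"
    and variance: "\<And>Y. (\<integral>x. (norm (grad (\<lambda>Z. F Z x) Y - grad f Y))\<^sup>2 \<partial>D) \<le> \<sigma>\<^sup>2"
    and smooth: "\<And>Y Z. norm (grad f Y - grad f Z) \<le> L * norm (Y - Z)"
    and bounded: "AE x in D. \<forall>Y. norm (grad (\<lambda>Z. F Z x) Y) \<le> Ghat"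
    and Orth: "orthogonalization Orth"
    and P: "prob_space P"
    and xi_indep: "prob_space.indep_vars P (\<lambda>_. D) \<xi> {1..}"
    and xi_distr: "\<And>t. t \<ge> 1 \<Longrightarrow> distr P D (\<xi> t) = D"
    and X_def: "\<And>t \<omega>. X t \<omega> = optmuon_A F Orth \<theta> X1 (\<lambda>s. \<xi> s \<omega>) t"
    and T: "T \<ge> 1"
    and B_def: "B = C_A1 CARD('n) \<theta> L Ghat (f X1 - fstar) * (ln (exp 1 + real T))\<^sup>2 / real T powr (1/2)
      + C_A2 CARD('n) \<theta> L Ghat (f X1 - fstar) * \<sigma> powr (1/2) * ln (exp 1 + real T) / real T powr (1/4)"
  shows "integrable P (\<lambda>\<omega>. 1 / real T * (\<Sum>t=1..T. norm (grad f (X t \<omega>)))) \<and>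
    (\<integral>\<omega>. 1 / real T * (\<Sum>t=1..T. norm (grad f (X t \<omega>))) \<partial>P) \<le> B \<and>
    (\<forall>R. R \<in> measurable P (count_space UNIV) \<and>
         distr P (count_space UNIV) R = measure_pmf (pmf_of_set {1..T}) \<and>
         prob_space.indep_set P
           (sets (vimage_algebra (space P) R (count_space UNIV)))
           (sets (vimage_algebra (space P) (\<lambda>\<omega>. \<lambda>t\<in>{1..}. \<xi> t \<omega>) (\<Pi>\<^sub>M t\<in>{1..}. D))) \<longrightarrow>
         integrable P (\<lambda>\<omega>. norm (grad f (X (R \<omega>) \<omega>))) \<and>
         (\<integral>\<omega>. norm (grad f (X (R \<omega>) \<omega>)) \<partial>P) \<le> B)"
proof -
  interpret optmuon_setup D P F f Orth \<xi> X X1 \<theta> L \<sigma> Ghat fstar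
  proof (rule optmuon_setup.intro)
    show "F Y \<in> borel_measurable D" for Y
      using F_integrable by auto
  qed (fact params D f_diff F_diff lower unbiased variance smooth bounded Orth P xi_indep xi_distr X_def)+
  show ?thesis
    using integrable_average[OF T] expectation_average_le[OF T, unfolded lT_def[OF T]] random_index[OF T]
    unfolding B_def by auto
qed

end
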